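(* Let $c,b\ge 1$ be real constants and let $\Phi$ be an implicit set system. If $\Phi$ is efficiently $(b,c)$-uniform, then there is an algorithm that, given an instance $I$, enumerates $\mathcal{F}_I$ in time $\left(1+b-\frac{1}{c}\right)^{n+o(n)}N^{O(1)}$.
   Context: An implicit set system is a function $\Phi$ that takes as input a string $I\in\{0,1\}^*$ (an instance) and outputs a set system $(U_I,\mathcal{F}_I)$, where $U_I$ is a finite universe and $\mathcal{F}_I$ is a collection of subsets of $U_I$; $n=|U_I|$, $N=|I|$, and $N\ge n$. For $X\subseteq U_I$ and an integer $k$, let $\mathcal{F}^k_{I,X}=\{S\subseteq U_I\setminus X: |S|=k \text{ and } S\cup X\in\mathcal{F}_I\}$. $\Phi$ is efficiently $(b,c)$-uniform if there is an algorithm that, given $I$, $X\subseteq U_I$ and an integer $k$, enumerates all elements of $\mathcal{F}^k_{I,X}$ in time $b^{n-|X|}c^{k}N^{O(1)}$.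
   Formalization: The algorithm is given the universe U_I (as an all-ones vector of length n) together with the instance I; from I alone the claim can fail, because nothing makes U_I computable from I within the time bound. *)

theory Defs
  imports Complex_Main "HOL-Library.Landau_Symbols"
begin

text \<open>
  Algorithms are programs of the language WHILE of Jones (``Computability and Complexity from a
  Programming Perspective''), whose data are binary trees and whose elementary operations
  cost one unit of time each.  Unit cost is realistic, since \<open>Cons\<close>, \<open>Hd\<close> and \<open>Tl\<close>
  are constant-time pointer operations on shared structures.  WHILE and the random access machine
  with logarithmic cost simulate each other with an overhead polylogarithmic in the running
  time (the memory of the machine being kept in a balanced tree).  For the running times considered
  below, such an overhead is polynomial in the instance size.
\<close>

datatype tree = Leaf | Node tree tree

fun left :: "tree \<Rightarrow> tree" where
  "left Leaf = Leaf"
| "left (Node l r) = l"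

fun right :: "tree \<Rightarrow> tree" where
  "right Leaf = Leaf"
| "right (Node l r) = r"

datatype expr = Var nat | Empty | Cons expr expr | Hd expr | Tl expr

datatype com =
    Skip
  | Assign nat expr
  | Seq com com
  | If expr com com
  | While expr com

type_synonym store = "nat \<Rightarrow> tree"

primrec eval_expr :: "expr \<Rightarrow> store \<Rightarrow> tree" where
  "eval_expr (Var x) s = s x"
| "eval_expr Empty s = Leaf"
| "eval_expr (Cons e f) s = Node (eval_expr e s) (eval_expr f s)"
| "eval_expr (Hd e) s = left (eval_expr e s)"
| "eval_expr (Tl e) s = right (eval_expr e s)"

primrec cost :: "expr \<Rightarrow> nat" where
  "cost (Var x) = 1"
| "cost Empty = 1"
| "cost (Cons e f) = cost e + cost f + 1"
| "cost (Hd e) = cost e + 1"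
| "cost (Tl e) = cost e + 1"

text \<open>
  \<open>exec p s t s'\<close>: started in the store \<open>s\<close>, the program \<open>p\<close> halts after exactly \<open>t\<close> time
  units in the store \<open>s'\<close>.  A test is false iff its value is \<open>Leaf\<close>.
\<close>

inductive exec :: "com \<Rightarrow> store \<Rightarrow> nat \<Rightarrow> store \<Rightarrow> bool" where
  Skip: "exec Skip s 1 s"
| Assign: "exec (Assign x e) s (cost e + 1) (s(x := eval_expr e s))"
| Seq: "exec p s t s' \<Longrightarrow> exec q s' t' s'' \<Longrightarrow> exec (Seq p q) s (t + t') s''"
| If_true: "eval_expr e s \<noteq> Leaf \<Longrightarrow> exec p s t s' \<Longrightarrow> exec (If e p q) s (cost e + 1 + t) s'"
| If_false: "eval_expr e s = Leaf \<Longrightarrow> exec q s t s' \<Longrightarrow> exec (If e p q) s (cost e + 1 + t) s'"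
| While_false: "eval_expr e s = Leaf \<Longrightarrow> exec (While e p) s (cost e + 1) s"
| While_true: "eval_expr e s \<noteq> Leaf \<Longrightarrow> exec p s t s' \<Longrightarrow> exec (While e p) s' t' s'' \<Longrightarrow>
    exec (While e p) s (cost e + 1 + t + t') s''"

definition computes_in :: "com \<Rightarrow> tree \<Rightarrow> tree \<Rightarrow> nat \<Rightarrow> bool" where
  "computes_in p inp out t \<longleftrightarrow>
     (\<exists>s. exec p ((\<lambda>_. Leaf)(0 := inp)) t s \<and> s 0 = out)"

lemma exec_deterministic:
  "exec p s t s' \<Longrightarrow> exec p s u s'' \<Longrightarrow> u = t \<and> s'' = s'"
proof (induction arbitrary: u s'' rule: exec.induct)
  case (Skip s)
  from Skip.prems show ?case by cases auto
next
  case (Assign x e s)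
  from Assign.prems show ?case by cases auto
next
  case (Seq p s t s' q t' s2)
  from Seq.prems show ?case by cases (use Seq.IH in blast)
next
  case (If_true e s p t s' q)
  from If_true.prems show ?case by cases (use If_true.IH If_true.hyps in blast)+
next
  case (If_false e s q t s' p)
  from If_false.prems show ?case by cases (use If_false.IH If_false.hyps in blast)+
next
  case (While_false e s p)
  from While_false.prems show ?case by cases (use While_false.hyps in auto)
next
  case (While_true e s p t s' t' s2)
  from While_true.prems show ?case by cases (use While_true.IH While_true.hyps in blast)+
qed

fun tree_of_list :: "tree list \<Rightarrow> tree" where
  "tree_of_list [] = Leaf"
| "tree_of_list (x # xs) = Node x (tree_of_list xs)"

definition tree_of_bits :: "bool list \<Rightarrow> tree" where
  "tree_of_bits bs = tree_of_list (map (\<lambda>b. if b then Node Leaf Leaf else Leaf) bs)"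

definition tree_of_nat :: "nat \<Rightarrow> tree" where
  "tree_of_nat k = tree_of_list (replicate k Leaf)"

text \<open>
  A subset \<open>X\<close> of a finite universe \<open>U\<close> is presented to a program as its characteristic vector,
  a list of \<open>card U\<close> bits.  The linear order on the elements serves only to index the vector.
\<close>

definition tree_of_subset :: "'a::linorder set \<Rightarrow> 'a set \<Rightarrow> tree" where
  "tree_of_subset U X = tree_of_bits (map (\<lambda>u. u \<in> X) (sorted_list_of_set U))"

type_synonym 'a set_system = "'a set \<times> 'a set set"

definition implicit_set_system :: "(bool list \<Rightarrow> 'a set_system) \<Rightarrow> bool" where
  "implicit_set_system \<Phi> \<longleftrightarrow>
     (\<forall>I. finite (fst (\<Phi> I)) \<and> snd (\<Phi> I) \<subseteq> Pow (fst (\<Phi> I)) \<and> card (fst (\<Phi> I)) \<le> length I)"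

definition extensions :: "'a set_system \<Rightarrow> 'a set \<Rightarrow> nat \<Rightarrow> 'a set set" where
  "extensions UF X k = {S. S \<subseteq> fst UF - X \<and> card S = k \<and> S \<union> X \<in> snd UF}"

text \<open>
  The program outputs a list in which each member of the family \<open>\<A>\<close> occurs exactly once.
\<close>

definition enumerates_in ::
    "com \<Rightarrow> tree \<Rightarrow> 'a::linorder set \<Rightarrow> 'a set set \<Rightarrow> nat \<Rightarrow> bool" where
  "enumerates_in p inp U \<A> t \<longleftrightarrow>
     (\<exists>L. distinct L \<and> set L = \<A> \<and>
        computes_in p inp (tree_of_list (map (tree_of_subset U) L)) t)"

text \<open>
  A factor \<open>N\<^sup>O\<^sup>(\<^sup>1\<^sup>)\<close> is rendered as \<open>C * (N + 1) ^ d\<close>, so that it does not vanish for the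
  empty instance.  The integer \<open>k\<close>, being a cardinality, is a natural number.
\<close>

definition efficiently_uniform ::
    "real \<Rightarrow> real \<Rightarrow> (bool list \<Rightarrow> 'a::linorder set_system) \<Rightarrow> bool" where
  "efficiently_uniform b c \<Phi> \<longleftrightarrow>
     (\<exists>p (C::real) (d::nat). \<forall>I X k. X \<subseteq> fst (\<Phi> I) \<longrightarrow>
        (\<exists>t. enumerates_in p
               (Node (tree_of_bits I) (Node (tree_of_subset (fst (\<Phi> I)) X) (tree_of_nat k)))
               (fst (\<Phi> I)) (extensions (\<Phi> I) X k) t \<and>
             real t \<le> b ^ (card (fst (\<Phi> I)) - card X) * c ^ k * (C * (real (length I) + 1) ^ d)))"

text \<open>
  Nothing in the notion of an implicit set system makes \<open>U\<^sub>I\<close>, or even its size, computable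
  from the string \<open>I\<close>.  Giving an instance to an algorithm therefore means giving it \<open>I\<close>
  together with \<open>U\<^sub>I\<close>, the latter as the all-ones vector of length \<open>card U\<^sub>I\<close>.  (In
  \<open>efficiently_uniform\<close> this information is already carried by the vector of \<open>X\<close>.)
\<close>

definition tree_of_instance :: "(bool list \<Rightarrow> 'a::linorder set_system) \<Rightarrow> bool list \<Rightarrow> tree" where
  "tree_of_instance \<Phi> I = Node (tree_of_bits I) (tree_of_subset (fst (\<Phi> I)) (fst (\<Phi> I)))"

end

theory Submission
  imports Defs
begin

text \<open>
  Fix a block size \<open>s\<close>.  For every \<open>k \<le> s\<close> choose \<open>j \<le> k\<close> and, greedily, a family of \<open>(k - j)\<close>-subsets
  of the block such that every \<open>k\<close>-subset contains a member \<open>X\<close>; the pair \<open>(X, j)\<close> is a pattern.  With the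
  right \<open>j\<close> the sum \<open>W\<close> of \<open>b ^ (s - card X) * c ^ j\<close> over all patterns is at most
  \<open>(s + 1) ^ 3 * \<alpha> ^ s\<close>, where \<open>\<alpha> = 1 + b - 1 / c\<close>.  Cut the universe into blocks and choose a pattern
  in each: every member of the family arises from a query to the given algorithm, and since the
  bound on its running time is multiplicative over the blocks, all queries together cost
  \<open>W ^ (n / s)\<close> up to a polynomial, which for large \<open>s\<close> is below \<open>\<alpha> ^ ((1 + \<epsilon>) * n)\<close>.  The last
  pattern of the list that fits a block is declared responsible for it, so nothing is listed twice.

  Good patterns depend on \<open>b\<close> and \<open>c\<close>, which need not be computable.  Hence the program searches for
  them: in round \<open>i\<close> it tries finitely many candidate lists, checks that they cover all subsets of
  a block, and runs the enumeration with a budget of \<open>2 ^ i\<close> steps.  A fixed list of patterns is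
  reached after a constant number of rounds, so that for every \<open>\<epsilon>\<close> only the constant factor is
  affected, and a diagonal argument turns the constants into the term \<open>o(n)\<close>.
\<close>

section \<open>Reasoning about WHILE programs with time bounds\<close>

text \<open>The base is the value of a binomial sum. A family of \<open>(k - j)\<close>-subsets such
  that every \<open>k\<close>-subset of a block contains a member has, up to a polynomial factor,
  the size \<open>(s choose k) / ((s - k + j) choose j)\<close> that averaging suggests, and each
  member costs \<open>b ^ (s - k + j) * c ^ j\<close>. For \<open>p = 1 / (b * c)\<close> one has
  \<open>b * (1 - p) = b - 1 / c\<close>, and the terms of \<open>(1 + (b - 1 / c)) ^ s\<close>
  bound the product for a suitable \<open>j\<close>; this is \<open>exchange\<close>. Blocks are
  used because a covering family for the whole universe is exponentially large and building it
  greedily means handling all \<open>k\<close>-subsets; for constant \<open>s\<close> it is a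
  constant object, and the factor \<open>(s + 1) ^ 3\<close> per block disappears in \<epsilon> as
  \<open>s\<close> grows. For one \<epsilon> the patterns could be written into the program, but one
  program has to serve all \<epsilon>. The search is possible because completeness of the output
  rests only on coverage, which can be tested on a single block: a bad candidate is slow or
  rejected, never wrong. Doubling the budgets makes knowledge of the time bound unnecessary.\<close>

definition runs :: "com \<Rightarrow> store \<Rightarrow> nat \<Rightarrow> (store \<Rightarrow> bool) \<Rightarrow> bool" where
  "runs p s T Q \<longleftrightarrow> (\<exists>t s'. exec p s t s' \<and> t \<le> T \<and> Q s')"

inductive_cases exec_SkipE: "exec Skip s t s'"
inductive_cases exec_AssignE: "exec (Assign x e) s t s'"
inductive_cases exec_SeqE: "exec (Seq p q) s t s'"
inductive_cases exec_IfE: "exec (If e p q) s t s'"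
inductive_cases exec_WhileE: "exec (While e p) s t s'"

lemma exec_Skip_iff: "exec Skip s t s' \<longleftrightarrow> t = 1 \<and> s' = s"
  by (metis exec.Skip exec_SkipE)

lemma exec_Assign_iff: "exec (Assign x e) s t s' \<longleftrightarrow> t = cost e + 1 \<and> s' = s(x := eval_expr e s)"
  by (metis exec.Assign exec_AssignE)

lemma exec_Seq_iff:
  "exec (Seq p q) s t s' \<longleftrightarrow> (\<exists>t1 t2 r. t = t1 + t2 \<and> exec p s t1 r \<and> exec q r t2 s')"
  by (metis exec.Seq exec_SeqE)

lemma exec_If_iff:
  "exec (If e p q) s t s' \<longleftrightarrow>
     (\<exists>t'. t = cost e + 1 + t' \<and> exec (if eval_expr e s \<noteq> Leaf then p else q) s t' s')"
proof
  assume "exec (If e p q) s t s'"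
  then show "\<exists>t'. t = cost e + 1 + t' \<and> exec (if eval_expr e s \<noteq> Leaf then p else q) s t' s'"
    by (rule exec_IfE) auto
next
  assume "\<exists>t'. t = cost e + 1 + t' \<and> exec (if eval_expr e s \<noteq> Leaf then p else q) s t' s'"
  then obtain t' where t': "t = cost e + 1 + t'"
    "exec (if eval_expr e s \<noteq> Leaf then p else q) s t' s'" by blast
  then show "exec (If e p q) s t s'"
    unfolding t'(1) by (cases "eval_expr e s = Leaf") (auto intro: exec.If_true exec.If_false simp del: add_Suc One_nat_def)
qed

lemma exec_While_iff:
  "exec (While e p) s t s' \<longleftrightarrow>
     (if eval_expr e s = Leaf then t = cost e + 1 \<and> s' = s
      else \<exists>t1 t2 r. t = cost e + 1 + t1 + t2 \<and> exec p s t1 r \<and> exec (While e p) r t2 s')"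
proof
  assume "exec (While e p) s t s'"
  then show "if eval_expr e s = Leaf then t = cost e + 1 \<and> s' = s
      else \<exists>t1 t2 r. t = cost e + 1 + t1 + t2 \<and> exec p s t1 r \<and> exec (While e p) r t2 s'"
    by (rule exec_WhileE) auto
qed (use exec.While_false exec.While_true in \<open>metis\<close>)

lemma runs_Skip: "runs Skip s T Q \<longleftrightarrow> 1 \<le> T \<and> Q s"
  by (auto simp: runs_def exec_Skip_iff)

lemma runs_Assign: "runs (Assign x e) s T Q \<longleftrightarrow> cost e + 1 \<le> T \<and> Q (s(x := eval_expr e s))"
  by (auto simp: runs_def exec_Assign_iff)

lemma ex_shift: "(\<exists>t. (\<exists>t'. t = c + t' \<and> P t') \<and> t \<le> T) \<longleftrightarrow> c \<le> T \<and> (\<exists>t'. P t' \<and> t' \<le> T - c)"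
  for c T :: nat
  by (metis add_leE le_diff_conv2 add.commute)

lemma runs_If: "runs (If e p q) s T Q \<longleftrightarrow> cost e + 1 \<le> T \<and>
    (if eval_expr e s \<noteq> Leaf then runs p s (T - (cost e + 1)) Q else runs q s (T - (cost e + 1)) Q)"
proof -
  have "runs (If e p q) s T Q \<longleftrightarrow> (\<exists>t. (\<exists>t'. t = (cost e + 1) + t' \<and>
      (\<exists>s'. exec (if eval_expr e s \<noteq> Leaf then p else q) s t' s' \<and> Q s')) \<and> t \<le> T)"
    unfolding runs_def exec_If_iff by blast
  also have "\<dots> \<longleftrightarrow> cost e + 1 \<le> T \<and> (\<exists>t'. (\<exists>s'. exec (if eval_expr e s \<noteq> Leaf then p else q) s t' s' \<and> Q s')
       \<and> t' \<le> T - (cost e + 1))"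
    by (rule ex_shift)
  finally show ?thesis unfolding runs_def by auto
qed

lemma runs_weaken: "runs p s T Q \<Longrightarrow> T \<le> T' \<Longrightarrow> (\<And>s'. Q s' \<Longrightarrow> Q' s') \<Longrightarrow> runs p s T' Q'"
  unfolding runs_def by (meson le_trans)

lemma runs_Seq: "runs p s T1 (\<lambda>s'. runs q s' T2 Q) \<Longrightarrow> T1 + T2 \<le> T \<Longrightarrow> runs (Seq p q) s T Q"
proof -
  assume "runs p s T1 (\<lambda>s'. runs q s' T2 Q)" and T: "T1 + T2 \<le> T"
  then obtain t1 r t2 s' where "exec p s t1 r" "t1 \<le> T1" "exec q r t2 s'" "t2 \<le> T2" "Q s'"
    by (auto simp: runs_def)
  then show ?thesis
    unfolding runs_def using T by (intro exI[of _ "t1 + t2"] exI[of _ s']) (auto intro: exec.Seq)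
qed

lemma runs_Seq_Skip: "runs (Seq Skip q) s T Q \<longleftrightarrow> 1 \<le> T \<and> runs q s (T - 1) Q"
proof -
  have "runs (Seq Skip q) s T Q \<longleftrightarrow> (\<exists>t. (\<exists>t'. t = 1 + t' \<and> (\<exists>s'. exec q s t' s' \<and> Q s')) \<and> t \<le> T)"
    unfolding runs_def exec_Seq_iff exec_Skip_iff by blast
  then show ?thesis unfolding ex_shift runs_def by auto
qed

lemma runs_Seq_Assign: "runs (Seq (Assign x e) q) s T Q \<longleftrightarrow>
    cost e + 1 \<le> T \<and> runs q (s(x := eval_expr e s)) (T - (cost e + 1)) Q"
proof -
  have "runs (Seq (Assign x e) q) s T Q \<longleftrightarrow> (\<exists>t. (\<exists>t'. t = (cost e + 1) + t' \<and>
     (\<exists>s'. exec q (s(x := eval_expr e s)) t' s' \<and> Q s')) \<and> t \<le> T)"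
    unfolding runs_def exec_Seq_iff exec_Assign_iff by blast
  then show ?thesis unfolding ex_shift runs_def by auto
qed

lemma runs_Seq_assoc: "runs (Seq (Seq p q) r) s T Q \<longleftrightarrow> runs (Seq p (Seq q r)) s T Q"
proof -
  have "exec (Seq (Seq p q) r) s t s' \<longleftrightarrow> exec (Seq p (Seq q r)) s t s'" for t s'
    unfolding exec_Seq_iff by (metis add.assoc)
  then show ?thesis by (simp add: runs_def)
qed

lemma runs_Seq_If: "runs (Seq (If e p q) r) s T Q \<longleftrightarrow> runs (If e (Seq p r) (Seq q r)) s T Q"
proof -
  have "exec (Seq (If e p q) r) s t s' \<longleftrightarrow> exec (If e (Seq p r) (Seq q r)) s t s'" for t s'
    unfolding exec_Seq_iff exec_If_iff
    by (cases "eval_expr e s = Leaf") (auto simp: exec_Seq_iff, (metis add.assoc add_Suc)+)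
  then show ?thesis by (simp add: runs_def)
qed

text \<open>Rewriting with these equivalences executes loop-free code symbolically: sequences are
  nested to the right, a conditional takes over its continuation, and the remaining time is handed
  on by subtraction, the conjunct \<open>cost e + 1 \<le> T\<close> guarding against
  truncation.\<close>

lemmas runs_simps = runs_Skip runs_Assign runs_If runs_Seq_Skip runs_Seq_Assign runs_Seq_If
  runs_Seq_assoc

text \<open>Every iteration lowers \<mu>, so there are at most \<open>\<mu> s\<close> of them; the
  additional 1 pays for the final failing test.\<close>

lemma runs_While:
  assumes "Inv s"
    and step: "\<And>s. Inv s \<Longrightarrow> eval_expr e s \<noteq> Leaf \<Longrightarrow> runs p s B (\<lambda>s'. Inv s' \<and> \<mu> s' < (\<mu> s :: nat))"
    and fin: "\<And>s. Inv s \<Longrightarrow> eval_expr e s = Leaf \<Longrightarrow> Q s"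
    and T: "(\<mu> s + 1) * (B + cost e + 1) \<le> T"
  shows "runs (While e p) s T Q"
proof -
  have "runs (While e p) s ((\<mu> s + 1) * (B + cost e + 1)) Q"
    using \<open>Inv s\<close>
  proof (induction "\<mu> s" arbitrary: s rule: less_induct)
    case less
    show ?case
    proof (cases "eval_expr e s = Leaf")
      case True
      have "exec (While e p) s (cost e + 1) s" using True by (rule exec.While_false)
      then show ?thesis using fin[OF less.prems True] unfolding runs_def
        by (intro exI[of _ "cost e + 1"] exI[of _ s]) simp
    next
      case False
      from step[OF less.prems False] obtain t1 r where r: "exec p s t1 r" "t1 \<le> B" "Inv r" "\<mu> r < \<mu> s"
        by (auto simp: runs_def)
      from less.hyps[OF r(4,3)] obtain t2 s' where s': "exec (While e p) r t2 s'"
         "t2 \<le> (\<mu> r + 1) * (B + cost e + 1)" "Q s'" by (auto simp: runs_def)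
      have "exec (While e p) s (cost e + 1 + t1 + t2) s'"
        using exec.While_true[OF False r(1) s'(1)] .
      moreover have "(\<mu> r + 1) * (B + cost e + 1) \<le> \<mu> s * (B + cost e + 1)"
        using r(4) by (intro mult_right_mono) auto
      then have "cost e + 1 + t1 + t2 \<le> (\<mu> s + 1) * (B + cost e + 1)"
        using r(2) s'(2) by simp
      ultimately show ?thesis using s'(3) unfolding runs_def by blast
    qed
  qed
  then show ?thesis using T by (auto intro: runs_weaken)
qed

text \<open>The list expression is evaluated only once, into the private register \<open>l\<close>;
  the body may therefore overwrite the register that is being traversed, as \<open>double\<close>
  does.\<close>

definition For :: "nat \<Rightarrow> nat \<Rightarrow> expr \<Rightarrow> com \<Rightarrow> com" where
  "For v l e p = Seq (Assign l e) (While (Var l)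
     (Seq (Assign v (Hd (Var l))) (Seq (Assign l (Tl (Var l))) p)))"

lemma tree_of_list_eq_Leaf [simp]: "tree_of_list xs = Leaf \<longleftrightarrow> xs = []"
  by (cases xs) auto

text \<open>\<open>Inv\<close> takes the list of elements that are still to be processed.\<close>

lemma runs_For:
  fixes B :: "tree \<Rightarrow> nat"
  assumes e: "eval_expr e s = tree_of_list xs"
    and "v \<noteq> l"
    and init: "Inv xs (s(l := tree_of_list xs))"
    and step: "\<And>x ys s. Inv (x # ys) s \<Longrightarrow> x \<in> set xs \<Longrightarrow> s l = Node x (tree_of_list ys) \<Longrightarrow>
       runs p (s(v := x, l := tree_of_list ys)) (B x) (\<lambda>s'. s' l = tree_of_list ys \<and> Inv ys s')"
    and fin: "\<And>s. Inv [] s \<Longrightarrow> s l = Leaf \<Longrightarrow> Q s"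
    and T: "cost e + 3 + (\<Sum>x\<leftarrow>xs. B x + 8) \<le> T"
  shows "runs (For v l e p) s T Q"
proof -
  let ?P = "Seq (Assign v (Hd (Var l))) (Seq (Assign l (Tl (Var l))) p)"
  have loop: "runs (While (Var l) ?P) s (2 + (\<Sum>x\<leftarrow>ys. B x + 8)) Q"
    if "Inv ys s" "s l = tree_of_list ys" "set ys \<subseteq> set xs" for ys s
    using that
  proof (induction ys arbitrary: s)
    case Nil
    have "exec (While (Var l) ?P) s (cost (Var l) + 1) s"
      using Nil by (intro exec.While_false) auto
    moreover have "Q s" using fin[OF Nil(1)] Nil(2) by simp
    ultimately show ?case unfolding runs_def
      by (intro exI[of _ "cost (Var l) + 1"] exI[of _ s]) simp
  next
    case (Cons x ys)
    have "runs p (s(v := x, l := tree_of_list ys)) (B x) (\<lambda>s'. s' l = tree_of_list ys \<and> Inv ys s')"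
      using Cons.prems by (intro step) auto
    then have "runs ?P s (B x + 6) (\<lambda>s'. s' l = tree_of_list ys \<and> Inv ys s')"
      using Cons.prems(2) \<open>v \<noteq> l\<close> by (simp add: runs_simps)
    then obtain t1 r where r: "exec ?P s t1 r" "t1 \<le> B x + 6" "r l = tree_of_list ys" "Inv ys r"
      by (auto simp: runs_def)
    from Cons.IH[OF r(4,3)] Cons.prems(3) obtain t2 s' where s': "exec (While (Var l) ?P) r t2 s'"
      "t2 \<le> 2 + (\<Sum>x\<leftarrow>ys. B x + 8)" "Q s'" by (auto simp: runs_def)
    have "exec (While (Var l) ?P) s (cost (Var l) + 1 + t1 + t2) s'"
      by (rule exec.While_true[OF _ r(1) s'(1)]) (use Cons.prems in auto)
    moreover have "cost (Var l) + 1 + t1 + t2 \<le> 2 + (\<Sum>x\<leftarrow>x # ys. B x + 8)"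
      using r(2) s'(2) by simp
    ultimately show ?case unfolding runs_def using s'(3) by blast
  qed
  show ?thesis
    unfolding For_def runs_simps
    using e T loop[OF init] by (auto elim!: runs_weaken)
qed

section \<open>Subroutine calls by shifting registers\<close>

primrec var_bound_e :: "expr \<Rightarrow> nat" where
  "var_bound_e (Var x) = Suc x"
| "var_bound_e Empty = 0"
| "var_bound_e (Cons e f) = max (var_bound_e e) (var_bound_e f)"
| "var_bound_e (Hd e) = var_bound_e e"
| "var_bound_e (Tl e) = var_bound_e e"

primrec var_bound :: "com \<Rightarrow> nat" where
  "var_bound Skip = 0"
| "var_bound (Assign x e) = max (Suc x) (var_bound_e e)"
| "var_bound (Seq p q) = max (var_bound p) (var_bound q)"
| "var_bound (If e p q) = max (var_bound_e e) (max (var_bound p) (var_bound q))"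
| "var_bound (While e p) = max (var_bound_e e) (var_bound p)"

primrec rename_vars_e :: "nat \<Rightarrow> expr \<Rightarrow> expr" where
  "rename_vars_e k (Var x) = Var (k + x)"
| "rename_vars_e k Empty = Empty"
| "rename_vars_e k (Cons e f) = Cons (rename_vars_e k e) (rename_vars_e k f)"
| "rename_vars_e k (Hd e) = Hd (rename_vars_e k e)"
| "rename_vars_e k (Tl e) = Tl (rename_vars_e k e)"

primrec rename_vars :: "nat \<Rightarrow> com \<Rightarrow> com" where
  "rename_vars k Skip = Skip"
| "rename_vars k (Assign x e) = Assign (k + x) (rename_vars_e k e)"
| "rename_vars k (Seq p q) = Seq (rename_vars k p) (rename_vars k q)"
| "rename_vars k (If e p q) = If (rename_vars_e k e) (rename_vars k p) (rename_vars k q)"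
| "rename_vars k (While e p) = While (rename_vars_e k e) (rename_vars k p)"

lemma cost_rename_vars [simp]: "cost (rename_vars_e k e) = cost e"
  by (induction e) auto

lemma eval_rename_vars: "var_bound_e e \<le> m \<Longrightarrow> (\<And>v. v < m \<Longrightarrow> z (k + v) = s v) \<Longrightarrow>
   eval_expr (rename_vars_e k e) z = eval_expr e s"
  by (induction e) auto

text \<open>Shifting all registers by \<open>k\<close> turns an arbitrary program into a subroutine
  that leaves the caller's registers below \<open>k\<close> alone. Agreement of the stores is
  demanded on finitely many registers only, because only those can be cleared before a call.\<close>

lemma exec_rename_vars:
  "exec p s t s' \<Longrightarrow> var_bound p \<le> m \<Longrightarrow> (\<And>v. v < m \<Longrightarrow> z (k + v) = s v) \<Longrightarrow>
   \<exists>z'. exec (rename_vars k p) z t z' \<and> (\<forall>v<m. z' (k + v) = s' v) \<and> (\<forall>v<k. z' v = z v)"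
proof (induction arbitrary: z rule: exec.induct)
  case (Skip s)
  then show ?case by (auto simp: exec_Skip_iff)
next
  case (Assign x e s)
  then show ?case using eval_rename_vars[of e m z k s] by (auto simp: exec_Assign_iff)
next
  case (Seq p s t s' q t' s'')
  from Seq.IH(1)[of z] Seq.prems obtain z1 where z1: "exec (rename_vars k p) z t z1"
    "\<forall>v<m. z1 (k + v) = s' v" "\<forall>v<k. z1 v = z v" by auto
  from Seq.IH(2)[of z1] Seq.prems z1 obtain z2 where z2: "exec (rename_vars k q) z1 t' z2"
    "\<forall>v<m. z2 (k + v) = s'' v" "\<forall>v<k. z2 v = z1 v" by auto
  show ?case using exec.Seq[OF z1(1) z2(1)] z1 z2 by auto
next
  case (If_true e s p t s' q)
  from If_true.IH[of z] If_true.prems obtain z1 where z1: "exec (rename_vars k p) z t z1"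
    "\<forall>v<m. z1 (k + v) = s' v" "\<forall>v<k. z1 v = z v" by auto
  have "eval_expr (rename_vars_e k e) z \<noteq> Leaf"
    using If_true.hyps If_true.prems eval_rename_vars[of e m z k s] by auto
  from exec.If_true[OF this z1(1)] show ?case using z1 by auto
next
  case (If_false e s q t s' p)
  from If_false.IH[of z] If_false.prems obtain z1 where z1: "exec (rename_vars k q) z t z1"
    "\<forall>v<m. z1 (k + v) = s' v" "\<forall>v<k. z1 v = z v" by auto
  have "eval_expr (rename_vars_e k e) z = Leaf"
    using If_false.hyps If_false.prems eval_rename_vars[of e m z k s] by auto
  from exec.If_false[OF this z1(1)] show ?case using z1 by auto
next
  case (While_false e s p)
  have "eval_expr (rename_vars_e k e) z = Leaf"
    using While_false.hyps While_false.prems eval_rename_vars[of e m z k s] by auto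
  from exec.While_false[OF this] show ?case using While_false.prems by auto
next
  case (While_true e s p t s' t' s'')
  from While_true.IH(1)[of z] While_true.prems obtain z1 where z1: "exec (rename_vars k p) z t z1"
    "\<forall>v<m. z1 (k + v) = s' v" "\<forall>v<k. z1 v = z v" by auto
  from While_true.IH(2)[of z1] While_true.prems z1 obtain z2 where z2:
    "exec (While (rename_vars_e k e) (rename_vars k p)) z1 t' z2"
    "\<forall>v<m. z2 (k + v) = s'' v" "\<forall>v<k. z2 v = z1 v" by auto
  have "eval_expr (rename_vars_e k e) z \<noteq> Leaf"
    using While_true.hyps While_true.prems eval_rename_vars[of e m z k s] by auto
  from exec.While_true[OF this z1(1) z2(1)] show ?case using z1 z2 by auto
qed

lemma eval_expr_cong: "(\<And>v. v < var_bound_e e \<Longrightarrow> s v = z v) \<Longrightarrow> eval_expr e s = eval_expr e z"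
  by (induction e) auto

primrec clear :: "nat \<Rightarrow> nat \<Rightarrow> com" where
  "clear k 0 = Skip"
| "clear k (Suc m) = Seq (clear k m) (Assign (k + m) Empty)"

lemma runs_clear:
  "runs (clear k m) s (2 * m + 1) (\<lambda>s'. (\<forall>v<m. s' (k + v) = Leaf) \<and> (\<forall>v<k. s' v = s v))"
proof (induction m)
  case (Suc m)
  show ?case unfolding clear.simps
    by (rule runs_Seq[OF runs_weaken[OF Suc, of "2 * m + 1"], of _ 2])
       (auto simp: runs_simps less_Suc_eq)
qed (auto simp: runs_simps)

text \<open>\<open>computes_in\<close> starts from a store that is \<open>Leaf\<close> outside
  register 0, so leftovers of an earlier call have to be cleared. The \<open>Suc\<close> keeps the
  input register in range even if \<open>p\<close> mentions no variable.\<close>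

definition call :: "nat \<Rightarrow> com \<Rightarrow> expr \<Rightarrow> nat \<Rightarrow> com" where
  "call k p e r = Seq (clear k (Suc (var_bound p))) (Seq (Assign k e) (Seq (rename_vars k p) (Assign r (Var k))))"

lemma runs_call:
  assumes "computes_in p (eval_expr e s) y t" "var_bound_e e \<le> k" "r < k"
    and "t + 2 * var_bound p + cost e + 7 \<le> T"
  shows "runs (call k p e r) s T (\<lambda>s'. s' r = y \<and> (\<forall>v<k. v \<noteq> r \<longrightarrow> s' v = s v))"
  unfolding call_def
proof (rule runs_Seq[OF runs_weaken[OF runs_clear order.refl], where ?T2.0 = "t + cost e + 4"])
  fix s1 assume s1: "(\<forall>v<Suc (var_bound p). s1 (k + v) = Leaf) \<and> (\<forall>v<k. s1 v = s v)"
  let ?z = "s1(k := eval_expr e s1)"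
  have e: "eval_expr e s1 = eval_expr e s"
    using assms s1 by (intro eval_expr_cong) auto
  obtain s' where s': "exec p ((\<lambda>_. Leaf)(0 := eval_expr e s)) t s'" "s' 0 = y"
    using assms by (auto simp: computes_in_def)
  have "?z (k + v) = ((\<lambda>_. Leaf)(0 := eval_expr e s)) v" if "v < Suc (var_bound p)" for v
    using s1 e that by simp
  from exec_rename_vars[OF s'(1), of "Suc (var_bound p)" ?z k, OF _ this] obtain z' where z': "exec (rename_vars k p) ?z t z'"
     "\<forall>v<Suc (var_bound p). z' (k + v) = s' v" "\<forall>v<k. z' v = ?z v"
    by (meson le_SucI order_refl)
  have "z' (k + 0) = y" using z'(2) s'(2) by blast
  then have "z' k = y" by simp
  show "runs (Seq (Assign k e) (Seq (rename_vars k p) (Assign r (Var k)))) s1 (t + cost e + 4)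
     (\<lambda>s'. s' r = y \<and> (\<forall>v<k. v \<noteq> r \<longrightarrow> s' v = s v))"
    unfolding runs_simps
  proof (intro conjI runs_Seq[of _ _ t _ 2])
    show "runs (rename_vars k p) ?z t (\<lambda>s'. runs (Assign r (Var k)) s' 2 (\<lambda>s'. s' r = y \<and> (\<forall>v<k. v \<noteq> r \<longrightarrow> s' v = s v)))"
      unfolding runs_def[of "rename_vars k p"] using z' s1 \<open>z' k = y\<close>
      by (intro exI[of _ t] exI[of _ z']) (auto simp: runs_simps)
  qed auto
qed (use assms in auto)

section \<open>Output length is bounded by running time\<close>

primrec height :: "tree \<Rightarrow> nat" where
  "height Leaf = 0"
| "height (Node l r) = Suc (max (height l) (height r))"

lemma height_left: "height (left t) \<le> height t" and height_right: "height (right t) \<le> height t"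
  by (cases t; simp)+

text \<open>Height is the right measure: \<open>Cons (Var x) (Var x)\<close> can double the number
  of nodes in constant time by sharing, whereas the height grows by at most the cost.\<close>

lemma height_eval: "(\<And>v. height (s v) \<le> H) \<Longrightarrow> height (eval_expr e s) \<le> H + cost e"
proof (induction e)
  case (Hd e) then show ?case using height_left[of "eval_expr e s"] by fastforce
next
  case (Tl e) then show ?case using height_right[of "eval_expr e s"] by fastforce
next
  case (Cons e f)
  then have "height (eval_expr e s) \<le> H + cost e" "height (eval_expr f s) \<le> H + cost f" by blast+
  then show ?case by simp
qed (auto simp: trans_le_add1 le_SucI)

lemma height_exec: "exec p s t s' \<Longrightarrow> (\<And>v. height (s v) \<le> H) \<Longrightarrow> height (s' v) \<le> H + t"
proof (induction arbitrary: H v rule: exec.induct)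
  case (Assign x e s)
  have "height (eval_expr e s) \<le> H + cost e" using Assign by (rule height_eval)
  then show ?case using Assign[of v] by simp
next
  case (Seq p s t s' q t' s'')
  have "height (s'' v) \<le> H + t + t'" using Seq by blast
  then show ?case by simp
next
  case (If_true e s p t s' q)
  have "height (s' v) \<le> H + t" using If_true by blast
  then show ?case by simp
next
  case (If_false e s q t s' p)
  have "height (s' v) \<le> H + t" using If_false by blast
  then show ?case by simp
next
  case (While_true e s p t s' t' s'')
  have "height (s'' v) \<le> H + t + t'" using While_true by blast
  then show ?case by simp
qed (auto intro: le_SucI trans_le_add1)

lemma length_le_height: "length xs \<le> height (tree_of_list xs)"
  by (induction xs) auto

text \<open>The given algorithm comes with a time bound only; this turns it into a bound on the
  number of sets it lists, over which the caller has to loop.\<close>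

lemma length_computes_in:
  assumes "computes_in p x (tree_of_list ys) t"
  shows "length ys \<le> height x + t"
proof -
  obtain s where s: "exec p ((\<lambda>_. Leaf)(0 := x)) t s" "s 0 = tree_of_list ys"
    using assms by (auto simp: computes_in_def)
  have "height (s 0) \<le> height x + t" by (rule height_exec[OF s(1)]) auto
  then show ?thesis using length_le_height[of ys] s(2) by simp
qed

section \<open>Programs with a step budget\<close>

text \<open>Only loops consume the budget in register \<open>b\<close>, one unit per iteration; the remaining
  program text costs a constant.  When the budget is exhausted, every loop is left, and the store
  is meaningless.\<close>

primrec clock :: "nat \<Rightarrow> nat \<Rightarrow> com \<Rightarrow> com" where
  "clock b f Skip = Skip"
| "clock b f (Assign x e) = Assign x e"
| "clock b f (Seq p q) = Seq (clock b f p) (clock b f q)"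
| "clock b f (If e p q) = If e (clock b f p) (clock b f q)"
| "clock b f (While e p) = Seq (If (Var b) (Assign f e) (Assign f Empty))
     (While (Var f) (Seq (clock b f p) (Seq (Assign b (Tl (Var b)))
       (If (Var b) (Assign f e) (Assign f Empty)))))"

lemma tree_of_nat_simps [simp]:
  "tree_of_nat 0 = Leaf" "tree_of_nat (Suc n) = Node Leaf (tree_of_nat n)"
  by (simp_all add: tree_of_nat_def)

lemma tree_of_nat_eq_Leaf [simp]: "tree_of_nat n = Leaf \<longleftrightarrow> n = 0"
  by (cases n) auto

lemma right_tree_of_nat [simp]: "right (tree_of_nat n) = tree_of_nat (n - 1)"
  by (cases n) auto

definition agree :: "nat set \<Rightarrow> store \<Rightarrow> store \<Rightarrow> bool" where
  "agree M s z \<longleftrightarrow> (\<forall>v. v \<notin> M \<longrightarrow> s v = z v)"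

lemma agree_eval: "agree {..<k} s z \<Longrightarrow> eval_expr (rename_vars_e k e) s = eval_expr (rename_vars_e k e) z"
  by (induction e) (auto simp: agree_def)

text \<open>The execution of \<open>c\<close> is asserted unconditionally, so the clocked program
  halts even where \<open>p\<close> diverges. Time is charged to the consumed part of the budget,
  which makes it additive over sequences and loop rounds. A halting run of \<open>p\<close> takes at
  least as many steps as units are consumed, hence a budget above its running time is never
  exhausted.\<close>

definition clocked :: "nat \<Rightarrow> nat \<Rightarrow> nat \<Rightarrow> com \<Rightarrow> com \<Rightarrow> store \<Rightarrow> nat \<Rightarrow> nat \<Rightarrow> store \<Rightarrow> nat \<Rightarrow> nat \<Rightarrow> bool" where
  "clocked k b f p c s \<beta> T s' \<beta>' K \<longleftrightarrow> exec c s T s' \<and> s' b = tree_of_nat \<beta>' \<and> \<beta>' \<le> \<beta> \<and>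
     T \<le> K * (1 + (\<beta> - \<beta>')) \<and> (\<forall>v<k. v \<noteq> b \<and> v \<noteq> f \<longrightarrow> s' v = s v) \<and>
     (\<forall>z t z'. agree {..<k} s z \<and> exec p z t z' \<longrightarrow> \<beta> \<le> \<beta>' + t \<and> (\<beta>' \<noteq> 0 \<longrightarrow> agree {..<k} s' z'))"

text \<open>\<open>K\<close> depends on the program text alone, since between two decrements of the
  budget only a bounded amount of loop-free code is executed. Loop rounds are handled by induction
  on the budget and not on an execution, as the original loop may diverge.\<close>

lemma clocked_clock:
  assumes "b < k" "f < k" "b \<noteq> f"
  shows "\<exists>K. \<forall>s \<beta>. s b = tree_of_nat \<beta> \<longrightarrow>
    (\<exists>T s' \<beta>'. clocked k b f (rename_vars k p) (clock b f (rename_vars k p)) s \<beta> T s' \<beta>' K)"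
proof (induction p)
  case Skip
  show ?case
    by (rule exI[of _ 1]) (auto simp: clocked_def exec_Skip_iff)
next
  case (Assign x e)
  show ?case
  proof (rule exI[of _ "cost e + 1"], intro allI impI)
    fix s \<beta> assume "s b = tree_of_nat \<beta>"
    then have "clocked k b f (rename_vars k (Assign x e)) (clock b f (rename_vars k (Assign x e))) s \<beta> (cost e + 1)
       (s(k + x := eval_expr (rename_vars_e k e) s)) \<beta> (cost e + 1)"
      using assms by (auto simp: clocked_def exec_Assign_iff agree_eval) (auto simp: agree_def)
    then show "\<exists>T s' \<beta>'. clocked k b f (rename_vars k (Assign x e)) (clock b f (rename_vars k (Assign x e))) s \<beta> T s' \<beta>' (cost e + 1)"
      by blast
  qed
next
  case (Seq p q)
  then obtain K1 K2 where
    K1: "\<And>s \<beta>. s b = tree_of_nat \<beta> \<Longrightarrow> \<exists>T s' \<beta>'. clocked k b f (rename_vars k p) (clock b f (rename_vars k p)) s \<beta> T s' \<beta>' K1" and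
    K2: "\<And>s \<beta>. s b = tree_of_nat \<beta> \<Longrightarrow> \<exists>T s' \<beta>'. clocked k b f (rename_vars k q) (clock b f (rename_vars k q)) s \<beta> T s' \<beta>' K2"
    by meson
  show ?case
  proof (rule exI[of _ "K1 + K2"], intro allI impI)
    fix s \<beta> assume "s b = tree_of_nat \<beta>"
    from K1[of s \<beta>, OF this] obtain T1 s1 \<beta>1 where c1: "clocked k b f (rename_vars k p) (clock b f (rename_vars k p)) s \<beta> T1 s1 \<beta>1 K1"
      by blast
    then have "s1 b = tree_of_nat \<beta>1" by (simp add: clocked_def)
    from K2[of s1 \<beta>1, OF this] obtain T2 s2 \<beta>2 where c2: "clocked k b f (rename_vars k q) (clock b f (rename_vars k q)) s1 \<beta>1 T2 s2 \<beta>2 K2"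
      by blast
    have le: "\<beta>1 \<le> \<beta>" "\<beta>2 \<le> \<beta>1" using c1 c2 by (auto simp: clocked_def)
    have "T1 \<le> K1 * (1 + (\<beta> - \<beta>2))" "T2 \<le> K2 * (1 + (\<beta> - \<beta>2))"
      using c1 c2 le by (auto simp: clocked_def elim!: order.trans)
    then have "T1 + T2 \<le> (K1 + K2) * (1 + (\<beta> - \<beta>2))" by (simp only: distrib_right add_mono)
    moreover have "\<beta> \<le> \<beta>2 + t \<and> (\<beta>2 \<noteq> 0 \<longrightarrow> agree {..<k} s2 z')"
      if z: "agree {..<k} s z" and ex: "exec (Seq (rename_vars k p) (rename_vars k q)) z t z'" for z t z'
    proof -
      from ex obtain t1 t2 r where r: "t = t1 + t2" "exec (rename_vars k p) z t1 r" "exec (rename_vars k q) r t2 z'"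
        by (auto simp: exec_Seq_iff)
      have 1: "\<beta> \<le> \<beta>1 + t1" "\<beta>1 \<noteq> 0 \<longrightarrow> agree {..<k} s1 r"
        using c1 z r(2) unfolding clocked_def by blast+
      \<comment> \<open>If the first part uses up the budget, the second part runs on a meaningless
        store; but then \<open>\<beta>2 = 0\<close> as well, and nothing is claimed about the
        store.\<close>
      show ?thesis
      proof (cases "\<beta>1 = 0")
        case False
        then have "\<beta>1 \<le> \<beta>2 + t2 \<and> (\<beta>2 \<noteq> 0 \<longrightarrow> agree {..<k} s2 z')"
          using c2 1(2) r(3) unfolding clocked_def by blast
        then show ?thesis using 1 r(1) by auto
      qed (use 1 le r in auto)
    qed
    ultimately have "clocked k b f (rename_vars k (Seq p q)) (clock b f (rename_vars k (Seq p q))) s \<beta> (T1 + T2) s2 \<beta>2 (K1 + K2)"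
      using c1 c2 le unfolding clocked_def by (auto intro: exec.Seq)
    then show "\<exists>T s' \<beta>'. clocked k b f (rename_vars k (Seq p q)) (clock b f (rename_vars k (Seq p q))) s \<beta> T s' \<beta>' (K1 + K2)"
      by blast
  qed
next
  case (If e p q)
  then obtain K1 K2 where
    K1: "\<And>s \<beta>. s b = tree_of_nat \<beta> \<Longrightarrow> \<exists>T s' \<beta>'. clocked k b f (rename_vars k p) (clock b f (rename_vars k p)) s \<beta> T s' \<beta>' K1" and
    K2: "\<And>s \<beta>. s b = tree_of_nat \<beta> \<Longrightarrow> \<exists>T s' \<beta>'. clocked k b f (rename_vars k q) (clock b f (rename_vars k q)) s \<beta> T s' \<beta>' K2"
    by meson
  let ?K = "cost e + 1 + K1 + K2"
  show ?case
  proof (rule exI[of _ ?K], intro allI impI)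
    fix s \<beta> assume sb: "s b = tree_of_nat \<beta>"
    define r where "r = (if eval_expr (rename_vars_e k e) s \<noteq> Leaf then p else q)"
    define K where "K = (if eval_expr (rename_vars_e k e) s \<noteq> Leaf then K1 else K2)"
    obtain T1 s1 \<beta>1 where c1: "clocked k b f (rename_vars k r) (clock b f (rename_vars k r)) s \<beta> T1 s1 \<beta>1 K"
      using K1[of s \<beta>, OF sb] K2[of s \<beta>, OF sb] unfolding r_def K_def by presburger
    have "T1 \<le> K * (1 + (\<beta> - \<beta>1))" using c1 by (simp add: clocked_def)
    also have "\<dots> \<le> (K1 + K2) * (1 + (\<beta> - \<beta>1))" by (rule mult_right_mono) (auto simp: K_def)
    finally have T: "cost e + 1 + T1 \<le> ?K * (1 + (\<beta> - \<beta>1))" by (simp add: algebra_simps)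
    have ex: "exec (clock b f (rename_vars k (If e p q))) s (cost e + 1 + T1) s1"
      using c1 unfolding clocked_def r_def
      by (auto simp: exec_If_iff split: if_splits)
    have ag: "\<beta> \<le> \<beta>1 + t \<and> (\<beta>1 \<noteq> 0 \<longrightarrow> agree {..<k} s1 z')"
      if z: "agree {..<k} s z" and ex: "exec (rename_vars k (If e p q)) z t z'" for z t z'
    proof -
      obtain t' where "t = cost e + 1 + t'" "exec (rename_vars k r) z t' z'"
        using ex unfolding r_def agree_eval[OF z] by (auto simp: exec_If_iff split: if_splits)
      moreover from this have "\<beta> \<le> \<beta>1 + t' \<and> (\<beta>1 \<noteq> 0 \<longrightarrow> agree {..<k} s1 z')"
        using c1 z unfolding clocked_def by blast
      ultimately show ?thesis by auto
    qed
    have "clocked k b f (rename_vars k (If e p q)) (clock b f (rename_vars k (If e p q))) s \<beta> (cost e + 1 + T1) s1 \<beta>1 ?K"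
      using c1 T ex ag unfolding clocked_def by blast
    then show "\<exists>T s' \<beta>'. clocked k b f (rename_vars k (If e p q)) (clock b f (rename_vars k (If e p q))) s \<beta> T s' \<beta>' ?K"
      by blast
  qed
next
  case (While e p)
  then obtain Kp where
    Kp: "\<And>s \<beta>. s b = tree_of_nat \<beta> \<Longrightarrow> \<exists>T s' \<beta>'. clocked k b f (rename_vars k p) (clock b f (rename_vars k p)) s \<beta> T s' \<beta>' Kp"
    by meson
  let ?e = "rename_vars_e k e"
  let ?I = "If (Var b) (Assign f ?e) (Assign f Empty)"
  let ?P = "Seq (clock b f (rename_vars k p)) (Seq (Assign b (Tl (Var b))) ?I)"
  let ?W = "While (Var f) ?P"
  define K where "K = 2 * (Kp + cost e + 10)"
  define upd where "upd s = s(f := if s b = Leaf then Leaf else eval_expr ?e s)" for s :: store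
  have I: "\<exists>t. exec ?I s t (upd s) \<and> t \<le> cost e + 4" for s
    by (auto simp: exec_If_iff exec_Assign_iff upd_def)
  have loop: "\<exists>T s' \<beta>'. clocked k b f (While ?e (rename_vars k p)) ?W s \<beta> T s' \<beta>' K"
    if "s b = tree_of_nat \<beta>" "s f = (if \<beta> = 0 then Leaf else eval_expr ?e s)" for s \<beta>
    using that
  proof (induction \<beta> arbitrary: s rule: less_induct)
    case (less \<beta>)
    show ?case
    proof (cases "s f = Leaf")
      case True
      have "exec ?W s 2 s" using exec.While_false[of "Var f" s ?P] True by (simp add: numeral_2_eq_2)
      moreover have "\<beta> \<le> \<beta> + t \<and> (\<beta> \<noteq> 0 \<longrightarrow> agree {..<k} s z')"
        if z: "agree {..<k} s z" and ex: "exec (While ?e (rename_vars k p)) z t z'" for z t z'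
        using True less.prems(2) z ex
        by (subst (asm) exec_While_iff) (auto simp: agree_eval[OF z] split: if_splits)
      ultimately have "clocked k b f (While ?e (rename_vars k p)) ?W s \<beta> 2 s \<beta> K"
        using less.prems by (auto simp: clocked_def K_def)
      then show ?thesis by blast
    next
      case False
      then have \<beta>: "\<beta> \<noteq> 0" and e: "eval_expr ?e s \<noteq> Leaf"
        using less.prems(2) by (auto split: if_splits)
      from Kp[of s \<beta>, OF less.prems(1)] obtain T1 s1 \<beta>1 where
        c1: "clocked k b f (rename_vars k p) (clock b f (rename_vars k p)) s \<beta> T1 s1 \<beta>1 Kp" by blast
      define s2 where "s2 = upd (s1(b := right (s1 b)))"
      obtain t3 where t3: "exec ?I (s1(b := right (s1 b))) t3 s2" "t3 \<le> cost e + 4"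
        using I unfolding s2_def by blast
      have P: "exec ?P s (T1 + (3 + t3)) s2"
        using c1 t3(1) unfolding clocked_def by (intro exec.Seq) (auto simp: exec_Assign_iff)
      have le: "\<beta>1 \<le> \<beta>" and T1: "T1 \<le> Kp * (1 + (\<beta> - \<beta>1))" using c1 by (auto simp: clocked_def)
      have s1b: "s1 b = tree_of_nat \<beta>1" using c1 by (auto simp: clocked_def)
      have s2: "s2 b = tree_of_nat (\<beta>1 - 1)" "s2 f = (if \<beta>1 - 1 = 0 then Leaf else eval_expr ?e s2)"
        "agree {..<k} s2 s1"
      proof -
        show "s2 b = tree_of_nat (\<beta>1 - 1)"
          using s1b assms by (simp add: s2_def upd_def)
        show ag: "agree {..<k} s2 s1"
          using assms by (auto simp: s2_def upd_def agree_def)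
        have "agree {..<k} (s1(b := right (s1 b))) s2"
          using assms by (auto simp: s2_def upd_def agree_def)
        then have "eval_expr ?e (s1(b := right (s1 b))) = eval_expr ?e s2" by (rule agree_eval)
        moreover have "s2 f = (if right (s1 b) = Leaf then Leaf else eval_expr ?e (s1(b := right (s1 b))))"
          by (simp add: s2_def upd_def)
        ultimately show "s2 f = (if \<beta>1 - 1 = 0 then Leaf else eval_expr ?e s2)"
          using s1b by simp
      qed
      have "\<beta>1 - 1 < \<beta>" using le \<beta> by simp
      from less.IH[of "\<beta>1 - 1" s2, OF this s2(1,2)] obtain T2 s3 \<beta>3 where
        c2: "clocked k b f (While ?e (rename_vars k p)) ?W s2 (\<beta>1 - 1) T2 s3 \<beta>3 K" by blast
      have ex: "exec ?W s (2 + (T1 + (3 + t3)) + T2) s3"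
        using exec.While_true[OF _ P, of "Var f" T2 s3] False c2 by (simp add: clocked_def)
      define D where "D = \<beta> - (\<beta>1 - 1)"
      have le3: "\<beta>3 \<le> \<beta>1 - 1" and T2: "T2 \<le> K * (1 + (\<beta>1 - 1 - \<beta>3))"
        using c2 by (auto simp: clocked_def)
      \<comment> \<open>The factor 2 is for \<open>\<beta>1 = 0\<close>: the decrement then finds
        nothing left to remove, so \<open>D = \<beta>\<close>, while the body was charged
        \<open>1 + \<beta>\<close>.\<close>
      have D: "1 \<le> D" "1 + (\<beta> - \<beta>1) \<le> 2 * D" using le \<beta> by (auto simp: D_def)
      have "cost e + 9 \<le> (cost e + 9) * D" using D(1) by (cases D) auto
      moreover have "T1 \<le> Kp * (2 * D)" using order.trans[OF T1 mult_left_mono[OF D(2)]] by simp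
      ultimately have "2 + (T1 + (3 + t3)) \<le> Kp * (2 * D) + (cost e + 9) * D"
        using t3(2) by linarith
      also have "\<dots> \<le> K * D" by (simp add: K_def algebra_simps)
      finally have "2 + (T1 + (3 + t3)) + T2 \<le> K * (1 + (D + (\<beta>1 - 1 - \<beta>3)))"
        using T2 by (simp add: algebra_simps)
      also have "D + (\<beta>1 - 1 - \<beta>3) = \<beta> - \<beta>3" using le3 le \<beta> by (auto simp: D_def)
      finally have T: "2 + (T1 + (3 + t3)) + T2 \<le> K * (1 + (\<beta> - \<beta>3))" .
      have ag: "\<beta> \<le> \<beta>3 + t \<and> (\<beta>3 \<noteq> 0 \<longrightarrow> agree {..<k} s3 z')"
        if z: "agree {..<k} s z" and exz: "exec (While ?e (rename_vars k p)) z t z'" for z t z'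
      proof -
        have "eval_expr ?e z \<noteq> Leaf" using e agree_eval[OF z] by simp
        then obtain t1 t2 r where r: "t = cost ?e + 1 + t1 + t2" "exec (rename_vars k p) z t1 r"
          "exec (While ?e (rename_vars k p)) r t2 z'" using exz by (subst (asm) exec_While_iff) auto
        have 1: "\<beta> \<le> \<beta>1 + t1" "\<beta>1 \<noteq> 0 \<longrightarrow> agree {..<k} s1 r"
          using c1 z r(2) unfolding clocked_def by blast+
        show ?thesis
        proof (cases "\<beta>1 = 0")
          case False
          then have "agree {..<k} s2 r" using 1(2) s2(3) by (auto simp: agree_def)
          then have "\<beta>1 - 1 \<le> \<beta>3 + t2 \<and> (\<beta>3 \<noteq> 0 \<longrightarrow> agree {..<k} s3 z')"
            using c2 r(3) unfolding clocked_def by blast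
          then show ?thesis using 1 r(1) by auto
        qed (use 1 le3 r in auto)
      qed
      have fr: "s3 v = s v" if "v < k" "v \<noteq> b" "v \<noteq> f" for v
      proof -
        have "s3 v = s2 v" using c2 that by (simp add: clocked_def)
        also have "\<dots> = s1 v" using that by (simp add: s2_def upd_def)
        also have "\<dots> = s v" using c1 that by (simp add: clocked_def)
        finally show ?thesis .
      qed
      have "clocked k b f (While ?e (rename_vars k p)) ?W s \<beta> (2 + (T1 + (3 + t3)) + T2) s3 \<beta>3 K"
        unfolding clocked_def using ex T ag fr le3 \<open>\<beta>1 - 1 < \<beta>\<close> c2 by (auto simp: clocked_def)
      then show ?thesis by blast
    qed
  qed
  show ?case
  proof (rule exI[of _ "cost e + 4 + K"], intro allI impI)
    fix s \<beta> assume sb: "s b = tree_of_nat \<beta>"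
    obtain t1 where t1: "exec ?I s t1 (upd s)" "t1 \<le> cost e + 4" using I by blast
    have ag: "agree {..<k} (upd s) s" "agree {..<k} s (upd s)"
      using assms by (auto simp: upd_def agree_def)
    have "upd s b = tree_of_nat \<beta>" "upd s f = (if \<beta> = 0 then Leaf else eval_expr ?e (upd s))"
      using sb assms agree_eval[OF ag(1)] by (auto simp: upd_def)
    from loop[of "upd s" \<beta>, OF this] obtain T s' \<beta>' where
      c: "clocked k b f (While ?e (rename_vars k p)) ?W (upd s) \<beta> T s' \<beta>' K" by blast
    have "exec (Seq ?I ?W) s (t1 + T) s'" using t1(1) c by (auto simp: clocked_def intro: exec.Seq)
    moreover have "t1 + T \<le> (cost e + 4 + K) * (1 + (\<beta> - \<beta>'))"
    proof -
      have "T \<le> K * (1 + (\<beta> - \<beta>'))" using c by (simp add: clocked_def)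
      moreover have "t1 \<le> (cost e + 4) * (1 + (\<beta> - \<beta>'))" using t1(2) by simp
      ultimately show ?thesis unfolding distrib_right[of "cost e + 4"] by (rule add_mono[rotated])
    qed
    moreover have "\<beta> \<le> \<beta>' + t \<and> (\<beta>' \<noteq> 0 \<longrightarrow> agree {..<k} s' z')"
      if z: "agree {..<k} s z" and exz: "exec (While ?e (rename_vars k p)) z t z'" for z t z'
    proof -
      have "agree {..<k} (upd s) z" using ag(1) z by (auto simp: agree_def)
      then show ?thesis using c exz unfolding clocked_def by blast
    qed
    moreover have "\<forall>v<k. v \<noteq> b \<and> v \<noteq> f \<longrightarrow> s' v = s v"
      using c by (auto simp: clocked_def upd_def)
    ultimately have "clocked k b f (rename_vars k (While e p)) (clock b f (rename_vars k (While e p))) s \<beta> (t1 + T) s' \<beta>' (cost e + 4 + K)"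
      using c unfolding clocked_def clock.simps rename_vars.simps by blast
    then show "\<exists>T s' \<beta>'. clocked k b f (rename_vars k (While e p)) (clock b f (rename_vars k (While e p))) s \<beta> T s' \<beta>' (cost e + 4 + K)"
      by blast
  qed
qed

definition clocked_call :: "nat \<Rightarrow> nat \<Rightarrow> nat \<Rightarrow> com \<Rightarrow> expr \<Rightarrow> nat \<Rightarrow> com" where
  "clocked_call k b f p e r = Seq (clear k (Suc (var_bound p)))
     (Seq (Assign k e) (Seq (clock b f (rename_vars k p)) (Assign r (Var k))))"

text \<open>The remaining budget doubles as a certificate: if it is nonempty, the result is genuine.
  Each consumed unit is matched by a step of the original run, so \<open>t < \<beta>\<close> leaves
  at least one unit.\<close>

lemma runs_clocked_call:
  assumes "b < k" "f < k" "b \<noteq> f" "var_bound_e e \<le> k" "r < k" "r \<noteq> b"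
  shows "\<exists>K. \<forall>s \<beta> y t. computes_in p (eval_expr e s) y t \<longrightarrow> s b = tree_of_nat \<beta> \<longrightarrow>
     runs (clocked_call k b f p e r) s (K * (\<beta> + 1))
       (\<lambda>s'. (s' b \<noteq> Leaf \<longrightarrow> s' r = y) \<and> (t < \<beta> \<longrightarrow> s' b \<noteq> Leaf) \<and>
             (\<forall>v<k. v \<noteq> b \<and> v \<noteq> f \<and> v \<noteq> r \<longrightarrow> s' v = s v))"
proof -
  obtain K where K: "\<And>s \<beta>. s b = tree_of_nat \<beta> \<Longrightarrow>
    \<exists>T s' \<beta>'. clocked k b f (rename_vars k p) (clock b f (rename_vars k p)) s \<beta> T s' \<beta>' K"
    using clocked_clock[OF assms(1-3), of p] by blast
  let ?K = "2 * var_bound p + cost e + 6 + K"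
  show ?thesis
  proof (rule exI[of _ ?K], intro allI impI)
    fix s \<beta> y t assume c: "computes_in p (eval_expr e s) y t" and sb: "s b = tree_of_nat \<beta>"
    show "runs (clocked_call k b f p e r) s (?K * (\<beta> + 1))
       (\<lambda>s'. (s' b \<noteq> Leaf \<longrightarrow> s' r = y) \<and> (t < \<beta> \<longrightarrow> s' b \<noteq> Leaf) \<and>
             (\<forall>v<k. v \<noteq> b \<and> v \<noteq> f \<and> v \<noteq> r \<longrightarrow> s' v = s v))"
      unfolding clocked_call_def
    proof (rule runs_Seq[OF runs_weaken[OF runs_clear order.refl], where ?T2.0 = "K * (\<beta> + 1) + cost e + 3"])
      fix s1 assume s1: "(\<forall>v<Suc (var_bound p). s1 (k + v) = Leaf) \<and> (\<forall>v<k. s1 v = s v)"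
      let ?z = "s1(k := eval_expr e s1)"
      have e: "eval_expr e s1 = eval_expr e s"
        using assms s1 by (intro eval_expr_cong) auto
      obtain s' where s': "exec p ((\<lambda>_. Leaf)(0 := eval_expr e s)) t s'" "s' 0 = y"
        using c by (auto simp: computes_in_def)
      have "?z (k + v) = ((\<lambda>_. Leaf)(0 := eval_expr e s)) v" if "v < Suc (var_bound p)" for v
        using s1 e that by simp
      from exec_rename_vars[OF s'(1), of "Suc (var_bound p)" ?z k, OF _ this] obtain z' where z': "exec (rename_vars k p) ?z t z'"
         "\<forall>v<Suc (var_bound p). z' (k + v) = s' v" "\<forall>v<k. z' v = ?z v"
        by (meson le_SucI order_refl)
      have "z' (k + 0) = y" using z'(2) s'(2) by blast
      then have z'k: "z' k = y" by simp
      have "?z b = tree_of_nat \<beta>" using s1 sb assms by simp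
      from K[of ?z \<beta>, OF this] obtain T s2 \<beta>' where
        c2: "clocked k b f (rename_vars k p) (clock b f (rename_vars k p)) ?z \<beta> T s2 \<beta>' K" by blast
      have "agree {..<k} ?z ?z" by (simp add: agree_def)
      with c2 z'(1) have ag: "\<beta> \<le> \<beta>' + t" "\<beta>' \<noteq> 0 \<longrightarrow> agree {..<k} s2 z'"
        unfolding clocked_def by blast+
      have "T \<le> K * (1 + (\<beta> - \<beta>'))" using c2 by (simp add: clocked_def)
      also have "\<dots> \<le> K * (\<beta> + 1)" by (intro mult_left_mono) auto
      finally have T: "T \<le> K * (\<beta> + 1)" .
      have s2: "exec (clock b f (rename_vars k p)) ?z T s2" "s2 b = tree_of_nat \<beta>'"
        "\<forall>v<k. v \<noteq> b \<and> v \<noteq> f \<longrightarrow> s2 v = s v" "\<beta>' \<noteq> 0 \<longrightarrow> s2 k = y"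
        using c2 s1 ag(2) z'k by (auto simp: clocked_def agree_def)
      show "runs (Seq (Assign k e) (Seq (clock b f (rename_vars k p)) (Assign r (Var k)))) s1 (K * (\<beta> + 1) + cost e + 3)
        (\<lambda>s'. (s' b \<noteq> Leaf \<longrightarrow> s' r = y) \<and> (t < \<beta> \<longrightarrow> s' b \<noteq> Leaf) \<and>
             (\<forall>v<k. v \<noteq> b \<and> v \<noteq> f \<and> v \<noteq> r \<longrightarrow> s' v = s v))"
        unfolding runs_simps
      proof (intro conjI runs_Seq[of _ _ T _ 2])
        show "runs (clock b f (rename_vars k p)) ?z T (\<lambda>s'. runs (Assign r (Var k)) s' 2
          (\<lambda>s'. (s' b \<noteq> Leaf \<longrightarrow> s' r = y) \<and> (t < \<beta> \<longrightarrow> s' b \<noteq> Leaf) \<and>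
             (\<forall>v<k. v \<noteq> b \<and> v \<noteq> f \<and> v \<noteq> r \<longrightarrow> s' v = s v)))"
          unfolding runs_def[of "clock b f (rename_vars k p)"] using s2 ag assms
          by (intro exI[of _ T] exI[of _ s2]) (auto simp: runs_simps)
      qed (use T in auto)
    qed auto
  qed
qed

section \<open>Search over all candidate trees\<close>

text \<open>The candidates of round \<open>i\<close> are \<open>fst (candidates i)\<close>; the second component is a queue of
  trees that still have to be added, refilled with all pairs of candidates once it is empty.\<close>

definition pairs :: "tree list \<Rightarrow> tree list" where
  "pairs E = fold (\<lambda>x. fold (\<lambda>y. (#) (Node x y)) E) E []"

fun candidates :: "nat \<Rightarrow> tree list \<times> tree list" where
  "candidates 0 = ([Leaf], [])"
| "candidates (Suc i) = (case candidates i of (E, g # G) \<Rightarrow> (g # E, G) | (E, []) \<Rightarrow> (E, pairs E))"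

lemma candidates_Suc_Cons: "candidates i = (E, g # G) \<Longrightarrow> candidates (Suc i) = (g # E, G)"
  and candidates_Suc_Nil: "candidates i = (E, []) \<Longrightarrow> candidates (Suc i) = (E, pairs E)"
  by simp_all

text \<open>Only one candidate is added per round, so that trying all of them costs a factor linear
  in \<open>i\<close>, small compared with the doubling budgets.\<close>

lemma length_candidates: "length (fst (candidates i)) \<le> Suc i"
  by (induction i) (auto split: prod.split list.split)

lemma fold_Cons: "fold (\<lambda>y. (#) (f y)) ys acc = rev (map f ys) @ acc"
  by (induction ys arbitrary: acc) auto

lemma set_fold_pairs:
  "set (fold (\<lambda>x. fold (\<lambda>y. (#) (Node x y)) E) xs acc) = {Node x y |x y. x \<in> set xs \<and> y \<in> set E} \<union> set acc"
  by (induction xs arbitrary: acc) (auto simp: fold_Cons)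

lemma set_pairs: "set (pairs E) = {Node x y |x y. x \<in> set E \<and> y \<in> set E}"
  by (simp add: pairs_def set_fold_pairs)

lemma candidates_mono: "i \<le> j \<Longrightarrow> set (fst (candidates i)) \<subseteq> set (fst (candidates j))"
proof (induction j rule: dec_induct)
  case (step j)
  then show ?case by (auto split: prod.split list.split)
qed auto

lemma candidates_flush: "\<exists>j\<ge>i. set (snd (candidates i)) \<subseteq> set (fst (candidates j)) \<and> snd (candidates j) = []"
proof (induction "length (snd (candidates i))" arbitrary: i)
  case 0
  then show ?case by auto
next
  case (Suc n)
  obtain E g G where c: "candidates i = (E, g # G)"
    using Suc.hyps(2) by (metis length_Suc_conv prod.collapse)
  then have "n = length (snd (candidates (Suc i)))" using Suc.hyps(2) by simp
  from Suc.hyps(1)[OF this] obtain j where j: "j \<ge> Suc i" "set (snd (candidates (Suc i))) \<subseteq> set (fst (candidates j))"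
     "snd (candidates j) = []" by blast
  moreover have "g \<in> set (fst (candidates j))" using candidates_mono[OF j(1)] candidates_Suc_Cons[OF c] by auto
  ultimately show ?case using c candidates_Suc_Cons[OF c] by (intro exI[of _ j]) auto
qed

text \<open>From some round on both subtrees are candidates; when the queue runs empty for the next
  time, it is refilled with all pairs, hence with their node, and then drained into the
  candidates.\<close>

lemma candidates_surj: "\<exists>i. a \<in> set (fst (candidates i))"
proof (induction a)
  case Leaf
  show ?case by (rule exI[of _ 0]) simp
next
  case (Node x y)
  then obtain i1 i2 where "x \<in> set (fst (candidates i1))" "y \<in> set (fst (candidates i2))" by blast
  then have xy: "x \<in> set (fst (candidates (max i1 i2)))" "y \<in> set (fst (candidates (max i1 i2)))"
    using candidates_mono[of i1 "max i1 i2"] candidates_mono[of i2 "max i1 i2"] by auto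
  obtain j where j: "j \<ge> max i1 i2" "snd (candidates j) = []" using candidates_flush by blast
  have "Node x y \<in> set (snd (candidates (Suc j)))"
    using candidates_Suc_Nil[of j "fst (candidates j)"] j(2) xy candidates_mono[OF j(1)]
    by (cases "candidates j") (auto simp: set_pairs)
  then show ?case using candidates_flush[of "Suc j"] by blast
qed

section \<open>The search loop\<close>

definition rank :: "tree \<Rightarrow> nat" where
  "rank a = (LEAST i. a \<in> set (fst (candidates i)))"

lemma rank: "rank a \<le> i \<Longrightarrow> a \<in> set (fst (candidates i))"
  unfolding rank_def using LeastI_ex[OF candidates_surj[of a]] candidates_mono by blast

text \<open>Registers of the search: 1 the input, 2 and 3 the candidates and the queue, 4 the budget
  \<open>2 ^ i\<close> in unary, 5 nonempty as long as nothing has been found, 6 the result. The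
  called program returns a node whose left part tells whether the right part may be trusted.\<close>

definition try_candidates :: "com \<Rightarrow> com" where
  "try_candidates A = For 10 11 (Var 2) (If (Var 5)
     (Seq (Assign 50 (Var 4)) (Seq (clocked_call 100 50 51 A (Cons (Var 1) (Var 10)) 52)
       (If (Var 50) (If (Hd (Var 52)) (Seq (Assign 6 (Tl (Var 52))) (Assign 5 Empty)) Skip) Skip)))
     Skip)"

definition double :: com where
  "double = For 12 13 (Var 4) (Assign 4 (Cons Empty (Var 4)))"

definition next_candidates :: com where
  "next_candidates = If (Var 3) (Seq (Assign 2 (Cons (Hd (Var 3)) (Var 2))) (Assign 3 (Tl (Var 3))))
     (For 14 15 (Var 2) (For 16 17 (Var 2) (Assign 3 (Cons (Cons (Var 14) (Var 16)) (Var 3)))))"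

definition search :: "com \<Rightarrow> com" where
  "search A = Seq (Assign 1 (Var 0)) (Seq (Assign 2 (Cons Empty Empty)) (Seq (Assign 3 Empty)
     (Seq (Assign 4 (Cons Empty Empty)) (Seq (Assign 5 (Cons Empty Empty))
     (Seq (While (Var 5) (Seq (try_candidates A) (Seq double next_candidates))) (Assign 0 (Var 6)))))))"

lemma sum_list_le: "(\<And>x. x \<in> set xs \<Longrightarrow> f x \<le> (c::nat)) \<Longrightarrow> length xs \<le> n \<Longrightarrow> (\<Sum>x\<leftarrow>xs. f x) \<le> n * c"
proof (induction xs arbitrary: n)
  case (Cons x xs)
  obtain m where m: "n = Suc m" "length xs \<le> m" using Cons.prems(2) by (cases n) auto
  have "(\<Sum>x\<leftarrow>xs. f x) \<le> m * c" using Cons.prems(1) m(2) by (intro Cons.IH) auto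
  then show ?case using Cons.prems(1)[of x] m(1) by simp
qed simp

lemma tree_of_nat_conv: "tree_of_nat n = tree_of_list (replicate n Leaf)"
  by (simp add: tree_of_nat_def)

lemma runs_double:
  assumes "s 4 = tree_of_nat n" "12 * n + 4 \<le> T"
  shows "runs double s T (\<lambda>s'. s' 4 = tree_of_nat (2 * n) \<and> (\<forall>v. v \<notin> {4, 12, 13} \<longrightarrow> s' v = s v))"
  unfolding double_def
proof (rule runs_For[where xs = "replicate n Leaf" and B = "\<lambda>_. 4" and
      Inv = "\<lambda>ys s'. (\<exists>m. m + length ys = 2 * n \<and> s' 4 = tree_of_nat m) \<and> (\<forall>v. v \<notin> {4, 12, 13} \<longrightarrow> s' v = s v)"])
  fix x :: tree and ys s1
  assume "(\<exists>m. m + length (x # ys) = 2 * n \<and> s1 4 = tree_of_nat m) \<and> (\<forall>v. v \<notin> {4, 12, 13} \<longrightarrow> s1 v = s v)"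
  then obtain m where "m + length (x # ys) = 2 * n" "s1 4 = tree_of_nat m" "\<forall>v. v \<notin> {4, 12, 13} \<longrightarrow> s1 v = s v"
    by blast
  then show "runs (Assign 4 (expr.Cons Empty (Var 4))) (s1(12 := x, 13 := tree_of_list ys)) 4
        (\<lambda>s'. s' 13 = tree_of_list ys \<and> (\<exists>m. m + length ys = 2 * n \<and> s' 4 = tree_of_nat m) \<and> (\<forall>v. v \<notin> {4, 12, 13} \<longrightarrow> s' v = s v))"
    by (auto simp: runs_simps intro!: exI[of _ "Suc m"])
qed (use assms in \<open>auto simp: tree_of_nat_conv sum_list_replicate intro!: exI[of _ n]\<close>)

lemma runs_next_candidates:
  assumes c: "candidates i = (E, G)" and s: "s 2 = tree_of_list E" "s 3 = tree_of_list G"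
    and T: "(i + 1) * ((i + 1) * 14 + 12) + 6 + 9 \<le> T"
  shows "runs next_candidates s T (\<lambda>s'. s' 2 = tree_of_list (fst (candidates (Suc i))) \<and>
     s' 3 = tree_of_list (snd (candidates (Suc i))) \<and> (\<forall>v. v \<notin> {2, 3, 14, 15, 16, 17} \<longrightarrow> s' v = s v))"
proof (cases G)
  case (Cons g G')
  then show ?thesis using T s candidates_Suc_Cons[of i E g G'] c
    by (auto simp: next_candidates_def runs_simps)
next
  case Nil
  have len: "length E \<le> i + 1" using length_candidates[of i] c by simp
  let ?step = "\<lambda>x. fold (\<lambda>y. (#) (Node x y)) E"
  have "runs (For 14 15 (Var 2) (For 16 17 (Var 2) (Assign 3 (expr.Cons (expr.Cons (Var 14) (Var 16)) (Var 3)))))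
    s (T - 2) (\<lambda>s'. s' 2 = tree_of_list E \<and>
     s' 3 = tree_of_list (pairs E) \<and> (\<forall>v. v \<notin> {2, 3, 14, 15, 16, 17} \<longrightarrow> s' v = s v))"
  proof (rule runs_For[where xs = E and B = "\<lambda>_. 4 + (i + 1) * 14" and Inv = "\<lambda>ys s'. (\<exists>H. s' 3 = tree_of_list H \<and>
     fold ?step ys H = pairs E) \<and> s' 2 = tree_of_list E \<and> (\<forall>v. v \<notin> {2, 3, 14, 15, 16, 17} \<longrightarrow> s' v = s v)"])
    fix x ys s1
    assume "(\<exists>H. s1 3 = tree_of_list H \<and> fold ?step (x # ys) H = pairs E) \<and> s1 2 = tree_of_list E \<and>
       (\<forall>v. v \<notin> {2, 3, 14, 15, 16, 17} \<longrightarrow> s1 v = s v)"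
    then obtain H where H: "s1 3 = tree_of_list H" "fold ?step ys (?step x H) = pairs E" "s1 2 = tree_of_list E"
       "\<forall>v. v \<notin> {2, 3, 14, 15, 16, 17} \<longrightarrow> s1 v = s v" by auto
    let ?s = "s1(14 := x, 15 := tree_of_list ys)"
    show "runs (For 16 17 (Var 2) (Assign 3 (expr.Cons (expr.Cons (Var 14) (Var 16)) (Var 3)))) ?s
        (4 + (i + 1) * 14)
        (\<lambda>s'. s' 15 = tree_of_list ys \<and>
              (\<exists>H. s' 3 = tree_of_list H \<and> fold ?step ys H = pairs E) \<and> s' 2 = tree_of_list E \<and>
              (\<forall>v. v \<notin> {2, 3, 14, 15, 16, 17} \<longrightarrow> s' v = s v))"
    proof (rule runs_For[where xs = E and B = "\<lambda>_. 6" and Inv = "\<lambda>zs s'. (\<exists>H'. s' 3 = tree_of_list H' \<and>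
       fold (\<lambda>y. (#) (Node x y)) zs H' = ?step x H) \<and> (\<forall>v. v \<notin> {3, 16, 17} \<longrightarrow> s' v = ?s v)"])
      fix z zs s2
      assume "(\<exists>H'. s2 3 = tree_of_list H' \<and>
       fold (\<lambda>y. (#) (Node x y)) (z # zs) H' = ?step x H) \<and> (\<forall>v. v \<notin> {3, 16, 17} \<longrightarrow> s2 v = ?s v)"
      then obtain H' where "s2 3 = tree_of_list H'" "fold (\<lambda>y. (#) (Node x y)) zs (Node x z # H') = ?step x H"
         "\<forall>v. v \<notin> {3, 16, 17} \<longrightarrow> s2 v = ?s v" by auto
      then show "runs (Assign 3 (expr.Cons (expr.Cons (Var 14) (Var 16)) (Var 3))) (s2(16 := z, 17 := tree_of_list zs)) 6
         (\<lambda>s'. s' 17 = tree_of_list zs \<and> (\<exists>H'. s' 3 = tree_of_list H' \<and>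
          fold (\<lambda>y. (#) (Node x y)) zs H' = ?step x H) \<and> (\<forall>v. v \<notin> {3, 16, 17} \<longrightarrow> s' v = ?s v))"
        by (auto simp: runs_simps intro!: exI[of _ "Node x z # H'"])
    next
      have "(\<Sum>x\<leftarrow>E. 6 + 8 :: nat) \<le> (i + 1) * 14" by (rule sum_list_le) (use len in auto)
      then show "cost (Var 2) + 3 + (\<Sum>x\<leftarrow>E. 6 + 8) \<le> 4 + (i + 1) * 14" by simp
    qed (use H in auto)
  next
    have "(\<Sum>x\<leftarrow>E. 4 + (i + 1) * 14 + 8) \<le> (i + 1) * ((i + 1) * 14 + 12)"
      by (rule sum_list_le) (use len in auto)
    then show "cost (Var 2) + 3 + (\<Sum>x\<leftarrow>E. 4 + (i + 1) * 14 + 8) \<le> T - 2" using T by simp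
  qed (use s Nil in \<open>auto simp: pairs_def intro!: exI[of _ "[]"]\<close>)
  then show ?thesis using c Nil s T by (simp add: next_candidates_def runs_If del: One_nat_def)
qed

definition search_inv :: "tree \<Rightarrow> nat \<Rightarrow> store \<Rightarrow> bool" where
  "search_inv x i s \<longleftrightarrow> s 1 = x \<and> s 2 = tree_of_list (fst (candidates i)) \<and>
     s 3 = tree_of_list (snd (candidates i)) \<and> s 4 = tree_of_nat (2 ^ i)"

text \<open>\<open>f\<close>, \<open>y\<close> and \<open>t\<close> describe the outcome of the
  called program on every candidate, and \<open>Good\<close> is what a nonempty flag guarantees.
  Soundness concerns all candidates, success within the budget only the distinguished
  \<open>a\<close>.\<close>

lemma runs_try_candidates:
  shows "\<exists>K. \<forall>s i x f y t Good a. (\<forall>a. computes_in A (Node x a) (Node (f a) (y a)) (t a) \<and>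
     (f a \<noteq> Leaf \<longrightarrow> Good (y a))) \<longrightarrow> search_inv x i s \<longrightarrow> s 5 \<noteq> Leaf \<longrightarrow>
     runs (try_candidates A) s (K * (i + 1) * 2 ^ i) (\<lambda>s'. search_inv x i s' \<and>
       (s' 5 = Leaf \<longrightarrow> Good (s' 6)) \<and> (a \<in> set (fst (candidates i)) \<and> f a \<noteq> Leaf \<and> t a < 2 ^ i \<longrightarrow> s' 5 = Leaf))"
proof -
  obtain K where K: "\<And>s \<beta> y t. computes_in A (eval_expr (expr.Cons (Var 1) (Var 10)) s) y t \<Longrightarrow>
     s 50 = tree_of_nat \<beta> \<Longrightarrow>
     runs (clocked_call 100 50 51 A (expr.Cons (Var 1) (Var 10)) 52) s (K * (\<beta> + 1))
       (\<lambda>s'. (s' 50 \<noteq> Leaf \<longrightarrow> s' 52 = y) \<and> (t < \<beta> \<longrightarrow> s' 50 \<noteq> Leaf) \<and>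
             (\<forall>v<100. v \<noteq> 50 \<and> v \<noteq> 51 \<and> v \<noteq> 52 \<longrightarrow> s' v = s v))"
    using runs_clocked_call[of 50 100 51 "expr.Cons (Var 1) (Var 10)" 52 A] by auto
  show ?thesis
  proof (rule exI[of _ "2 * K + 30"], intro allI impI)
    fix s i x f y t Good a
    assume A: "\<forall>a. computes_in A (Node x a) (Node (f a) (y a)) (t a) \<and> (f a \<noteq> Leaf \<longrightarrow> Good (y a))"
      and s: "search_inv x i s" and s5: "s 5 \<noteq> Leaf"
    let ?B = "K * (2 ^ i + 1) + 16"
    let ?Inv = "\<lambda>ys s'. search_inv x i s' \<and> (s' 5 = Leaf \<longrightarrow> Good (s' 6)) \<and>
       (a \<in> set (fst (candidates i)) \<and> a \<notin> set ys \<and> f a \<noteq> Leaf \<and> t a < 2 ^ i \<longrightarrow> s' 5 = Leaf)"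
    show "runs (try_candidates A) s ((2 * K + 30) * (i + 1) * 2 ^ i) (\<lambda>s'. search_inv x i s' \<and>
       (s' 5 = Leaf \<longrightarrow> Good (s' 6)) \<and> (a \<in> set (fst (candidates i)) \<and> f a \<noteq> Leaf \<and> t a < 2 ^ i \<longrightarrow> s' 5 = Leaf))"
      unfolding try_candidates_def
    proof (rule runs_For[where xs = "fst (candidates i)" and B = "\<lambda>_. ?B" and Inv = ?Inv])
      fix z ys s1
      assume s1: "?Inv (z # ys) s1" and "z \<in> set (fst (candidates i))"
      let ?s = "s1(10 := z, 11 := tree_of_list ys)"
      let ?Q = "\<lambda>s'. s' 11 = tree_of_list ys \<and> ?Inv ys s'"
      show "runs (If (Var 5)
     (Seq (Assign 50 (Var 4)) (Seq (clocked_call 100 50 51 A (expr.Cons (Var 1) (Var 10)) 52)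
       (If (Var 50) (If (Hd (Var 52)) (Seq (Assign 6 (Tl (Var 52))) (Assign 5 Empty)) Skip) Skip)))
     Skip) ?s ?B ?Q"
      proof (cases "s1 5 = Leaf")
        case True
        then show ?thesis using s1 by (auto simp: runs_simps search_inv_def)
      next
        case False
        let ?s' = "?s(50 := tree_of_nat (2 ^ i))"
        have "computes_in A (eval_expr (expr.Cons (Var 1) (Var 10)) ?s') (Node (f z) (y z)) (t z)"
          using A s1 by (simp add: search_inv_def)
        from K[OF this, of "2 ^ i"]
        have "runs (clocked_call 100 50 51 A (expr.Cons (Var 1) (Var 10)) 52) ?s' (K * (2 ^ i + 1))
           (\<lambda>s'. (s' 50 \<noteq> Leaf \<longrightarrow> s' 52 = Node (f z) (y z)) \<and> (t z < 2 ^ i \<longrightarrow> s' 50 \<noteq> Leaf) \<and>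
             (\<forall>v<100. v \<noteq> 50 \<and> v \<noteq> 51 \<and> v \<noteq> 52 \<longrightarrow> s' v = ?s' v))" by simp
        then have "runs (Seq (clocked_call 100 50 51 A (expr.Cons (Var 1) (Var 10)) 52)
           (If (Var 50) (If (Hd (Var 52)) (Seq (Assign 6 (Tl (Var 52))) (Assign 5 Empty)) Skip) Skip)) ?s'
           (12 + K * (2 ^ i + 1)) ?Q"
        proof (rule runs_Seq[OF runs_weaken[OF _ order.refl], where ?T2.0 = 12], goal_cases)
          case (1 s')
          then show ?case using s1 A
            by (auto simp: runs_simps search_inv_def)
        qed auto
        then show ?thesis using False s1 by (auto simp: runs_simps search_inv_def)
      qed
    next
      have "(\<Sum>x\<leftarrow>fst (candidates i). ?B + 8) \<le> (i + 1) * (?B + 8)"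
        by (rule sum_list_le) (use length_candidates[of i] in auto)
      also have "?B + 8 \<le> (2 * K + 26) * 2 ^ i"
      proof -
        have "K * 1 \<le> K * 2 ^ i" by (rule mult_le_mono2) simp
        moreover have "1 \<le> (2::nat) ^ i" by simp
        moreover have "(2 * K + 26) * 2 ^ i = 2 * (K * 2 ^ i) + 26 * 2 ^ i" by (simp add: algebra_simps)
        ultimately show ?thesis unfolding distrib_left by linarith
      qed
      then have "(i + 1) * (?B + 8) \<le> (i + 1) * ((2 * K + 26) * 2 ^ i)" by (rule mult_left_mono) simp
      moreover have "4 * 1 \<le> 4 * (i + 1) * 2 ^ i" by (rule mult_le_mono) auto
      ultimately show "cost (Var 2) + 3 + (\<Sum>x\<leftarrow>fst (candidates i). ?B + 8) \<le> (2 * K + 30) * (i + 1) * 2 ^ i"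
        by (simp add: algebra_simps)
    qed (use s s5 in \<open>auto simp: search_inv_def\<close>)
  qed
qed

lemma runs_search_loop:
  assumes round: "\<And>s i. search_inv x i s \<Longrightarrow> s 5 \<noteq> Leaf \<Longrightarrow> i \<le> R \<Longrightarrow> runs p s T (\<lambda>s'.
      (s' 5 = Leaf \<longrightarrow> Good (s' 6)) \<and> (s' 5 \<noteq> Leaf \<longrightarrow> i < R \<and> search_inv x (Suc i) s'))"
    and s: "search_inv x i s" "s 5 \<noteq> Leaf" "i \<le> R"
  shows "runs (While (Var 5) p) s ((R - i + 1) * (T + 2) + 2) (\<lambda>s'. Good (s' 6))"
  using s
proof (induction "R - i" arbitrary: i s rule: less_induct)
  case less
  obtain t1 s1 where s1: "exec p s t1 s1" "t1 \<le> T" "s1 5 = Leaf \<longrightarrow> Good (s1 6)"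
    "s1 5 \<noteq> Leaf \<longrightarrow> i < R \<and> search_inv x (Suc i) s1"
    using round[OF less.prems] by (auto simp: runs_def)
  have "runs (While (Var 5) p) s1 ((R - i) * (T + 2) + 2) (\<lambda>s'. Good (s' 6))"
  proof (cases "s1 5 = Leaf")
    case True
    have "exec (While (Var 5) p) s1 (cost (Var 5) + 1) s1"
      using True by (intro exec.While_false) auto
    moreover have "Good (s1 6)" using s1(3) True by simp
    ultimately show ?thesis unfolding runs_def
      by (intro exI[of _ "cost (Var 5) + 1"] exI[of _ s1]) simp
  next
    case False
    then have i: "i < R" "search_inv x (Suc i) s1" using s1(4) by auto
    then have "runs (While (Var 5) p) s1 ((R - Suc i + 1) * (T + 2) + 2) (\<lambda>s'. Good (s' 6))"
      using less.hyps[of "Suc i" s1] False by auto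
    then show ?thesis using i(1) by (simp add: Suc_diff_Suc)
  qed
  then obtain t2 s2 where s2: "exec (While (Var 5) p) s1 t2 s2" "t2 \<le> (R - i) * (T + 2) + 2" "Good (s2 6)"
    by (auto simp: runs_def)
  have "exec (While (Var 5) p) s (cost (Var 5) + 1 + t1 + t2) s2"
    by (rule exec.While_true[OF _ s1(1) s2(1)]) (use less.prems in simp)
  moreover have "cost (Var 5) + 1 + t1 + t2 \<le> (R - i + 1) * (T + 2) + 2"
    using s1(2) s2(2) by simp
  ultimately show ?case using s2(3) unfolding runs_def by blast
qed

text \<open>No round after \<open>rank a + r\<close> is needed: by then \<open>a\<close> is a
  candidate and the budget is at least \<open>2 ^ r\<close>. A round costs
  \<open>(i + 1) * 2 ^ i\<close> for the trials and a quadratic amount for refilling the queue, and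
  there are at most \<open>rank a + r + 1\<close> rounds, whence the cube. \<open>K\<close> is fixed
  before the input, so it depends on \<open>A\<close> alone.\<close>

theorem search:
  "\<exists>K. \<forall>x f y t Good a r. (\<forall>a. computes_in A (Node x a) (Node (f a) (y a)) (t a) \<and>
     (f a \<noteq> Leaf \<longrightarrow> Good (y a))) \<longrightarrow> f a \<noteq> Leaf \<longrightarrow> t a < 2 ^ r \<longrightarrow>
     (\<exists>out T. computes_in (search A) x out T \<and> Good out \<and>
        T \<le> K * (rank a + r + 1) ^ 3 * 2 ^ (rank a + r))"
proof -
  obtain K where K: "\<And>s i x f y t Good a. (\<forall>a. computes_in A (Node x a) (Node (f a) (y a)) (t a) \<and>
     (f a \<noteq> Leaf \<longrightarrow> Good (y a))) \<Longrightarrow> search_inv x i s \<Longrightarrow> s 5 \<noteq> Leaf \<Longrightarrow>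
     runs (try_candidates A) s (K * (i + 1) * 2 ^ i) (\<lambda>s'. search_inv x i s' \<and>
       (s' 5 = Leaf \<longrightarrow> Good (s' 6)) \<and> (a \<in> set (fst (candidates i)) \<and> f a \<noteq> Leaf \<and> t a < 2 ^ i \<longrightarrow> s' 5 = Leaf))"
    using runs_try_candidates[of A] by blast
  show ?thesis
  proof (rule exI[of _ "K + 100"], intro allI impI)
    fix x f y t Good a r
    assume A: "\<forall>a. computes_in A (Node x a) (Node (f a) (y a)) (t a) \<and> (f a \<noteq> Leaf \<longrightarrow> Good (y a))"
      and a: "f a \<noteq> Leaf" "t a < 2 ^ r"
    define R where "R = rank a + r"
    define T where "T = (K + 60) * (R + 1)\<^sup>2 * 2 ^ R"
    have round: "runs (Seq (try_candidates A) (Seq double next_candidates)) s T (\<lambda>s'.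
      (s' 5 = Leaf \<longrightarrow> Good (s' 6)) \<and> (s' 5 \<noteq> Leaf \<longrightarrow> i < R \<and> search_inv x (Suc i) s'))"
      if i: "search_inv x i s" "s 5 \<noteq> Leaf" "i \<le> R" for s i
    proof (rule runs_Seq[OF runs_weaken[OF K[OF A i(1,2), of a] order.refl]])
      fix s1 assume s1: "search_inv x i s1 \<and> (s1 5 = Leaf \<longrightarrow> Good (s1 6)) \<and>
         (a \<in> set (fst (candidates i)) \<and> f a \<noteq> Leaf \<and> t a < 2 ^ i \<longrightarrow> s1 5 = Leaf)"
      have win: "s1 5 \<noteq> Leaf \<longrightarrow> i < R"
      proof (rule impI, rule ccontr)
        assume *: "s1 5 \<noteq> Leaf" "\<not> i < R"
        then have "i = R" using i(3) by simp
        then have "a \<in> set (fst (candidates i))" using rank[of a i] by (simp add: R_def)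
        moreover have "(2::nat) ^ r \<le> 2 ^ i" using \<open>i = R\<close> by (intro power_increasing) (auto simp: R_def)
        ultimately show False using s1 a * less_le_trans[OF a(2)] by auto
      qed
      show "runs (Seq double next_candidates) s1 (12 * 2 ^ i + 4 + ((i + 1) * ((i + 1) * 14 + 12) + 15)) (\<lambda>s'.
         (s' 5 = Leaf \<longrightarrow> Good (s' 6)) \<and> (s' 5 \<noteq> Leaf \<longrightarrow> i < R \<and> search_inv x (Suc i) s'))"
      proof (rule runs_Seq[OF runs_weaken[OF runs_double[OF _ order.refl] order.refl]])
        fix s2 assume s2: "s2 4 = tree_of_nat (2 * 2 ^ i) \<and> (\<forall>v. v \<notin> {4, 12, 13} \<longrightarrow> s2 v = s1 v)"
        show "runs next_candidates s2 ((i + 1) * ((i + 1) * 14 + 12) + 15) (\<lambda>s'.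
         (s' 5 = Leaf \<longrightarrow> Good (s' 6)) \<and> (s' 5 \<noteq> Leaf \<longrightarrow> i < R \<and> search_inv x (Suc i) s'))"
          by (rule runs_weaken[OF runs_next_candidates[OF prod.collapse[symmetric], of s2 i] order.refl])
             (use s1 s2 win in \<open>auto simp: search_inv_def simp del: candidates.simps\<close>)
      qed (use s1 in \<open>auto simp: search_inv_def\<close>)
    next
      have "(i + 1) \<le> (i + 1)\<^sup>2" "1 \<le> (2::nat) ^ i" "1 \<le> (i + 1)\<^sup>2" by (auto simp: power2_eq_square)
      then have *: "(i + 1) * 2 ^ i \<le> (i + 1)\<^sup>2 * 2 ^ i" "1 * 2 ^ i \<le> (i + 1)\<^sup>2 * 2 ^ i"
        "(i + 1)\<^sup>2 * 1 \<le> (i + 1)\<^sup>2 * 2 ^ i" "(i + 1) * 1 \<le> (i + 1)\<^sup>2 * 2 ^ i"  "1 * 1 \<le> (i + 1)\<^sup>2 * (2 ^ i :: nat)"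
        by (intro mult_mono; simp)+
      have "K * (i + 1) * 2 ^ i + (12 * 2 ^ i + 4 + ((i + 1) * ((i + 1) * 14 + 12) + 15)) =
        K * ((i + 1) * 2 ^ i) + 12 * (1 * 2 ^ i) + 14 * ((i + 1)\<^sup>2 * 1) + 12 * ((i + 1) * 1) + 19 * (1 * 1)"
        by (simp add: algebra_simps power2_eq_square)
      also have "\<dots> \<le> K * ((i + 1)\<^sup>2 * 2 ^ i) + 12 * ((i + 1)\<^sup>2 * 2 ^ i) + 14 * ((i + 1)\<^sup>2 * 2 ^ i)
         + 12 * ((i + 1)\<^sup>2 * 2 ^ i) + 19 * ((i + 1)\<^sup>2 * 2 ^ i)"
        using * by (intro add_mono mult_left_mono) auto
      also have "\<dots> \<le> (K + 60) * ((i + 1)\<^sup>2 * 2 ^ i)" by (simp add: algebra_simps)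
      also have "\<dots> \<le> (K + 60) * ((R + 1)\<^sup>2 * 2 ^ R)"
        using i(3) by (intro mult_left_mono mult_mono power_mono power_increasing) auto
      finally show "K * (i + 1) * 2 ^ i + (12 * 2 ^ i + 4 + ((i + 1) * ((i + 1) * 14 + 12) + 15)) \<le> T"
        by (simp add: T_def mult.assoc)
    qed
    let ?s = "(\<lambda>_. Leaf)(0 := x, 1 := x, 2 := Node Leaf Leaf, 3 := Leaf, 4 := Node Leaf Leaf, 5 := Node Leaf Leaf)"
    have "runs (While (Var 5) (Seq (try_candidates A) (Seq double next_candidates))) ?s ((R - 0 + 1) * (T + 2) + 2) (\<lambda>s'. Good (s' 6))"
      by (rule runs_search_loop[OF round]) (auto simp: search_inv_def)
    then have "runs (search A) ((\<lambda>_. Leaf)(0 := x)) ((R + 1) * (T + 2) + 20) (\<lambda>s'. Good (s' 0))"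
      unfolding search_def runs_simps
      by (auto simp: fun_upd_twist intro!: runs_Seq[where ?T2.0 = 2] elim!: runs_weaken)
         (auto simp: runs_simps)
    then obtain t' s' where "exec (search A) ((\<lambda>_. Leaf)(0 := x)) t' s'"
      and t': "t' \<le> (R + 1) * (T + 2) + 20" "Good (s' 0)"
      by (auto simp: runs_def)
    then have "computes_in (search A) x (s' 0) t'" unfolding computes_in_def by blast
    moreover note t'
    moreover have "(R + 1) * (T + 2) + 20 \<le> (K + 100) * (R + 1) ^ 3 * 2 ^ R"
    proof -
      have "(R + 1) * 1 \<le> (R + 1) ^ 3 * 2 ^ R"
        by (intro mult_mono) (auto simp: power3_eq_cube)
      moreover have "1 \<le> (R + 1) ^ 3 * 2 ^ R" by simp
      moreover have "(R + 1) * (T + 2) + 20 = (K + 60) * ((R + 1) ^ 3 * 2 ^ R) + 2 * ((R + 1) * 1) + 20"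
        by (simp add: T_def power3_eq_cube power2_eq_square algebra_simps)
      ultimately have "(R + 1) * (T + 2) + 20 \<le> (K + 100) * ((R + 1) ^ 3 * 2 ^ R)"
        unfolding distrib_right[of K] by linarith
      then show ?thesis by (simp add: mult.assoc)
    qed
    ultimately show "\<exists>out T. computes_in (search A) x out T \<and> Good out \<and>
        T \<le> (K + 100) * (rank a + r + 1) ^ 3 * 2 ^ (rank a + r)"
      unfolding R_def by (meson le_trans)
  qed
qed

section \<open>Matching patterns in a block\<close>

primrec drop_tree :: "nat \<Rightarrow> tree \<Rightarrow> tree" where
  "drop_tree 0 t = t"
| "drop_tree (Suc n) t = drop_tree n (right t)"

text \<open>Total on all trees: any nonempty entry counts as 1, and every position beyond the end
  reads as 0, which pads the last block when the block size does not divide the size of the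
  universe.\<close>

definition bit_at :: "nat \<Rightarrow> tree \<Rightarrow> bool" where
  "bit_at i t \<longleftrightarrow> left (drop_tree i t) \<noteq> Leaf"

primrec list_of_tree :: "tree \<Rightarrow> tree list" where
  "list_of_tree Leaf = []"
| "list_of_tree (Node a r) = a # list_of_tree r"

text \<open>Every tree is a list along its right spine; hence no candidate of the search is
  malformed.\<close>

lemma tree_of_list_list_of_tree [simp]: "tree_of_list (list_of_tree t) = t"
  by (induction t) auto

lemma list_of_tree_tree_of_list [simp]: "list_of_tree (tree_of_list xs) = xs"
  by (induction xs) auto

definition tree_of_bool :: "bool \<Rightarrow> tree" where
  "tree_of_bool b = (if b then Node Leaf Leaf else Leaf)"

lemma tree_of_bool_simps [simp]: "tree_of_bool True = Node Leaf Leaf" "tree_of_bool False = Leaf"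
    "tree_of_bool b = Leaf \<longleftrightarrow> \<not> b" "Leaf = tree_of_bool b \<longleftrightarrow> \<not> b"
    "tree_of_bool b = Node Leaf Leaf \<longleftrightarrow> b" "Node Leaf Leaf = tree_of_bool b \<longleftrightarrow> b"
  by (auto simp: tree_of_bool_def)

lemma tree_of_bits_conv: "tree_of_bits bs = tree_of_list (map tree_of_bool bs)"
  by (simp add: tree_of_bits_def tree_of_bool_def[abs_def])

lemma tree_of_bits_simps [simp]:
  "tree_of_bits [] = Leaf" "tree_of_bits (b # bs) = Node (tree_of_bool b) (tree_of_bits bs)"
  by (simp_all add: tree_of_bits_conv)

lemma drop_tree_drop_tree: "drop_tree m (drop_tree n t) = drop_tree (n + m) t"
  by (induction n arbitrary: t) auto

lemma bit_at_drop_tree: "bit_at i (drop_tree n t) = bit_at (n + i) t"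
  by (simp add: bit_at_def drop_tree_drop_tree)

lemma bit_at_simps: "bit_at 0 t \<longleftrightarrow> left t \<noteq> Leaf" "bit_at (Suc i) t \<longleftrightarrow> bit_at i (right t)"
  by (simp_all add: bit_at_def)

lemma drop_tree_Leaf [simp]: "drop_tree n Leaf = Leaf"
  by (induction n) auto

lemma drop_tree_tree_of_list: "drop_tree n (tree_of_list xs) = tree_of_list (drop n xs)"
proof (induction n arbitrary: xs)
  case (Suc n)
  show ?case using Suc[of "tl xs"] by (cases xs) auto
qed simp

lemma bit_at_tree_of_list: "bit_at i (tree_of_list xs) \<longleftrightarrow> i < length xs \<and> xs ! i \<noteq> Leaf"
proof (cases "i < length xs")
  case True
  then show ?thesis by (simp add: bit_at_def drop_tree_tree_of_list flip: Cons_nth_drop_Suc)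
qed (simp add: bit_at_def drop_tree_tree_of_list)

lemma bit_at_tree_of_bits: "bit_at i (tree_of_bits bs) \<longleftrightarrow> i < length bs \<and> bs ! i"
  by (auto simp: tree_of_bits_conv bit_at_tree_of_list)

text \<open>One pass over the block decides whether \<open>Y\<close> contains \<open>X\<close> and
  exceeds it by exactly as many elements as the unary number \<open>j\<close> says: each element of
  \<open>Y\<close> outside \<open>X\<close> uses up one unit of \<open>j\<close>. See
  \<open>match_bits_iff\<close>.\<close>

fun match_bits :: "nat \<Rightarrow> tree \<Rightarrow> tree \<Rightarrow> tree \<Rightarrow> bool" where
  "match_bits 0 X Y j \<longleftrightarrow> j = Leaf"
| "match_bits (Suc n) X Y j \<longleftrightarrow>
     (if left X \<noteq> Leaf then left Y \<noteq> Leaf \<and> match_bits n (right X) (right Y) j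
      else if left Y \<noteq> Leaf then j \<noteq> Leaf \<and> match_bits n (right X) (right Y) (right j)
      else match_bits n (right X) (right Y) j)"

abbreviation (input) one :: expr where "one \<equiv> expr.Cons Empty Empty"

text \<open>
  Registers of the enumeration: 1 the instance string, 2 the universe, 3 a list whose length is the
  block size, 4 the patterns, 5 the result of the coverage test, 6 the number of blocks and later
  the tuples, 7 the remaining tuples, 8 the current tuple, 9 the output.  Registers 10 to 99 are
  local, and those from 100 on belong to the called program.  A pattern is a node of a bit vector
  and a unary number.
\<close>

definition match_block :: com where
  "match_block = Seq (Assign 12 (Hd (Var 10))) (Seq (Assign 13 (Tl (Var 10))) (Seq (Assign 14 (Var 11))
     (Seq (Assign 17 one) (Seq (For 16 15 (Var 3)
        (Seq (If (Hd (Var 12)) (If (Hd (Var 14)) Skip (Assign 17 Empty))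
               (If (Hd (Var 14)) (If (Var 13) (Assign 13 (Tl (Var 13))) (Assign 17 Empty)) Skip))
          (Seq (Assign 12 (Tl (Var 12))) (Assign 14 (Tl (Var 14))))))
     (If (Var 13) (Assign 17 Empty) Skip)))))"

definition matches :: "nat \<Rightarrow> tree \<Rightarrow> tree \<Rightarrow> bool" where
  "matches n w Y \<longleftrightarrow> match_bits n (left w) Y (right w)"

lemma runs_match_block:
  assumes "s 3 = tree_of_list cs" "30 * length cs + 30 \<le> T"
  shows "runs match_block s T (\<lambda>s'. s' 17 = tree_of_bool (matches (length cs) (s 10) (s 11)) \<and>
     s' 14 = drop_tree (length cs) (s 11) \<and> (\<forall>v. v \<notin> {12..17} \<longrightarrow> s' v = s v))"
proof -
  let ?b = "matches (length cs) (s 10) (s 11)"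
  let ?s = "s(12 := left (s 10), 13 := right (s 10), 14 := s 11, 17 := Node Leaf Leaf)"
  let ?P = "Seq (If (Hd (Var 12)) (If (Hd (Var 14)) Skip (Assign 17 Empty))
               (If (Hd (Var 14)) (If (Var 13) (Assign 13 (Tl (Var 13))) (Assign 17 Empty)) Skip))
          (Seq (Assign 12 (Tl (Var 12))) (Assign 14 (Tl (Var 14))))"
  \<comment> \<open>The loop does not stop at a mismatch. The flag \<open>b\<close> remembers it,
    and at every moment the flag together with the remaining scan yields the final verdict.\<close>
  let ?I = "\<lambda>ys s'. (\<exists>b. s' 17 = tree_of_bool b \<and> (b \<and> match_bits (length ys) (s' 12) (s' 14) (s' 13)) = ?b) \<and>
     drop_tree (length ys) (s' 14) = drop_tree (length cs) (s 11) \<and> (\<forall>v. v \<notin> {12..17} \<longrightarrow> s' v = s v)"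
  have "runs (For 16 15 (Var 3) ?P) ?s (30 * length cs + 4) (?I [])"
  proof (rule runs_For[where xs = cs and B = "\<lambda>_. 22" and Inv = ?I])
    fix x ys s1 assume "?I (x # ys) s1" "s1 15 = Node x (tree_of_list ys)"
    then obtain b where b: "s1 17 = tree_of_bool b" "(b \<and> match_bits (length (x # ys)) (s1 12) (s1 14) (s1 13)) = ?b"
      "drop_tree (length ys) (right (s1 14)) = drop_tree (length cs) (s 11)" "\<forall>v. v \<notin> {12..17} \<longrightarrow> s1 v = s v"
      by auto
    show "runs ?P (s1(16 := x, 15 := tree_of_list ys)) 22
        (\<lambda>s'. s' 15 = tree_of_list ys \<and> ?I ys s')"
      using b by (auto simp: runs_simps ex_bool_eq)
  qed (use assms in \<open>auto simp: sum_list_triv matches_def\<close>)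
  then have "runs (Seq (For 16 15 (Var 3) ?P) (If (Var 13) (Assign 17 Empty) Skip)) ?s (30 * length cs + 8)
    (\<lambda>s'. s' 17 = tree_of_bool ?b \<and> s' 14 = drop_tree (length cs) (s 11) \<and> (\<forall>v. v \<notin> {12..17} \<longrightarrow> s' v = s v))"
    by (rule runs_Seq[OF runs_weaken[OF _ order.refl], where ?T2.0 = 4]) (auto simp: runs_simps)
  then show ?thesis unfolding match_block_def using assms
    by (auto simp: runs_simps elim!: runs_weaken)
qed

definition exists_match :: "expr \<Rightarrow> com" where
  "exists_match e = Seq (Assign 20 Empty) (For 10 21 e (Seq match_block (If (Var 17) (Assign 20 one) Skip)))"

lemma runs_exists_match:
  assumes "s 3 = tree_of_list cs" and e: "eval_expr e (s(20 := Leaf)) = tree_of_list ws"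
    and T: "length ws * (30 * length cs + 50) + cost e + 5 \<le> T"
  shows "runs (exists_match e) s T (\<lambda>s'. s' 20 = tree_of_bool (\<exists>w\<in>set ws. matches (length cs) w (s 11)) \<and>
     (\<forall>v. v \<noteq> 10 \<and> v \<notin> {12..21} \<longrightarrow> s' v = s v))"
  unfolding exists_match_def runs_simps
proof (intro conjI)
  let ?b = "\<exists>w\<in>set ws. matches (length cs) w (s 11)"
  let ?I = "\<lambda>ys s'. (\<exists>b. s' 20 = tree_of_bool b \<and> (b \<or> (\<exists>w\<in>set ys. matches (length cs) w (s 11))) = ?b) \<and>
      (\<forall>v. v \<noteq> 10 \<and> v \<notin> {12..21} \<longrightarrow> s' v = s v)"
  have s3: "s 3 = tree_of_list cs" by fact
  show "runs (For 10 21 e (Seq match_block (If (Var 17) (Assign 20 one) Skip))) (s(20 := eval_expr Empty s))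
    (T - (cost Empty + 1)) (\<lambda>s'. s' 20 = tree_of_bool ?b \<and> (\<forall>v. v \<noteq> 10 \<and> v \<notin> {12..21} \<longrightarrow> s' v = s v))"
  proof (rule runs_For[where xs = ws and B = "\<lambda>_. 30 * length cs + 42" and Inv = ?I])
    fix x ys s1 assume "?I (x # ys) s1"
    then obtain b where b: "s1 20 = tree_of_bool b" "(b \<or> (\<exists>w\<in>set (x # ys). matches (length cs) w (s 11))) = ?b"
      "\<forall>v. v \<noteq> 10 \<and> v \<notin> {12..21} \<longrightarrow> s1 v = s v" by blast
    show "runs (Seq match_block (If (Var 17) (Assign 20 one) Skip)) (s1(10 := x, 21 := tree_of_list ys))
      (30 * length cs + 42) (\<lambda>s'. s' 21 = tree_of_list ys \<and> ?I ys s')"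
    proof (rule runs_Seq[OF runs_weaken[OF runs_match_block order.refl], where ?T2.0 = 12])
      fix s2 let ?s = "s1(10 := x, 21 := tree_of_list ys)"
      assume s2: "s2 17 = tree_of_bool (matches (length cs) (?s 10) (?s 11)) \<and>
          s2 14 = drop_tree (length cs) (?s 11) \<and> (\<forall>v. v \<notin> {12..17} \<longrightarrow> s2 v = ?s v)"
      then have "s2 17 = tree_of_bool (matches (length cs) x (s 11))" "s2 20 = tree_of_bool b"
        "\<forall>v. v \<noteq> 10 \<and> v \<notin> {12..21} \<longrightarrow> s2 v = s v" "s2 21 = tree_of_list ys"
        using b by auto
      then show "runs (If (Var 17) (Assign 20 one) Skip) s2 12
           (\<lambda>s'. s' 21 = tree_of_list ys \<and> ?I ys s')"
        using b(2) by (auto simp: runs_simps ex_bool_eq)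
    qed (use b s3 in auto)
  qed (use e T in \<open>auto simp: sum_list_triv algebra_simps\<close>)
qed (use T in auto)

section \<open>Testing whether a list of patterns covers a block\<close>

primrec all_bits :: "nat \<Rightarrow> tree list" where
  "all_bits 0 = [Leaf]"
| "all_bits (Suc n) = fold (\<lambda>t acc. Node Leaf t # Node (tree_of_bool True) t # acc) (all_bits n) []"

lemma set_fold_all_bits: "set (fold (\<lambda>t acc. Node Leaf t # Node (tree_of_bool True) t # acc) ts acc) =
   Node Leaf ` set ts \<union> Node (tree_of_bool True) ` set ts \<union> set acc"
  by (induction ts arbitrary: acc) auto

lemma length_fold_all_bits: "length (fold (\<lambda>t acc. Node Leaf t # Node (tree_of_bool True) t # acc) ts acc) =
   2 * length ts + length acc"
  by (induction ts arbitrary: acc) auto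

lemma length_all_bits: "length (all_bits n) = 2 ^ n"
  by (induction n) (simp_all add: length_fold_all_bits del: tree_of_bool_simps)

lemma set_all_bits: "set (all_bits n) = tree_of_bits ` {bs. length bs = n}"
proof (induction n)
  case (Suc n)
  have "{bs. length bs = Suc n} = (#) False ` {bs. length bs = n} \<union> (#) True ` {bs. length bs = n}"
    by (auto simp: length_Suc_conv)
  then have "tree_of_bits ` {bs. length bs = Suc n} =
    Node Leaf ` tree_of_bits ` {bs. length bs = n} \<union> Node (tree_of_bool True) ` tree_of_bits ` {bs. length bs = n}"
    by (simp only: image_Un image_image tree_of_bits_simps tree_of_bool_simps)
  then show ?case unfolding all_bits.simps set_fold_all_bits Suc by simp
qed auto

definition gen_bits :: com where
  "gen_bits = Seq (Assign 22 one) (For 24 23 (Var 3) (Seq (Assign 25 Empty)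
     (Seq (For 26 27 (Var 22) (Assign 25 (expr.Cons (expr.Cons Empty (Var 26)) (expr.Cons (expr.Cons one (Var 26)) (Var 25)))))
       (Assign 22 (Var 25)))))"

definition check_cover :: com where
  "check_cover = Seq gen_bits (Seq (Assign 5 one)
     (For 11 29 (Var 22) (Seq (exists_match (Var 4)) (If (Var 20) Skip (Assign 5 Empty)))))"

lemma runs_gen_bits:
  assumes "s 3 = tree_of_list cs" "length cs * (20 * 2 ^ length cs + 20) + 10 \<le> T"
  shows "runs gen_bits s T (\<lambda>s'. s' 22 = tree_of_list (all_bits (length cs)) \<and>
      (\<forall>v. v \<notin> {22..27} \<longrightarrow> s' v = s v))"
  unfolding gen_bits_def runs_simps
proof (intro conjI)
  let ?I = "\<lambda>(ys :: tree list) s'. s' 22 = tree_of_list (all_bits (length cs - length ys)) \<and>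
      (\<forall>v. v \<notin> {22..27} \<longrightarrow> s' v = s v)"
  let ?f = "\<lambda>t acc. Node Leaf t # Node (tree_of_bool True) t # acc"
  let ?P = "(Assign 25 (expr.Cons (expr.Cons Empty (Var 26)) (expr.Cons (expr.Cons one (Var 26)) (Var 25))))"
  show "runs (For 24 23 (Var 3) (Seq (Assign 25 Empty) (Seq (For 26 27 (Var 22) ?P) (Assign 22 (Var 25)))))
      (s(22 := eval_expr one s)) (T - (cost one + 1))
      (\<lambda>s'. s' 22 = tree_of_list (all_bits (length cs)) \<and> (\<forall>v. v \<notin> {22..27} \<longrightarrow> s' v = s v))"
  proof (rule runs_For[where xs = cs and B = "\<lambda>_. 20 * 2 ^ length cs + 12" and Inv = "\<lambda>ys s'. ?I ys s' \<and> length ys \<le> length cs"])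
    fix x ys s1 assume s1: "?I (x # ys) s1 \<and> length (x # ys) \<le> length cs"
    let ?n = "length cs - length (x # ys)"
    let ?s = "s1(24 := x, 23 := tree_of_list ys, 25 := Leaf)"
    have n: "length cs - length ys = Suc ?n" using s1 by auto
    let ?J = "\<lambda>zs s'. (\<exists>acc. s' 25 = tree_of_list acc \<and> fold ?f zs acc = all_bits (Suc ?n)) \<and>
       (\<forall>v. v \<notin> {25..27} \<longrightarrow> s' v = ?s v)"
    have le: "(2::nat) ^ ?n \<le> 2 ^ length cs" by (intro power_increasing) auto
    have "runs (For 26 27 (Var 22) ?P) ?s (20 * 2 ^ length cs + 4) (?J [])"
    proof (rule runs_For[where xs = "all_bits ?n" and B = "\<lambda>_. 12" and Inv = ?J])
      fix z zs s2 assume "?J (z # zs) s2"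
      then obtain acc where "s2 25 = tree_of_list acc" "fold ?f zs (?f z acc) = all_bits (Suc ?n)"
        "(\<forall>v. v \<notin> {25..27} \<longrightarrow> s2 v = ?s v)" by auto
      then show "runs ?P (s2(26 := z, 27 := tree_of_list zs)) 12 (\<lambda>s'. s' 27 = tree_of_list zs \<and> ?J zs s')"
        by (auto simp: runs_simps intro!: exI[of _ "?f z acc"])
    qed (use s1 le in \<open>auto simp: sum_list_triv length_all_bits intro!: exI[of _ "[]"]\<close>)
    then have "runs (Seq (For 26 27 (Var 22) ?P) (Assign 22 (Var 25))) ?s (20 * 2 ^ length cs + 6)
       (\<lambda>s'. s' 23 = tree_of_list ys \<and> ?I ys s' \<and> length ys \<le> length cs)"
      by (rule runs_Seq[OF runs_weaken[OF _ order.refl], where ?T2.0 = 2])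
         (use s1 in \<open>auto simp: runs_simps n simp del: all_bits.simps\<close>)
    then show "runs (Seq (Assign 25 Empty) (Seq (For 26 27 (Var 22) ?P) (Assign 22 (Var 25))))
        (s1(24 := x, 23 := tree_of_list ys)) (20 * 2 ^ length cs + 12)
        (\<lambda>s'. s' 23 = tree_of_list ys \<and> ?I ys s' \<and> length ys \<le> length cs)"
      by (auto simp: runs_simps elim!: runs_weaken)
  qed (use assms in \<open>auto simp: sum_list_triv algebra_simps\<close>)
qed (use assms in auto)

text \<open>Restricted to the \<open>2 ^ n\<close> vectors of length \<open>n\<close> to be
  checkable by a program; \<open>covers_iff\<close> extends it to arbitrary trees.\<close>

definition covers :: "nat \<Rightarrow> tree list \<Rightarrow> bool" where
  "covers n ws \<longleftrightarrow> (\<forall>t \<in> set (all_bits n). \<exists>w\<in>set ws. matches n w t)"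

text \<open>Exponential in the block size, but independent of the instance.\<close>

definition cover_cost :: "nat \<Rightarrow> nat \<Rightarrow> nat" where
  "cover_cost n m = n * (20 * 2 ^ n + 20) + 2 ^ n * (m * (30 * n + 50) + 30) + 30"

lemma runs_check_cover:
  assumes s: "s 3 = tree_of_list cs" "s 4 = tree_of_list ws"
    and T: "cover_cost (length cs) (length ws) \<le> T"
  shows "runs check_cover s T (\<lambda>s'. s' 5 = tree_of_bool (covers (length cs) ws) \<and>
     (\<forall>v<10. v \<noteq> 5 \<longrightarrow> s' v = s v))"
  unfolding check_cover_def
proof (rule runs_Seq[OF runs_weaken[OF runs_gen_bits[OF _ order.refl] order.refl], where
      ?T2.0 = "2 ^ length cs * (length ws * (30 * length cs + 50) + 30) + 20"])
  let ?b = "covers (length cs) ws"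
  let ?P = "Seq (exists_match (Var 4)) (If (Var 20) Skip (Assign 5 Empty))"
  fix s1 assume s1: "s1 22 = tree_of_list (all_bits (length cs)) \<and> (\<forall>v. v \<notin> {22..27} \<longrightarrow> s1 v = s v)"
  let ?s = "s1(5 := Node Leaf Leaf)"
  let ?I = "\<lambda>ys s'. (\<exists>b. s' 5 = tree_of_bool b \<and> (b \<and> (\<forall>t \<in> set ys. \<exists>w\<in>set ws. matches (length cs) w t)) = ?b) \<and>
      (\<forall>v<10. v \<noteq> 5 \<longrightarrow> s' v = s v)"
  have "runs (For 11 29 (Var 22) ?P) ?s (2 ^ length cs * (length ws * (30 * length cs + 50) + 30) + 10) (?I [])"
  proof (rule runs_For[where xs = "all_bits (length cs)" and Inv = ?I and B = "\<lambda>_. length ws * (30 * length cs + 50) + 20"])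
    fix x ys s2 assume "?I (x # ys) s2"
    then obtain b where b: "s2 5 = tree_of_bool b" "(b \<and> (\<forall>t \<in> set (x # ys). \<exists>w\<in>set ws. matches (length cs) w t)) = ?b"
      "\<forall>v<10. v \<noteq> 5 \<longrightarrow> s2 v = s v" by blast
    let ?s = "s2(11 := x, 29 := tree_of_list ys)"
    show "runs ?P ?s (length ws * (30 * length cs + 50) + 20) (\<lambda>s'. s' 29 = tree_of_list ys \<and> ?I ys s')"
    proof (rule runs_Seq[OF runs_weaken[OF runs_exists_match[where ws = ws, OF _ _ order.refl] order.refl], where ?T2.0 = 12])
      fix s3 assume "s3 20 = tree_of_bool (\<exists>w\<in>set ws. matches (length cs) w (?s 11)) \<and> (\<forall>v. v \<noteq> 10 \<and> v \<notin> {12..21} \<longrightarrow> s3 v = ?s v)"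
      then show "runs (If (Var 20) Skip (Assign 5 Empty)) s3 12 (\<lambda>s'. s' 29 = tree_of_list ys \<and> ?I ys s')"
        using b by (auto simp: runs_simps ex_bool_eq)
    qed (use s b in auto)
  qed (use s s1 in \<open>auto simp: sum_list_triv length_all_bits covers_def algebra_simps\<close>)
  then show "runs (Seq (Assign 5 one) (For 11 29 (Var 22) ?P)) s1
       (2 ^ length cs * (length ws * (30 * length cs + 50) + 30) + 20)
       (\<lambda>s'. s' 5 = tree_of_bool ?b \<and> (\<forall>v<10. v \<noteq> 5 \<longrightarrow> s' v = s v))"
    by (auto simp: runs_simps elim!: runs_weaken)
qed (use s T in \<open>auto simp: cover_cost_def\<close>)

section \<open>Tuples of patterns\<close>

lemma Leaf_eq_tree_of_list [simp]: "Leaf = tree_of_list xs \<longleftrightarrow> xs = []"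
  by (cases xs) auto

definition count_blocks :: com where
  "count_blocks = Seq (Assign 6 Empty) (Seq (Assign 31 (Var 2)) (While (Var 31)
     (Seq (Assign 6 (expr.Cons Empty (Var 6))) (For 33 32 (Var 3) (Assign 31 (Tl (Var 31)))))))"

text \<open>The number of blocks is rounded up, so the last block may stick out of the universe, by
  fewer than \<open>length cs\<close> positions.\<close>

lemma runs_count_blocks:
  assumes s: "s 2 = tree_of_list us" "s 3 = tree_of_list cs" and cs: "cs \<noteq> []"
    and T: "(length us + 1) * (11 * length cs + 12) + 4 \<le> T"
  shows "runs count_blocks s T (\<lambda>s'. (\<exists>m. s' 6 = tree_of_nat m \<and> length us \<le> m * length cs \<and>
      m * length cs < length us + length cs) \<and> (\<forall>v<10. v \<noteq> 6 \<longrightarrow> s' v = s v))"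
proof -
  let ?c = "length cs"
  let ?P = "Seq (Assign 6 (expr.Cons Empty (Var 6))) (For 33 32 (Var 3) (Assign 31 (Tl (Var 31))))"
  let ?I = "\<lambda>s'. (\<exists>m. s' 6 = tree_of_nat m \<and> s' 31 = tree_of_list (drop (m * ?c) us) \<and>
      m * ?c < length us + ?c) \<and> (\<forall>v<10. v \<noteq> 6 \<longrightarrow> s' v = s v)"
  have "runs (While (Var 31) ?P) (s(6 := Leaf, 31 := tree_of_list us)) (T - 4)
     (\<lambda>s'. (\<exists>m. s' 6 = tree_of_nat m \<and> length us \<le> m * ?c \<and>
      m * ?c < length us + ?c) \<and> (\<forall>v<10. v \<noteq> 6 \<longrightarrow> s' v = s v))"
  proof (rule runs_While[where Inv = ?I and \<mu> = "\<lambda>s. length (list_of_tree (s 31))" and B = "11 * ?c + 8"])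
    fix s1 assume "?I s1" "eval_expr (Var 31) s1 \<noteq> Leaf"
    then obtain m where m: "s1 6 = tree_of_nat m" "s1 31 = tree_of_list (drop (m * ?c) us)"
      "m * ?c < length us" "\<forall>v<10. v \<noteq> 6 \<longrightarrow> s1 v = s v" by auto
    let ?s = "s1(6 := tree_of_nat (Suc m))"
    let ?J = "\<lambda>ys s'. length ys \<le> ?c \<and> s' 31 = tree_of_list (drop (m * ?c + (?c - length ys)) us) \<and>
       s' 6 = tree_of_nat (Suc m) \<and> (\<forall>v<10. v \<noteq> 6 \<longrightarrow> s' v = s v)"
    have "runs (For 33 32 (Var 3) (Assign 31 (Tl (Var 31)))) ?s (11 * ?c + 4) (?J [])"
    proof (rule runs_For[where xs = cs and B = "\<lambda>_. 3" and Inv = ?J])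
      fix x :: tree and ys :: "tree list" and s2 assume J: "?J (x # ys) s2"
      have "right (tree_of_list xs) = tree_of_list (drop 1 xs)" for xs by (cases xs) auto
      moreover have "1 + (m * ?c + (?c - length (x # ys))) = m * ?c + (?c - length ys)" using J by auto
      ultimately have "right (s2 31) = tree_of_list (drop (m * ?c + (?c - length ys)) us)"
        using J by (metis drop_drop)
      then show "runs (Assign 31 (Tl (Var 31))) (s2(33 := x, 32 := tree_of_list ys)) 3
         (\<lambda>s'. s' 32 = tree_of_list ys \<and> ?J ys s')" using J by (auto simp: runs_simps)
    qed (use m s in \<open>auto simp: sum_list_triv\<close>)
    then have "runs ?P s1 (11 * ?c + 8) (?J [])" using m by (simp add: runs_simps add.commute)
    then show "runs ?P s1 (11 * ?c + 8) (\<lambda>s'. ?I s' \<and> length (list_of_tree (s' 31)) < length (list_of_tree (s1 31)))"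
      by (rule runs_weaken) (use m cs length_greater_0_conv[THEN iffD2, OF cs] in \<open>auto intro!: exI[of _ "Suc m"] diff_less_mono2 simp: add.commute simp del: tree_of_nat_simps\<close>)
  next
    show "?I (s(6 := Leaf, 31 := tree_of_list us))" using cs by (auto intro!: exI[of _ 0])
  qed (use s T cs in \<open>auto simp: algebra_simps\<close>)
  then show ?thesis using T s by (simp add: count_blocks_def runs_simps del: One_nat_def)
qed

text \<open>A pattern is represented by the suffix of the pattern list that starts with it, so that the
  patterns of higher priority are at hand when a block is checked.\<close>

fun suffs :: "'a list \<Rightarrow> 'a list list" where
  "suffs [] = []"
| "suffs (w # ws) = (w # ws) # suffs ws"

definition tree_of_tuple :: "tree list list \<Rightarrow> tree" where
  "tree_of_tuple gs = tree_of_list (map tree_of_list gs)"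

lemma tree_of_tuple_simps [simp]: "tree_of_tuple [] = Leaf" "tree_of_tuple (g # gs) = Node (tree_of_list g) (tree_of_tuple gs)"
  by (simp_all add: tree_of_tuple_def)

text \<open>The folds follow the order in which the nested loops of \<open>gen_tuples\<close> build
  the list; \<open>tuples_Suc\<close> is the readable form.\<close>

primrec tuples :: "'a list \<Rightarrow> nat \<Rightarrow> 'a list list list" where
  "tuples ws 0 = [[]]"
| "tuples ws (Suc m) = fold (\<lambda>gs. fold (\<lambda>g. (#) (g # gs)) (suffs ws)) (tuples ws m) []"

lemma length_suffs [simp]: "length (suffs ws) = length ws"
  by (induction ws) auto

lemma fold_Cons_concat: "fold (\<lambda>gs. fold (\<lambda>g. (#) (f g gs)) hs) xs acc =
   rev (concat (map (\<lambda>gs. map (\<lambda>g. f g gs) hs) xs)) @ acc"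
  by (induction xs arbitrary: acc) (auto simp: fold_Cons)

lemma tuples_Suc: "tuples ws (Suc m) = rev (concat (map (\<lambda>gs. map (\<lambda>g. g # gs) (suffs ws)) (tuples ws m)))"
  by (simp add: fold_Cons_concat[of "\<lambda>g gs. g # gs"])

declare tuples.simps(2) [simp del]

lemma length_tuples: "length (tuples ws m) = length ws ^ m"
  by (induction m) (auto simp: tuples_Suc length_concat o_def sum_list_triv)

text \<open>In the innermost loop register 40 holds the current pattern and register 41 the patterns
  not yet visited; consing them gives the current suffix at constant cost.\<close>

definition gen_tuples :: com where
  "gen_tuples = Seq (Assign 34 one) (Seq (For 35 36 (Var 6) (Seq (Assign 37 Empty)
     (Seq (For 38 39 (Var 34) (For 40 41 (Var 4)
       (Assign 37 (expr.Cons (expr.Cons (expr.Cons (Var 40) (Var 41)) (Var 38)) (Var 37)))))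
     (Assign 34 (Var 37))))) (Assign 6 (Var 34)))"

lemma runs_gen_tuples:
  assumes s: "s 4 = tree_of_list ws" "s 6 = tree_of_nat m" and ws: "ws \<noteq> []"
    and T: "m * (length ws ^ m * (16 * length ws + 12) + 20) + 20 \<le> T"
  shows "runs gen_tuples s T (\<lambda>s'. s' 6 = tree_of_list (map tree_of_tuple (tuples ws m)) \<and> (\<forall>v<10. v \<noteq> 6 \<longrightarrow> s' v = s v))"
proof -
  let ?M = "length ws"
  let ?B = "?M ^ m * (16 * ?M + 12)"
  let ?P = "For 40 41 (Var 4) (Assign 37 (expr.Cons (expr.Cons (expr.Cons (Var 40) (Var 41)) (Var 38)) (Var 37)))"
  let ?I = "\<lambda>(ys :: tree list) s'. length ys \<le> m \<and> s' 34 = tree_of_list (map tree_of_tuple (tuples ws (m - length ys))) \<and>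
     (\<forall>v<10. s' v = s v)"
  have main: "runs (For 35 36 (Var 6) (Seq (Assign 37 Empty) (Seq (For 38 39 (Var 34) ?P) (Assign 34 (Var 37)))))
     (s(34 := Node Leaf Leaf)) (m * (?B + 20) + 8) (?I [])"
  proof (rule runs_For[where xs = "replicate m Leaf" and B = "\<lambda>_. ?B + 12" and Inv = ?I])
    fix x :: tree and ys s1 assume s1: "?I (x # ys) s1"
    let ?n = "m - length (x # ys)"
    have n: "m - length ys = Suc ?n" using s1 by auto
    let ?s = "s1(35 := x, 36 := tree_of_list ys, 37 := Leaf)"
    let ?step = "\<lambda>gs. fold (\<lambda>g. (#) (g # gs)) (suffs ws)"
    let ?J = "\<lambda>zs s'. (\<exists>acc Z. s' 37 = tree_of_list (map tree_of_tuple acc) \<and> zs = map tree_of_tuple Z \<and> fold ?step Z acc = tuples ws (Suc ?n)) \<and>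
       (\<forall>v\<le>36. s' v = ?s v)"
    have J0: "?J (map tree_of_tuple (tuples ws ?n)) (?s(39 := t))" for t
      by (rule conjI, rule exI[of _ "[]"], rule exI[of _ "tuples ws ?n"]) (auto simp: tuples.simps(2))
    have "runs (For 38 39 (Var 34) ?P) ?s (?B + 4) (?J [])"
    proof (rule runs_For[where xs = "map tree_of_tuple (tuples ws ?n)" and B = "\<lambda>_. 16 * ?M + 4" and Inv = ?J])
      fix z zs s2 assume "?J (z # zs) s2"
      then obtain acc gs Z where J: "s2 37 = tree_of_list (map tree_of_tuple acc)" "z = tree_of_tuple gs" "zs = map tree_of_tuple Z"
        "fold ?step Z (?step gs acc) = tuples ws (Suc ?n)" "\<forall>v\<le>36. s2 v = ?s v"
        by (auto simp: Cons_eq_map_conv)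
      let ?s' = "s2(38 := z, 39 := tree_of_list zs)"
      let ?L = "\<lambda>us s'. (\<exists>acc'. s' 37 = tree_of_list (map tree_of_tuple acc') \<and>
        fold (\<lambda>g. (#) (g # gs)) (suffs us) acc' = ?step gs acc) \<and> (\<forall>v\<le>39. v \<noteq> 37 \<longrightarrow> s' v = ?s' v)"
      show "runs ?P ?s' (16 * ?M + 4) (\<lambda>s'. s' 39 = tree_of_list zs \<and> ?J zs s')"
      proof (rule runs_For[where xs = ws and B = "\<lambda>_. 8" and Inv = ?L])
        fix u us s3 assume "?L (u # us) s3"
        then obtain acc' where "s3 37 = tree_of_list (map tree_of_tuple acc')"
          "fold (\<lambda>g. (#) (g # gs)) (suffs us) (((u # us) # gs) # acc') = ?step gs acc" "\<forall>v\<le>39. v \<noteq> 37 \<longrightarrow> s3 v = ?s' v"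
          by auto
        then show "runs (Assign 37 (expr.Cons (expr.Cons (expr.Cons (Var 40) (Var 41)) (Var 38)) (Var 37)))
           (s3(40 := u, 41 := tree_of_list us)) 8 (\<lambda>s'. s' 41 = tree_of_list us \<and> ?L us s')"
          using J(2) by (auto simp: runs_simps intro!: exI[of _ "((u # us) # gs) # acc'"])
      qed (use J s s1 in \<open>auto simp: sum_list_triv\<close>)
    next
      have "?M ^ ?n \<le> ?M ^ m" using ws by (intro power_increasing) (auto simp: Suc_le_eq)
      then have "?M ^ ?n * (16 * ?M + 12) \<le> ?M ^ m * (16 * ?M + 12)" by (rule mult_le_mono1)
      then show "cost (Var 34) + 3 + (\<Sum>x\<leftarrow>map tree_of_tuple (tuples ws ?n). 16 * ?M + 4 + 8) \<le> ?B + 4"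
        by (simp add: sum_list_triv length_tuples o_def add.commute)
    next
      show "?J (map tree_of_tuple (tuples ws ?n)) (?s(39 := tree_of_list (map tree_of_tuple (tuples ws ?n))))" by (rule J0)
    qed (use s1 in auto)
    then have "runs (Seq (For 38 39 (Var 34) ?P) (Assign 34 (Var 37))) ?s (?B + 6) (\<lambda>s'. s' 36 = tree_of_list ys \<and> ?I ys s')"
      by (rule runs_Seq[OF runs_weaken[OF _ order.refl], where ?T2.0 = 2])
         (use s1 in \<open>auto simp: runs_simps n\<close>)
    then show "runs (Seq (Assign 37 Empty) (Seq (For 38 39 (Var 34) ?P) (Assign 34 (Var 37))))
        (s1(35 := x, 36 := tree_of_list ys)) (?B + 12) (\<lambda>s'. s' 36 = tree_of_list ys \<and> ?I ys s')"
      by (auto simp: runs_simps elim!: runs_weaken)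
  qed (use s in \<open>auto simp: tree_of_nat_conv sum_list_replicate algebra_simps\<close>)
  have "runs (Seq (For 35 36 (Var 6) (Seq (Assign 37 Empty) (Seq (For 38 39 (Var 34) ?P) (Assign 34 (Var 37))))) (Assign 6 (Var 34)))
     (s(34 := Node Leaf Leaf)) (T - 4) (\<lambda>s'. s' 6 = tree_of_list (map tree_of_tuple (tuples ws m)) \<and> (\<forall>v<10. v \<noteq> 6 \<longrightarrow> s' v = s v))"
    by (rule runs_Seq[OF runs_weaken[OF main order.refl], where ?T2.0 = 2]) (use T in \<open>auto simp: runs_simps\<close>)
  then show ?thesis using T by (simp add: gen_tuples_def runs_simps del: One_nat_def)
qed

section \<open>Unions of vectors and the test for canonical tuples\<close>

definition bits_of :: "nat \<Rightarrow> tree \<Rightarrow> tree \<Rightarrow> bool list" where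
  "bits_of n a b = map (\<lambda>i. bit_at i a \<or> bit_at i b) [0..<n]"

definition union_bits :: com where
  "union_bits = Seq (Assign 56 Empty) (Seq (Assign 57 (Var 53)) (Seq (Assign 58 (Var 54)) (Seq (For 59 60 (Var 2)
     (Seq (If (Hd (Var 57)) (Assign 56 (expr.Cons one (Var 56)))
        (If (Hd (Var 58)) (Assign 56 (expr.Cons one (Var 56))) (Assign 56 (expr.Cons Empty (Var 56)))))
       (Seq (Assign 57 (Tl (Var 57))) (Assign 58 (Tl (Var 58))))))
     (Seq (Assign 55 Empty) (For 59 60 (Var 56) (Assign 55 (expr.Cons (Var 59) (Var 55))))))))"

lemma runs_union_bits:
  assumes s: "s 2 = tree_of_list us" and T: "50 * length us + 50 \<le> T"
  shows "runs union_bits s T (\<lambda>s'. s' 55 = tree_of_bits (bits_of (length us) (s 53) (s 54)) \<and>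
      (\<forall>v. v \<notin> {55..60} \<longrightarrow> s' v = s v))"
proof -
  let ?n = "length us"
  let ?R = "map tree_of_bool (bits_of ?n (s 53) (s 54))"
  let ?s = "s(56 := Leaf, 57 := s 53, 58 := s 54)"
  let ?P = "Seq (If (Hd (Var 57)) (Assign 56 (expr.Cons one (Var 56)))
        (If (Hd (Var 58)) (Assign 56 (expr.Cons one (Var 56))) (Assign 56 (expr.Cons Empty (Var 56)))))
       (Seq (Assign 57 (Tl (Var 57))) (Assign 58 (Tl (Var 58))))"
  let ?Q = "\<lambda>s'. s' 55 = tree_of_list ?R \<and> (\<forall>v. v \<notin> {55..60} \<longrightarrow> s' v = s v)"
  let ?I = "\<lambda>ys s'. (\<exists>acc. s' 56 = tree_of_list acc \<and>
     rev (map tree_of_bool (bits_of (length ys) (s' 57) (s' 58))) @ acc = rev ?R) \<and> (\<forall>v. v \<notin> {55..60} \<longrightarrow> s' v = s v)"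
  have bits_Suc: "bits_of (Suc n) a b = (left a \<noteq> Leaf \<or> left b \<noteq> Leaf) # bits_of n (right a) (right b)" for n a b
    by (simp add: bits_of_def upt_conv_Cons map_Suc_upt[symmetric] bit_at_simps o_def del: upt_Suc)
  have 1: "runs (For 59 60 (Var 2) ?P) ?s (28 * ?n + 4) (?I [])"
  proof (rule runs_For[where xs = us and B = "\<lambda>_. 20" and Inv = ?I])
    fix x :: tree and ys :: "tree list" and s1 assume "?I (x # ys) s1"
    then obtain acc where "s1 56 = tree_of_list acc"
     "rev (map tree_of_bool (bits_of (length ys) (right (s1 57)) (right (s1 58)))) @
       tree_of_bool (left (s1 57) \<noteq> Leaf \<or> left (s1 58) \<noteq> Leaf) # acc = rev ?R" "(\<forall>v. v \<notin> {55..60} \<longrightarrow> s1 v = s v)"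
      by (auto simp: bits_Suc)
    then show "runs ?P (s1(59 := x, 60 := tree_of_list ys)) 20 (\<lambda>s'. s' 60 = tree_of_list ys \<and> ?I ys s')"
      by (auto simp: runs_simps intro!: exI[of _ "tree_of_bool (left (s1 57) \<noteq> Leaf \<or> left (s1 58) \<noteq> Leaf) # acc"])
  qed (use s in \<open>auto simp: sum_list_triv\<close>)
  have "runs (Seq (For 59 60 (Var 2) ?P) (Seq (Assign 55 Empty) (For 59 60 (Var 56) (Assign 55 (expr.Cons (Var 59) (Var 55))))))
     ?s (50 * ?n + 30) ?Q"
  proof (rule runs_Seq[OF runs_weaken[OF 1 order.refl], where ?T2.0 = "12 * ?n + 8"])
    fix s1 assume s1: "?I [] s1"
    let ?J = "\<lambda>ys s'. (\<exists>acc. s' 55 = tree_of_list acc \<and> rev ys @ acc = ?R) \<and> (\<forall>v. v \<notin> {55..60} \<longrightarrow> s' v = s v)"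
    have "runs (For 59 60 (Var 56) (Assign 55 (expr.Cons (Var 59) (Var 55)))) (s1(55 := Leaf)) (12 * ?n + 4) ?Q"
    proof (rule runs_For[where xs = "rev ?R" and B = "\<lambda>_. 4" and Inv = ?J])
      fix x ys s2 assume "?J (x # ys) s2"
      then obtain acc where "s2 55 = tree_of_list acc" "rev ys @ x # acc = ?R" "\<forall>v. v \<notin> {55..60} \<longrightarrow> s2 v = s v"
        by auto
      then show "runs (Assign 55 (expr.Cons (Var 59) (Var 55))) (s2(59 := x, 60 := tree_of_list ys)) 4
        (\<lambda>s'. s' 60 = tree_of_list ys \<and> ?J ys s')"
        by (auto simp: runs_simps intro!: exI[of _ "x # acc"])
    qed (use s1 in \<open>auto simp: sum_list_triv bits_of_def o_def intro!: exI[of _ "[]"]\<close>)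
    then show "runs (Seq (Assign 55 Empty) (For 59 60 (Var 56) (Assign 55 (expr.Cons (Var 59) (Var 55))))) s1 (12 * ?n + 8) ?Q"
      by (auto simp: runs_simps elim!: runs_weaken)
  qed auto
  then show ?thesis using T unfolding tree_of_bits_conv
    by (auto simp: union_bits_def runs_simps elim!: runs_weaken)
qed

text \<open>Several tuples may lead to the same set; if the patterns cover, exactly one of them is
  canonical, so the answers kept for different tuples are disjoint and nothing is lost.\<close>

fun canonical :: "nat \<Rightarrow> tree list list \<Rightarrow> tree \<Rightarrow> bool" where
  "canonical n [] Y \<longleftrightarrow> True"
| "canonical n (g # gs) Y \<longleftrightarrow>
     matches n (hd g) Y \<and> \<not> (\<exists>w\<in>set (tl g). matches n w Y) \<and> canonical n gs (drop_tree n Y)"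

definition check_canonical :: com where
  "check_canonical = Seq (Assign 65 one) (Seq (Assign 11 (Var 55)) (For 67 68 (Var 8)
     (Seq (Assign 10 (Hd (Var 67))) (Seq match_block (Seq (If (Var 17) Skip (Assign 65 Empty))
     (Seq (Assign 69 (Var 14)) (Seq (exists_match (Tl (Var 67))) (Seq (If (Var 20) (Assign 65 Empty) Skip)
     (Assign 11 (Var 69))))))))))"

lemma runs_check_canonical:
  assumes s: "s 3 = tree_of_list cs" "s 8 = tree_of_tuple gs"
    and gs: "\<forall>g\<in>set gs. g \<noteq> [] \<and> length g \<le> M"
    and T: "length gs * (M * (30 * length cs + 50) + 30 * length cs + 100) + 20 \<le> T"
  shows "runs check_canonical s T (\<lambda>s'. s' 65 = tree_of_bool (canonical (length cs) gs (s 55)) \<and>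
     (\<forall>v. v \<notin> {10..21} \<and> v \<notin> {65..69} \<longrightarrow> s' v = s v))"
proof -
  let ?c = "length cs"
  let ?b = "canonical ?c gs (s 55)"
  let ?B = "M * (30 * ?c + 50) + 30 * ?c + 92"
  let ?P = "Seq (Assign 10 (Hd (Var 67))) (Seq match_block (Seq (If (Var 17) Skip (Assign 65 Empty))
     (Seq (Assign 69 (Var 14)) (Seq (exists_match (Tl (Var 67))) (Seq (If (Var 20) (Assign 65 Empty) Skip)
     (Assign 11 (Var 69)))))))"
  let ?F = "\<lambda>s'. \<forall>v. v \<notin> {10..21} \<and> v \<notin> {65..69} \<longrightarrow> s' v = s v"
  let ?I = "\<lambda>ys s'. (\<exists>b hs. s' 65 = tree_of_bool b \<and> ys = map tree_of_list hs \<and> set hs \<subseteq> set gs \<and> (b \<and> canonical ?c hs (s' 11)) = ?b) \<and> ?F s'"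
  have "runs (For 67 68 (Var 8) ?P) (s(65 := Node Leaf Leaf, 11 := s 55)) (length gs * (?B + 8) + 4)
    (\<lambda>s'. s' 65 = tree_of_bool ?b \<and> ?F s')"
  proof (rule runs_For[where xs = "map tree_of_list gs" and B = "\<lambda>_. ?B" and Inv = ?I])
    fix x ys s1 assume I: "?I (x # ys) s1"
    obtain b h hs where b: "s1 65 = tree_of_bool b" "x = tree_of_list h" "ys = map tree_of_list hs" "set (h # hs) \<subseteq> set gs"
       "(b \<and> canonical ?c (h # hs) (s1 11)) = ?b" "?F s1"
    proof -
      from I obtain b hs' where *: "s1 65 = tree_of_bool b" "x # ys = map tree_of_list hs'" "set hs' \<subseteq> set gs"
        "(b \<and> canonical ?c hs' (s1 11)) = ?b" "?F s1"
        by (elim conjE exE) (rule that)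
      then obtain h hs where "hs' = h # hs" by (cases hs') auto
      with * show ?thesis by (intro that) auto
    qed
    then have h: "h \<noteq> []" "length h \<le> M" using gs by auto
    then obtain w ws where w: "h = w # ws" by (cases h) auto
    let ?s = "s1(67 := x, 68 := tree_of_list ys, 10 := w)"
    let ?Q = "\<lambda>s'. s' 68 = tree_of_list ys \<and> ?I ys s'"
    define m1 where "m1 \<longleftrightarrow> matches ?c w (s1 11)"
    define m2 where "m2 \<longleftrightarrow> (\<exists>w\<in>set ws. matches ?c w (s1 11))"
    have "runs (Seq match_block (Seq (If (Var 17) Skip (Assign 65 Empty))
     (Seq (Assign 69 (Var 14)) (Seq (exists_match (Tl (Var 67))) (Seq (If (Var 20) (Assign 65 Empty) Skip)
     (Assign 11 (Var 69))))))) ?s (?B - 4) ?Q"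
    proof (rule runs_Seq[OF runs_weaken[OF runs_match_block[OF _ order.refl] order.refl], where ?T2.0 = "M * (30 * ?c + 50) + 50"])
      fix s2 assume s2: "s2 17 = tree_of_bool (matches ?c (?s 10) (?s 11)) \<and> s2 14 = drop_tree ?c (?s 11) \<and> (\<forall>v. v \<notin> {12..17} \<longrightarrow> s2 v = ?s v)"
      let ?s2 = "s2(65 := tree_of_bool (b \<and> m1), 69 := drop_tree ?c (s1 11))"
      have "runs (Seq (exists_match (Tl (Var 67))) (Seq (If (Var 20) (Assign 65 Empty) Skip)
         (Assign 11 (Var 69)))) ?s2 (M * (30 * ?c + 50) + 35) ?Q"
      proof (rule runs_Seq[OF runs_weaken[OF runs_exists_match[where cs = cs and ws = ws, OF _ _ order.refl] order.refl], where ?T2.0 = 10])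
        show "?s2 3 = tree_of_list cs" using s2 b(6) s by simp
        show "eval_expr (Tl (Var 67)) (?s2(20 := Leaf)) = tree_of_list ws" using s2 b w by simp
        fix s3 assume s3: "s3 20 = tree_of_bool (\<exists>w\<in>set ws. matches ?c w (?s2 11)) \<and>
            (\<forall>v. v \<noteq> 10 \<and> v \<notin> {12..21} \<longrightarrow> s3 v = ?s2 v)"
        have "s3 20 = tree_of_bool m2" "s3 65 = tree_of_bool (b \<and> m1)" "s3 69 = drop_tree ?c (s1 11)" "s3 68 = tree_of_list ys" "?F s3"
          using s3 s2 b(6) by (auto simp: m2_def)
        moreover have "(b \<and> m1 \<and> \<not> m2 \<and> canonical ?c hs (drop_tree ?c (s1 11))) = ?b"
          using b(5) w by (simp add: m1_def m2_def)
        ultimately show "runs (Seq (If (Var 20) (Assign 65 Empty) Skip) (Assign 11 (Var 69))) s3 10 ?Q"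
          using b(3,4) by (auto simp: runs_simps ex_bool_eq intro!: exI[of _ hs])
      next
        have "length ws \<le> M" using h w by simp
        then have "length ws * (30 * ?c + 50) \<le> M * (30 * ?c + 50)" by (rule mult_le_mono1)
        then show "length ws * (30 * ?c + 50) + cost (Tl (Var 67)) + 5 + 10 \<le> M * (30 * ?c + 50) + 35"
          unfolding cost.simps by linarith
      qed
      \<comment> \<open>Both branches of the first conditional lead to the same store, in which
        register 65 holds \<open>b \<and> m1\<close>; the two branches can then be continued
        together.\<close>
      moreover have "s2(65 := Leaf, 69 := drop_tree ?c (s1 11)) = ?s2" if "s2 17 = Leaf" using that s2 by (simp add: m1_def)
      moreover have "s2(69 := drop_tree ?c (s1 11)) = ?s2" if "s2 17 \<noteq> Leaf"
        using that s2 b(1) by (auto simp: m1_def fun_eq_iff)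
      ultimately show "runs (Seq (If (Var 17) Skip (Assign 65 Empty))
       (Seq (Assign 69 (Var 14)) (Seq (exists_match (Tl (Var 67))) (Seq (If (Var 20) (Assign 65 Empty) Skip)
       (Assign 11 (Var 69)))))) s2 (M * (30 * ?c + 50) + 50) ?Q"
        using s2 by (auto simp: runs_simps elim!: runs_weaken)
    qed (use s b in auto)
    then show "runs ?P (s1(67 := x, 68 := tree_of_list ys)) ?B ?Q"
      using b w by (auto simp: runs_simps elim!: runs_weaken)
  qed (use s in \<open>auto simp: tree_of_tuple_def sum_list_triv o_def\<close>)
  then show ?thesis using T by (auto simp: check_canonical_def runs_simps algebra_simps elim!: runs_weaken)
qed

section \<open>Queries\<close>

lemma set_tuples: "set (tuples ws m) = {gs. length gs = m \<and> set gs \<subseteq> set (suffs ws)}"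
proof (induction m)
  case (Suc m)
  show ?case by (auto simp: tuples_Suc Suc length_Suc_conv image_iff)
qed auto

lemma set_suffs: "g \<in> set (suffs ws) \<Longrightarrow> g \<noteq> [] \<and> length g \<le> length ws \<and> hd g \<in> set ws"
  by (induction ws) auto

text \<open>Reads exactly \<open>n\<close> entries of any tree, padding with \<open>Leaf\<close>, so
  that consecutive blocks stay aligned whatever the length of a candidate's vector.\<close>

definition prefix_list :: "nat \<Rightarrow> tree \<Rightarrow> tree list" where
  "prefix_list n x = map (\<lambda>i. left (drop_tree i x)) [0..<n]"

lemma prefix_list_Suc: "prefix_list (Suc n) x = left x # prefix_list n (right x)"
  by (simp add: prefix_list_def upt_conv_Cons map_Suc_upt[symmetric] o_def del: upt_Suc)

lemma length_prefix_list [simp]: "length (prefix_list n x) = n"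
  by (simp add: prefix_list_def)

definition chosen :: "nat \<Rightarrow> tree list list \<Rightarrow> tree list" where
  "chosen c gs = concat (map (\<lambda>g. prefix_list c (left (hd g))) gs)"

definition rest_size :: "tree list list \<Rightarrow> nat" where
  "rest_size gs = (\<Sum>g\<leftarrow>gs. length (list_of_tree (right (hd g))))"

lemma length_chosen [simp]: "length (chosen c gs) = length gs * c"
  by (induction gs) (auto simp: chosen_def)

definition build_query :: com where
  "build_query = Seq (Assign 43 Empty) (Seq (Assign 44 Empty) (Seq (For 45 46 (Var 8)
      (Seq (Assign 47 (Hd (Hd (Var 45)))) (Seq (For 49 48 (Var 3)
         (Seq (Assign 43 (expr.Cons (Hd (Var 47)) (Var 43))) (Assign 47 (Tl (Var 47)))))
        (For 49 48 (Tl (Hd (Var 45))) (Assign 44 (expr.Cons Empty (Var 44)))))))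
     (Seq (Assign 50 Empty) (For 51 52 (Var 43) (Assign 50 (expr.Cons (Var 51) (Var 50)))))))"

lemma runs_build_query:
  assumes s: "s 3 = tree_of_list cs" "s 8 = tree_of_tuple gs"
    and gs: "\<forall>g\<in>set gs. g \<noteq> [] \<and> length (list_of_tree (right (hd g))) \<le> Q"
    and T: "length gs * (28 * length cs + 12 * Q + 50) + 20 \<le> T"
  shows "runs build_query s T (\<lambda>s'. s' 50 = tree_of_list (chosen (length cs) gs) \<and>
     s' 44 = tree_of_nat (rest_size gs) \<and> (\<forall>v<40. s' v = s v))"
proof -
  let ?c = "length cs"
  let ?B = "16 * ?c + 12 * Q + 20"
  let ?P1 = "Seq (Assign 43 (expr.Cons (Hd (Var 47)) (Var 43))) (Assign 47 (Tl (Var 47)))"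
  let ?P2 = "Assign 44 (expr.Cons Empty (Var 44))"
  let ?P = "Seq (Assign 47 (Hd (Hd (Var 45)))) (Seq (For 49 48 (Var 3) ?P1) (For 49 48 (Tl (Hd (Var 45))) ?P2))"
  let ?I = "\<lambda>ys s'. (\<exists>acc k hs. s' 43 = tree_of_list acc \<and> s' 44 = tree_of_nat k \<and> ys = map tree_of_list hs \<and>
     set hs \<subseteq> set gs \<and> rev (chosen ?c hs) @ acc = rev (chosen ?c gs) \<and> k + rest_size hs = rest_size gs) \<and>
     (\<forall>v<40. s' v = s v)"
  let ?J = "\<lambda>s'. s' 43 = tree_of_list (rev (chosen ?c gs)) \<and> s' 44 = tree_of_nat (rest_size gs) \<and> (\<forall>v<40. s' v = s v)"
  let ?K = "\<lambda>s'. s' 50 = tree_of_list (chosen ?c gs) \<and> s' 44 = tree_of_nat (rest_size gs) \<and> (\<forall>v<40. s' v = s v)"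
  let ?s = "s(43 := Leaf, 44 := Leaf)"
  have 1: "runs (For 45 46 (Var 8) ?P) ?s (length gs * (?B + 8) + 4) ?J"
  proof (rule runs_For[where xs = "map tree_of_list gs" and B = "\<lambda>_. ?B" and Inv = ?I])
    have "?I (map tree_of_list gs) (?s(46 := t))" for t
      by (rule conjI, rule exI[of _ "[]"], rule exI[of _ 0], rule exI[of _ gs]) auto
    then show "?I (map tree_of_list gs) (?s(46 := tree_of_list (map tree_of_list gs)))" .
  next
    fix x ys s1 assume I: "?I (x # ys) s1"
    obtain acc k h hs where b: "s1 43 = tree_of_list acc" "s1 44 = tree_of_nat k" "x = tree_of_list h"
      "ys = map tree_of_list hs" "set (h # hs) \<subseteq> set gs" "rev (chosen ?c (h # hs)) @ acc = rev (chosen ?c gs)"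
      "k + rest_size (h # hs) = rest_size gs" "\<forall>v<40. s1 v = s v"
    proof -
      from I obtain acc k hs' where *: "s1 43 = tree_of_list acc" "s1 44 = tree_of_nat k" "x # ys = map tree_of_list hs'"
        "set hs' \<subseteq> set gs" "rev (chosen ?c hs') @ acc = rev (chosen ?c gs)"
        "k + rest_size hs' = rest_size gs" "\<forall>v<40. s1 v = s v"
        by (elim conjE exE) (rule that)
      then obtain h hs where "hs' = h # hs" by (cases hs') auto
      with * show ?thesis by (intro that) auto
    qed
    then have "h \<noteq> []" and Q: "length (list_of_tree (right (hd h))) \<le> Q" using gs by auto
    then obtain w ws where w: "h = w # ws" by (cases h) auto
    let ?js = "list_of_tree (right w)"
    let ?s1 = "s1(45 := x, 46 := tree_of_list ys, 47 := left w)"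
    let ?acc = "rev (prefix_list ?c (left w)) @ acc"
    let ?Q = "\<lambda>s'. s' 46 = tree_of_list ys \<and> ?I ys s'"
    have "runs (Seq (For 49 48 (Var 3) ?P1) (For 49 48 (Tl (Hd (Var 45))) ?P2)) ?s1 (16 * ?c + 12 * Q + 14) ?Q"
    proof (rule runs_Seq)
      let ?L = "\<lambda>zs s'. (\<exists>acc'. s' 43 = tree_of_list acc' \<and> rev (prefix_list (length zs) (s' 47)) @ acc' = ?acc) \<and>
        s' 44 = tree_of_nat k \<and> (\<forall>v\<le>46. v \<noteq> 43 \<and> v \<noteq> 44 \<longrightarrow> s' v = ?s1 v)"
      show "runs (For 49 48 (Var 3) ?P1) ?s1 (16 * ?c + 4) (\<lambda>s'. runs (For 49 48 (Tl (Hd (Var 45))) ?P2) s' (12 * Q + 6) ?Q)"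
      proof (rule runs_For[where xs = cs and B = "\<lambda>_. 8" and Inv = ?L])
        fix z :: tree and zs :: "tree list" and s2 assume "?L (z # zs) s2"
        then show "runs ?P1 (s2(49 := z, 48 := tree_of_list zs)) 8 (\<lambda>s'. s' 48 = tree_of_list zs \<and> ?L zs s')"
          by (auto simp: runs_simps prefix_list_Suc) (metis append.left_neutral append_Cons tree_of_list.simps(2))
      next
        fix s2 assume L: "?L [] s2"
        then have L43: "s2 43 = tree_of_list ?acc" by (auto simp: prefix_list_def)
        let ?M = "\<lambda>zs s'. (\<exists>k'. s' 44 = tree_of_nat k' \<and> k' + length zs = k + length ?js) \<and> s' 43 = s2 43 \<and>
          (\<forall>v\<le>46. v \<noteq> 43 \<and> v \<noteq> 44 \<longrightarrow> s' v = ?s1 v)"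
        show "runs (For 49 48 (Tl (Hd (Var 45))) ?P2) s2 (12 * Q + 6) ?Q"
        proof (rule runs_For[where xs = ?js and B = "\<lambda>_. 4" and Inv = ?M])
          fix z :: tree and zs :: "tree list" and s3 assume "?M (z # zs) s3"
          then obtain k' where "s3 44 = tree_of_nat k'" "Suc k' + length zs = k + length ?js" "s3 43 = s2 43"
            "\<forall>v\<le>46. v \<noteq> 43 \<and> v \<noteq> 44 \<longrightarrow> s3 v = ?s1 v" by auto
          then show "runs ?P2 (s3(49 := z, 48 := tree_of_list zs)) 4 (\<lambda>s'. s' 48 = tree_of_list zs \<and> ?M zs s')"
            by (auto simp: runs_simps intro!: exI[of _ "Suc k'"])
        next
          fix s3 assume M: "?M [] s3"
          have "rev (chosen ?c hs) @ ?acc = rev (chosen ?c gs)" "k + length ?js + rest_size hs = rest_size gs"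
            using b(6,7) w by (auto simp: chosen_def rest_size_def)
          moreover have "s3 43 = tree_of_list ?acc" "s3 44 = tree_of_nat (k + length ?js)" using M L43 by auto
          moreover have "\<forall>v<40. s3 v = s v" using M b(8) by simp
          ultimately have "?I ys s3" using b(4,5) by (intro conjI exI[of _ ?acc] exI[of _ "k + length ?js"] exI[of _ hs]) auto
          then show "?Q s3" using M by simp
        qed (use L b w Q in \<open>auto simp: sum_list_triv\<close>)
      qed (use b s in \<open>auto simp: sum_list_triv\<close>)
    qed auto
    then show "runs ?P (s1(45 := x, 46 := tree_of_list ys)) ?B ?Q"
      using b(3) w by (auto simp: runs_simps elim!: runs_weaken)
  next
    fix s1 assume "?I [] s1"
    then show "?J s1" by (auto simp: chosen_def rest_size_def)
  qed (use s in \<open>auto simp: tree_of_tuple_def sum_list_triv o_def algebra_simps\<close>)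
  have "runs (Seq (For 45 46 (Var 8) ?P) (Seq (Assign 50 Empty) (For 51 52 (Var 43) (Assign 50 (expr.Cons (Var 51) (Var 50)))))) ?s
     (T - 4) ?K"
  proof (rule runs_Seq[OF runs_weaken[OF 1 order.refl], where ?T2.0 = "12 * (length gs * ?c) + 8"])
    fix s1 assume s1: "?J s1"
    let ?L = "\<lambda>ys s'. (\<exists>acc. s' 50 = tree_of_list acc \<and> rev ys @ acc = chosen ?c gs) \<and> s' 44 = tree_of_nat (rest_size gs) \<and> (\<forall>v<40. s' v = s v)"
    have "runs (For 51 52 (Var 43) (Assign 50 (expr.Cons (Var 51) (Var 50)))) (s1(50 := Leaf)) (12 * (length gs * ?c) + 4) ?K"
    proof (rule runs_For[where xs = "rev (chosen ?c gs)" and B = "\<lambda>_. 4" and Inv = ?L])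
      fix x ys s2 assume "?L (x # ys) s2"
      then obtain acc where "s2 50 = tree_of_list acc" "rev ys @ x # acc = chosen ?c gs" "s2 44 = tree_of_nat (rest_size gs)" "\<forall>v<40. s2 v = s v"
        by auto
      then show "runs (Assign 50 (expr.Cons (Var 51) (Var 50))) (s2(51 := x, 52 := tree_of_list ys)) 4
        (\<lambda>s'. s' 52 = tree_of_list ys \<and> ?L ys s')"
        by (auto simp: runs_simps intro!: exI[of _ "x # acc"])
    qed (use s1 in \<open>auto simp: sum_list_triv intro!: exI[of _ "[]"]\<close>)
    then show "runs (Seq (Assign 50 Empty) (For 51 52 (Var 43) (Assign 50 (expr.Cons (Var 51) (Var 50))))) s1 (12 * (length gs * ?c) + 8) ?K"
      by (auto simp: runs_simps elim!: runs_weaken)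
  qed (use T in \<open>auto simp: algebra_simps\<close>)
  then show ?thesis using T by (simp add: build_query_def runs_simps del: One_nat_def)
qed

definition query :: "com \<Rightarrow> com" where
  "query p = Seq build_query (Seq (Assign 53 Empty) (Seq (Assign 54 (Var 50)) (Seq union_bits (Seq (Assign 61 (Var 55))
     (Seq (call 100 p (expr.Cons (Var 1) (expr.Cons (Var 61) (Var 44))) 62)
       (For 63 64 (Var 62) (Seq (Assign 53 (Var 63)) (Seq (Assign 54 (Var 61)) (Seq union_bits (Seq check_canonical
         (If (Var 65) (Assign 9 (expr.Cons (Var 55) (Var 9))) Skip)))))))))))"

text \<open>The union with the empty set serves to normalise: entries of a candidate may be
  arbitrary trees, and the part of the last block beyond the universe is cut off.\<close>

definition chosen_bits :: "nat \<Rightarrow> nat \<Rightarrow> tree list list \<Rightarrow> bool list" where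
  "chosen_bits n c gs = bits_of n Leaf (tree_of_list (chosen c gs))"

definition answers :: "nat \<Rightarrow> nat \<Rightarrow> tree list list \<Rightarrow> bool list list \<Rightarrow> bool list list" where
  "answers n c gs L = filter (\<lambda>Y. canonical c gs (tree_of_bits Y))
     (map (\<lambda>S. bits_of n (tree_of_bits S) (tree_of_bits (chosen_bits n c gs))) L)"

lemma runs_query:
  assumes s: "s 2 = tree_of_list us" "s 3 = tree_of_list cs" "s 8 = tree_of_tuple gs" "s 9 = tree_of_list (map tree_of_bits out)"
    and gs: "\<forall>g\<in>set gs. g \<noteq> [] \<and> length g \<le> M \<and> length (list_of_tree (right (hd g))) \<le> Q"
    and p: "computes_in p (Node (s 1) (Node (tree_of_bits (chosen_bits (length us) (length cs) gs)) (tree_of_nat (rest_size gs))))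
       (tree_of_list (map tree_of_bits L)) t"
    and T: "length gs * (28 * length cs + 12 * Q + 50) + 50 * length us + t + 2 * var_bound p + 150 +
       length L * (50 * length us + length gs * (M * (30 * length cs + 50) + 30 * length cs + 100) + 100) \<le> T"
  shows "runs (query p) s T (\<lambda>s'. s' 9 = tree_of_list (map tree_of_bits (rev (answers (length us) (length cs) gs L) @ out)) \<and>
      (\<forall>v<9. s' v = s v))"
proof -
  let ?n = "length us" and ?c = "length cs"
  let ?X = "chosen_bits ?n ?c gs"
  let ?D = "length gs * (M * (30 * ?c + 50) + 30 * ?c + 100) + 20"
  let ?B = "50 * ?n + ?D + 70"
  let ?C = "Seq (Assign 53 (Var 63)) (Seq (Assign 54 (Var 61)) (Seq union_bits (Seq check_canonical
         (If (Var 65) (Assign 9 (expr.Cons (Var 55) (Var 9))) Skip))))"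
  let ?e = "expr.Cons (Var 1) (expr.Cons (Var 61) (Var 44))"
  let ?F = "\<lambda>s'. \<forall>v<9. s' v = s v"
  let ?Q = "\<lambda>s'. s' 9 = tree_of_list (map tree_of_bits (rev (answers ?n ?c gs L) @ out)) \<and> ?F s'"
  let ?u = "\<lambda>S. bits_of ?n (tree_of_bits S) (tree_of_bits ?X)"
  have loop: "runs (For 63 64 (Var 62) ?C) s1 (length L * (?B + 8) + 4) ?Q"
    if s1: "s1 62 = tree_of_list (map tree_of_bits L)" "s1 61 = tree_of_bits ?X" "s1 9 = s 9" "?F s1" for s1
  proof -
    let ?I = "\<lambda>ys s'. (\<exists>acc L'. ys = map tree_of_bits L' \<and> s' 9 = tree_of_list (map tree_of_bits acc) \<and>
       rev (answers ?n ?c gs L') @ acc = rev (answers ?n ?c gs L) @ out) \<and> s' 61 = tree_of_bits ?X \<and> ?F s'"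
    show ?thesis
    proof (rule runs_For[where xs = "map tree_of_bits L" and B = "\<lambda>_. ?B" and Inv = ?I])
      have "?I (map tree_of_bits L) (s1(64 := t))" for t
        by (rule conjI, rule exI[of _ out], rule exI[of _ L]) (use s s1 in auto)
      then show "?I (map tree_of_bits L) (s1(64 := tree_of_list (map tree_of_bits L)))" .
    next
      fix x ys s2 assume I: "?I (x # ys) s2"
      obtain acc S L' where b: "x = tree_of_bits S" "ys = map tree_of_bits L'" "s2 9 = tree_of_list (map tree_of_bits acc)"
        "rev (answers ?n ?c gs (S # L')) @ acc = rev (answers ?n ?c gs L) @ out" "s2 61 = tree_of_bits ?X" "?F s2"
      proof -
        from I obtain acc L'' where *: "x # ys = map tree_of_bits L''" "s2 9 = tree_of_list (map tree_of_bits acc)"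
          "rev (answers ?n ?c gs L'') @ acc = rev (answers ?n ?c gs L) @ out" "s2 61 = tree_of_bits ?X" "?F s2"
          by (elim conjE exE) (rule that)
        then obtain S L' where "L'' = S # L'" by (cases L'') auto
        with * show ?thesis by (intro that) auto
      qed
      let ?s = "s2(63 := x, 64 := tree_of_list ys, 53 := x, 54 := s2 61)"
      let ?R = "\<lambda>s'. s' 64 = tree_of_list ys \<and> ?I ys s'"
      have "runs (Seq union_bits (Seq check_canonical (If (Var 65) (Assign 9 (expr.Cons (Var 55) (Var 9))) Skip))) ?s (?B - 4) ?R"
      proof (rule runs_Seq[OF runs_weaken[OF runs_union_bits[OF _ order.refl] order.refl], where ?T2.0 = "?D + 10"])
        show "?s 2 = tree_of_list us" using b s by simp
        fix s3 assume s3: "s3 55 = tree_of_bits (bits_of ?n (?s 53) (?s 54)) \<and> (\<forall>v. v \<notin> {55..60} \<longrightarrow> s3 v = ?s v)"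
        show "runs (Seq check_canonical (If (Var 65) (Assign 9 (expr.Cons (Var 55) (Var 9))) Skip)) s3 (?D + 10) ?R"
        proof (rule runs_Seq[OF runs_weaken[OF runs_check_canonical[where cs = cs and M = M and gs = gs, OF _ _ _ order.refl] order.refl], where ?T2.0 = 10])
          show "s3 3 = tree_of_list cs" "s3 8 = tree_of_tuple gs" using s3 b s by auto
          show "\<forall>g\<in>set gs. g \<noteq> [] \<and> length g \<le> M" using gs by auto
          fix s4 assume s4: "s4 65 = tree_of_bool (canonical ?c gs (s3 55)) \<and> (\<forall>v. v \<notin> {10..21} \<and> v \<notin> {65..69} \<longrightarrow> s4 v = s3 v)"
          let ?acc = "if canonical ?c gs (tree_of_bits (?u S)) then ?u S # acc else acc"
          have 4: "s4 65 = tree_of_bool (canonical ?c gs (tree_of_bits (?u S)))" "s4 55 = tree_of_bits (?u S)"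
            "s4 9 = tree_of_list (map tree_of_bits acc)" "s4 61 = tree_of_bits ?X" "?F s4" "s4 64 = tree_of_list ys"
            using s4 s3 b by auto
          have acc: "rev (answers ?n ?c gs L') @ ?acc = rev (answers ?n ?c gs L) @ out"
            using b(4) by (auto simp: answers_def)
          have "runs (If (Var 65) (Assign 9 (expr.Cons (Var 55) (Var 9))) Skip) s4 10
             (\<lambda>s'. s' 9 = tree_of_list (map tree_of_bits ?acc) \<and> s' 61 = tree_of_bits ?X \<and> ?F s' \<and> s' 64 = tree_of_list ys)"
            using 4 by (auto simp: runs_simps)
          then show "runs (If (Var 65) (Assign 9 (expr.Cons (Var 55) (Var 9))) Skip) s4 10 ?R"
          proof (rule runs_weaken)
            fix s' assume "s' 9 = tree_of_list (map tree_of_bits ?acc) \<and> s' 61 = tree_of_bits ?X \<and> ?F s' \<and> s' 64 = tree_of_list ys"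
            then show "?R s'" using b(2) acc
              by (intro conjI exI[of _ ?acc] exI[of _ L']) blast+
          qed simp
        qed simp
      qed auto
      then show "runs ?C (s2(63 := x, 64 := tree_of_list ys)) ?B ?R"
        by (auto simp: runs_simps elim!: runs_weaken)
    qed (use s1 in \<open>auto simp: sum_list_triv answers_def o_def algebra_simps\<close>)
  qed
  show ?thesis unfolding query_def
  proof (rule runs_Seq[OF runs_weaken[OF runs_build_query[where cs = cs and gs = gs and Q = Q, OF _ _ _ order.refl] order.refl],
        where ?T2.0 = "50 * ?n + t + 2 * var_bound p + 120 + length L * (?B + 8)"])
    show "s 3 = tree_of_list cs" "s 8 = tree_of_tuple gs" by fact+
    show "\<forall>g\<in>set gs. g \<noteq> [] \<and> length (list_of_tree (right (hd g))) \<le> Q" using gs by auto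
    fix s1 assume s1: "s1 50 = tree_of_list (chosen ?c gs) \<and> s1 44 = tree_of_nat (rest_size gs) \<and> (\<forall>v<40. s1 v = s v)"
    let ?s1 = "s1(53 := Leaf, 54 := s1 50)"
    have "runs (Seq union_bits (Seq (Assign 61 (Var 55)) (Seq (call 100 p ?e 62) (For 63 64 (Var 62) ?C)))) ?s1
       (50 * ?n + t + 2 * var_bound p + 110 + length L * (?B + 8)) ?Q"
    proof (rule runs_Seq[OF runs_weaken[OF runs_union_bits[OF _ order.refl] order.refl], where ?T2.0 = "t + 2 * var_bound p + 60 + length L * (?B + 8)"])
      show "?s1 2 = tree_of_list us" using s s1 by simp
      fix s2 assume s2: "s2 55 = tree_of_bits (bits_of ?n (?s1 53) (?s1 54)) \<and> (\<forall>v. v \<notin> {55..60} \<longrightarrow> s2 v = ?s1 v)"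
      let ?s2 = "s2(61 := tree_of_bits ?X)"
      have 2: "s2 55 = tree_of_bits ?X" using s1 s2 by (simp add: chosen_bits_def)
      have "runs (Seq (call 100 p ?e 62) (For 63 64 (Var 62) ?C)) ?s2 (t + 2 * var_bound p + 50 + length L * (?B + 8)) ?Q"
      proof (rule runs_Seq[OF runs_weaken[OF runs_call[OF _ _ _ order.refl] order.refl], where ?T2.0 = "length L * (?B + 8) + 4"])
        show "computes_in p (eval_expr ?e ?s2) (tree_of_list (map tree_of_bits L)) t"
          using p s1 s2 by simp
        fix s3 assume "s3 62 = tree_of_list (map tree_of_bits L) \<and> (\<forall>v<100. v \<noteq> 62 \<longrightarrow> s3 v = ?s2 v)"
        then show "runs (For 63 64 (Var 62) ?C) s3 (length L * (?B + 8) + 4) ?Q"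
          using s1 s2 by (intro loop) auto
      qed auto
      then show "runs (Seq (Assign 61 (Var 55)) (Seq (call 100 p ?e 62) (For 63 64 (Var 62) ?C))) s2
         (t + 2 * var_bound p + 60 + length L * (?B + 8)) ?Q"
        using 2 by (auto simp: runs_simps elim!: runs_weaken)
    qed auto
    then show "runs (Seq (Assign 53 Empty) (Seq (Assign 54 (Var 50)) (Seq union_bits (Seq (Assign 61 (Var 55)) (Seq (call 100 p ?e 62) (For 63 64 (Var 62) ?C)))))) s1
       (50 * ?n + t + 2 * var_bound p + 120 + length L * (?B + 8)) ?Q"
      by (auto simp: runs_simps elim!: runs_weaken)
  qed (use T in \<open>auto simp: algebra_simps\<close>)
qed

section \<open>The enumeration for given patterns\<close>

lemma height_tree_of_nat: "height (tree_of_nat k) = k"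
  by (induction k) auto

lemma height_tree_of_bits: "height (tree_of_bits bs) \<le> length bs + 1"
  by (induction bs) (auto simp: tree_of_bool_def)

lemma runs_exec_Seq: "exec p s t s' \<Longrightarrow> runs q s' T Q \<Longrightarrow> runs (Seq p q) s (t + T) Q"
  by (rule runs_Seq[OF _ order.refl]) (unfold runs_def[of p], blast)

text \<open>An arbitrary tree is read as a candidate; both of its components are forced to be nonempty
  lists, and \<open>blocks a\<close> matters only through its length, the block size.\<close>

definition blocks :: "tree \<Rightarrow> tree list" where
  "blocks a = left (left a) # list_of_tree (right (left a))"

definition patterns :: "tree \<Rightarrow> tree list" where
  "patterns a = left (right a) # list_of_tree (right (right a))"

text \<open>The enumeration is carried out even if the coverage test fails; the verdict is returned
  beside the list, and the search ignores lists without a positive one.\<close>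

definition solve :: "com \<Rightarrow> com" where
  "solve p = Seq (Assign 1 (Hd (Hd (Var 0)))) (Seq (Assign 2 (Tl (Hd (Var 0))))
     (Seq (Assign 3 (expr.Cons (Hd (Hd (Tl (Var 0)))) (Tl (Hd (Tl (Var 0))))))
     (Seq (Assign 4 (expr.Cons (Hd (Tl (Tl (Var 0)))) (Tl (Tl (Tl (Var 0))))))
     (Seq check_cover (Seq count_blocks (Seq gen_tuples (Seq (Assign 9 Empty)
     (Seq (For 8 7 (Var 6) (query p)) (Assign 0 (expr.Cons (Var 5) (Var 9)))))))))))"

definition query_cost :: "nat \<Rightarrow> nat \<Rightarrow> nat \<Rightarrow> nat \<Rightarrow> nat \<Rightarrow> nat \<Rightarrow> nat \<Rightarrow> nat \<Rightarrow> nat" where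
  "query_cost b n m c M Q l t = m * (28 * c + 12 * Q + 50) + 50 * n + t + 2 * b + 150 +
     l * (50 * n + m * (M * (30 * c + 50) + 30 * c + 100) + 100)"

definition time :: "tree list \<Rightarrow> (bool list \<Rightarrow> nat \<Rightarrow> nat) \<Rightarrow> nat \<Rightarrow> tree list list \<Rightarrow> nat" where
  "time us t c gs = t (chosen_bits (length us) c gs) (rest_size gs)"

definition found :: "tree list \<Rightarrow> (bool list \<Rightarrow> nat \<Rightarrow> bool list list) \<Rightarrow> nat \<Rightarrow> tree list list \<Rightarrow> bool list list" where
  "found us L c gs = L (chosen_bits (length us) c gs) (rest_size gs)"

definition listing :: "tree list \<Rightarrow> (bool list \<Rightarrow> nat \<Rightarrow> bool list list) \<Rightarrow> nat \<Rightarrow> tree list \<Rightarrow> nat \<Rightarrow> bool list list" where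
  "listing us L c ws m = rev (concat (map (\<lambda>gs. answers (length us) c gs (found us L c gs)) (tuples ws m)))"

lemma runs_solve:
  assumes p: "\<And>X k. length X = length us \<Longrightarrow> computes_in p (Node It (Node (tree_of_bits X) (tree_of_nat k)))
      (tree_of_list (map tree_of_bits (L X k))) (t X k)"
    and Q: "\<forall>w\<in>set (patterns a). length (list_of_tree (right w)) \<le> Q"
  defines "c \<equiv> length (blocks a)" and "ws \<equiv> patterns a" and "n \<equiv> length us"
  shows "\<exists>m T. n \<le> m * c \<and> m * c < n + c \<and>
    computes_in (solve p) (Node (Node It (tree_of_list us)) a)
      (Node (tree_of_bool (covers c ws)) (tree_of_list (map tree_of_bits (listing us L c ws m)))) T \<and>
    T \<le> cover_cost c (length ws) + (n + 1) * (11 * c + 12) + m * (length ws ^ m * (16 * length ws + 12) + 20) + 100 +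
      (\<Sum>gs\<leftarrow>tuples ws m. query_cost (var_bound p) n m c (length ws) Q (length (found us L c gs)) (time us t c gs) + 8)"
proof -
  let ?M = "length ws"
  let ?cs = "blocks a"
  define s0 :: store where "s0 = (\<lambda>_. Leaf)(0 := Node (Node It (tree_of_list us)) a, 1 := It, 2 := tree_of_list us,
      3 := tree_of_list ?cs, 4 := tree_of_list ws)"
  have a: "Node (left (left a)) (right (left a)) = tree_of_list ?cs" "Node (left (right a)) (right (right a)) = tree_of_list ws"
    by (simp_all add: blocks_def patterns_def ws_def)
  have ne: "?cs \<noteq> []" "ws \<noteq> []" by (simp_all add: blocks_def patterns_def ws_def)
  obtain t1 s1 where 1: "exec check_cover s0 t1 s1" "t1 \<le> cover_cost c ?M"
    "s1 5 = tree_of_bool (covers c ws)" "\<forall>v<10. v \<noteq> 5 \<longrightarrow> s1 v = s0 v"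
    using runs_check_cover[of s0 ?cs ws, OF _ _ order.refl] unfolding runs_def c_def by (auto simp: s0_def)
  obtain t2 s2 m where 2: "exec count_blocks s1 t2 s2" "t2 \<le> (n + 1) * (11 * c + 12) + 4"
    "s2 6 = tree_of_nat m" "n \<le> m * c" "m * c < n + c" "\<forall>v<10. v \<noteq> 6 \<longrightarrow> s2 v = s1 v"
    using runs_count_blocks[of s1 us ?cs, OF _ _ _ order.refl] 1(4) ne unfolding runs_def c_def n_def by (auto simp: s0_def)
  obtain t3 s3 where 3: "exec gen_tuples s2 t3 s3" "t3 \<le> m * (?M ^ m * (16 * ?M + 12) + 20) + 20"
    "s3 6 = tree_of_list (map tree_of_tuple (tuples ws m))" "\<forall>v<10. v \<noteq> 6 \<longrightarrow> s3 v = s2 v"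
    using runs_gen_tuples[of s2 ws m, OF _ _ _ order.refl] 1(4) 2(3,6) ne unfolding runs_def by (auto simp: s0_def)
  let ?q = "\<lambda>gs. query_cost (var_bound p) n m c ?M Q (length (found us L c gs)) (time us t c gs)"
  \<comment> \<open>Queries differ in cost, and \<open>runs_For\<close> charges per list element,
    here a tree; decoding recovers the tuple and with it the time of its query.\<close>
  let ?dec = "\<lambda>x. map list_of_tree (list_of_tree x)"
  have dec: "?dec (tree_of_tuple gs) = gs" for gs by (simp add: tree_of_tuple_def o_def)
  let ?ans = "\<lambda>gs. answers n c gs (found us L c gs)"
  let ?s3 = "s3(9 := Leaf)"
  have s3: "s3 1 = It" "s3 2 = tree_of_list us" "s3 3 = tree_of_list ?cs" "s3 4 = tree_of_list ws" "s3 5 = tree_of_bool (covers c ws)"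
    using 3(4) 2(6) 1(3,4) by (auto simp: s0_def)
  let ?F = "\<lambda>s'. \<forall>v\<in>{1,2,3,4,5}. s' v = s3 v"
  let ?I = "\<lambda>ys s'. (\<exists>acc G. ys = map tree_of_tuple G \<and> s' 9 = tree_of_list (map tree_of_bits acc) \<and>
     rev (concat (map ?ans G)) @ acc = listing us L c ws m) \<and> ?F s'"
  have loop: "runs (For 8 7 (Var 6) (query p)) ?s3 ((\<Sum>gs\<leftarrow>tuples ws m. ?q gs + 8) + 4)
    (\<lambda>s'. s' 9 = tree_of_list (map tree_of_bits (listing us L c ws m)) \<and> s' 5 = tree_of_bool (covers c ws))"
  proof (rule runs_For[where xs = "map tree_of_tuple (tuples ws m)" and B = "\<lambda>x. ?q (?dec x)" and Inv = ?I])
    have "?I (map tree_of_tuple (tuples ws m)) (?s3(7 := x))" for x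
      by (rule conjI, rule exI[of _ "[]"], rule exI[of _ "tuples ws m"]) (auto simp: listing_def n_def)
    then show "?I (map tree_of_tuple (tuples ws m)) (?s3(7 := tree_of_list (map tree_of_tuple (tuples ws m))))" .
  next
    fix x ys s' assume I: "?I (x # ys) s'" and x: "x \<in> set (map tree_of_tuple (tuples ws m))"
    obtain acc gs G where b: "x = tree_of_tuple gs" "ys = map tree_of_tuple G" "s' 9 = tree_of_list (map tree_of_bits acc)"
      "rev (concat (map ?ans (gs # G))) @ acc = listing us L c ws m" "?F s'"
    proof -
      from I obtain acc G' where *: "x # ys = map tree_of_tuple G'" "s' 9 = tree_of_list (map tree_of_bits acc)"
        "rev (concat (map ?ans G')) @ acc = listing us L c ws m" "?F s'"
        by (elim conjE exE) (rule that)
      then obtain gs G where "G' = gs # G" by (cases G') auto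
      with * show ?thesis by (intro that) auto
    qed
    from x b(1) have "gs \<in> set (tuples ws m)" using dec by (metis (no_types, lifting) imageE list.set_map)
    then have gs: "length gs = m" "set gs \<subseteq> set (suffs ws)" by (auto simp: set_tuples)
    have gs': "\<forall>g\<in>set gs. g \<noteq> [] \<and> length g \<le> ?M \<and> length (list_of_tree (right (hd g))) \<le> Q"
      using gs(2) set_suffs Q unfolding ws_def by blast
    let ?s' = "s'(8 := x, 7 := tree_of_list ys)"
    show "runs (query p) ?s' (?q (?dec x)) (\<lambda>s'. s' 7 = tree_of_list ys \<and> ?I ys s')"
    proof (rule runs_weaken[OF runs_query[where us = us and cs = ?cs and gs = gs and out = acc and M = ?M and Q = Q and
            L = "found us L c gs" and t = "time us t c gs", OF _ _ _ _ gs' _ order.refl]])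
      show "?s' 2 = tree_of_list us" "?s' 3 = tree_of_list ?cs" "?s' 8 = tree_of_tuple gs" "?s' 9 = tree_of_list (map tree_of_bits acc)"
        using b s3 by auto
      have "?s' 1 = It" using b s3 by simp
      then show "computes_in p (Node (?s' 1) (Node (tree_of_bits (chosen_bits (length us) (length ?cs) gs)) (tree_of_nat (rest_size gs))))
         (tree_of_list (map tree_of_bits (found us L c gs))) (time us t c gs)"
        using p[of "chosen_bits (length us) c gs" "rest_size gs"]
        by (simp add: found_def time_def c_def chosen_bits_def bits_of_def)
      fix s''
      assume "s'' 9 = tree_of_list (map tree_of_bits (rev (answers (length us) (length ?cs) gs (found us L c gs)) @ acc)) \<and> (\<forall>v<9. s'' v = ?s' v)"
      then have *: "s'' 9 = tree_of_list (map tree_of_bits (rev (?ans gs) @ acc))" "s'' 7 = tree_of_list ys" "?F s''"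
        using b(5) by (auto simp: n_def c_def)
      have "?I ys s''"
        by (rule conjI, rule exI[of _ "rev (?ans gs) @ acc"], rule exI[of _ G]) (use * b in auto)
      with * show "s'' 7 = tree_of_list ys \<and> ?I ys s''" by blast
    qed (simp add: b(1) dec query_cost_def gs(1) n_def c_def)
  next
    show "cost (Var 6) + 3 + (\<Sum>x\<leftarrow>map tree_of_tuple (tuples ws m). ?q (?dec x) + 8) \<le> (\<Sum>gs\<leftarrow>tuples ws m. ?q gs + 8) + 4"
      by (simp add: o_def dec)
  next
    fix s' assume "?I [] s'"
    then show "s' 9 = tree_of_list (map tree_of_bits (listing us L c ws m)) \<and> s' 5 = tree_of_bool (covers c ws)"
      using s3 by auto
  qed (use 3 in auto)
  let ?T = "cover_cost c ?M + (n + 1) * (11 * c + 12) + m * (?M ^ m * (16 * ?M + 12) + 20) + 100 +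
      (\<Sum>gs\<leftarrow>tuples ws m. ?q gs + 8)"
  have "runs (Seq check_cover (Seq count_blocks (Seq gen_tuples (Seq (Assign 9 Empty)
     (Seq (For 8 7 (Var 6) (query p)) (Assign 0 (expr.Cons (Var 5) (Var 9)))))))) s0 (?T - 50)
     (\<lambda>s'. s' 0 = Node (tree_of_bool (covers c ws)) (tree_of_list (map tree_of_bits (listing us L c ws m))))" (is "runs _ _ _ ?R")
  proof (rule runs_Seq[where ?T1.0 = t1])
    have "runs (Seq (For 8 7 (Var 6) (query p)) (Assign 0 (expr.Cons (Var 5) (Var 9)))) ?s3 ((\<Sum>gs\<leftarrow>tuples ws m. ?q gs + 8) + 8) ?R"
      by (rule runs_Seq[OF runs_weaken[OF loop order.refl], where ?T2.0 = 4]) (auto simp: runs_simps)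
    then have "runs (Seq (Assign 9 Empty) (Seq (For 8 7 (Var 6) (query p)) (Assign 0 (expr.Cons (Var 5) (Var 9))))) s3
       ((\<Sum>gs\<leftarrow>tuples ws m. ?q gs + 8) + 10) ?R"
      by (simp add: runs_simps add.commute)
    then have "runs (Seq gen_tuples (Seq (Assign 9 Empty) (Seq (For 8 7 (Var 6) (query p)) (Assign 0 (expr.Cons (Var 5) (Var 9)))))) s2
       (t3 + ((\<Sum>gs\<leftarrow>tuples ws m. ?q gs + 8) + 10)) ?R"
      by (rule runs_exec_Seq[OF 3(1)])
    then have "runs (Seq count_blocks (Seq gen_tuples (Seq (Assign 9 Empty) (Seq (For 8 7 (Var 6) (query p)) (Assign 0 (expr.Cons (Var 5) (Var 9))))))) s1
       (t2 + (t3 + ((\<Sum>gs\<leftarrow>tuples ws m. ?q gs + 8) + 10))) ?R"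
      by (rule runs_exec_Seq[OF 2(1)])
    then show "runs check_cover s0 t1 (\<lambda>s1. runs (Seq count_blocks (Seq gen_tuples (Seq (Assign 9 Empty) (Seq (For 8 7 (Var 6) (query p)) (Assign 0 (expr.Cons (Var 5) (Var 9))))))) s1
       (t2 + (t3 + ((\<Sum>gs\<leftarrow>tuples ws m. ?q gs + 8) + 10))) ?R)"
      using 1(1) unfolding runs_def[of check_cover] by blast
  qed (use 1(2) 2(2) 3(2) in simp)
  then have "runs (solve p) ((\<lambda>_. Leaf)(0 := Node (Node It (tree_of_list us)) a)) ?T ?R"
    by (simp add: solve_def runs_simps a s0_def fun_upd_twist runs_weaken)
  then obtain T s' where "exec (solve p) ((\<lambda>_. Leaf)(0 := Node (Node It (tree_of_list us)) a)) T s'" "T \<le> ?T" "?R s'"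
    by (auto simp: runs_def)
  then show ?thesis using 2(4,5) unfolding computes_in_def by blast
qed

section \<open>Correctness of the enumeration\<close>

definition count :: "(nat \<Rightarrow> bool) \<Rightarrow> nat \<Rightarrow> nat" where
  "count P n = card {i. i < n \<and> P i}"

lemma count_sum: "count P n = (\<Sum>i<n. of_bool (P i))"
proof -
  have "{i. i < n \<and> P i} = {..<n} \<inter> {i. P i}" by auto
  then show ?thesis by (simp add: count_def of_bool_def sum.If_cases)
qed

lemma count_0 [simp]: "count P 0 = 0"
  by (simp add: count_def)

lemma count_Suc: "count P (Suc n) = of_bool (P 0) + count (\<lambda>i. P (Suc i)) n"
  unfolding count_sum by (rule sum.lessThan_Suc_shift)

lemma count_add: "count P (a + b) = count P a + count (\<lambda>i. P (a + i)) b"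
  by (induction b) (auto simp: count_sum)

lemma match_bits_iff: "match_bits n X Y j \<longleftrightarrow> (\<forall>i<n. bit_at i X \<longrightarrow> bit_at i Y) \<and> count (\<lambda>i. bit_at i Y \<and> \<not> bit_at i X) n = length (list_of_tree j)"
proof (induction n arbitrary: X Y j)
  case 0
  show ?case by (cases j) auto
next
  case (Suc n)
  show ?case
    by (cases j) (auto simp: Suc count_Suc bit_at_simps All_less_Suc2)
qed

lemma matches_cong:
  assumes "\<And>i. i < n \<Longrightarrow> bit_at i Y \<longleftrightarrow> bit_at i Z" shows "matches n w Y \<longleftrightarrow> matches n w Z"
proof -
  have "count (\<lambda>i. bit_at i Y \<and> \<not> bit_at i (left w)) n = count (\<lambda>i. bit_at i Z \<and> \<not> bit_at i (left w)) n"
    unfolding count_sum using assms by (intro sum.cong) auto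
  then show ?thesis using assms by (auto simp: matches_def match_bits_iff)
qed

text \<open>Matching inspects the first \<open>n\<close> positions only, so an arbitrary tree may be
  replaced by the vector of its first \<open>n\<close> bits.\<close>

lemma covers_iff: "covers n ws \<longleftrightarrow> (\<forall>Y. \<exists>w\<in>set ws. matches n w Y)"
proof
  assume c: "covers n ws"
  show "\<forall>Y. \<exists>w\<in>set ws. matches n w Y"
  proof
    fix Y
    let ?Z = "tree_of_bits (map (\<lambda>i. bit_at i Y) [0..<n])"
    have "?Z \<in> set (all_bits n)" by (auto simp: set_all_bits)
    then obtain w where "w \<in> set ws" "matches n w ?Z" using c by (auto simp: covers_def)
    moreover have "matches n w ?Z \<longleftrightarrow> matches n w Y" by (rule matches_cong) (simp add: bit_at_tree_of_bits)
    ultimately show "\<exists>w\<in>set ws. matches n w Y" by blast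
  qed
qed (simp add: covers_def)

text \<open>The witness is the suffix that starts at the last element satisfying
  \<open>P\<close>.\<close>

lemma suffs_exists: "\<exists>w\<in>set ws. P w \<Longrightarrow> \<exists>g\<in>set (suffs ws). P (hd g) \<and> \<not> (\<exists>w\<in>set (tl g). P w)"
  by (induction ws) auto

lemma suffs_unique: "g \<in> set (suffs ws) \<Longrightarrow> h \<in> set (suffs ws) \<Longrightarrow> P (hd g) \<Longrightarrow> P (hd h) \<Longrightarrow>
   \<not> (\<exists>w\<in>set (tl g). P w) \<Longrightarrow> \<not> (\<exists>w\<in>set (tl h). P w) \<Longrightarrow> g = h"
  by (induction ws) (auto, (metis set_suffs)+)

lemma canonical_exists:
  assumes "covers n ws" shows "\<exists>gs\<in>set (tuples ws m). canonical n gs Y"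
proof (induction m arbitrary: Y)
  case (Suc m)
  from Suc[of "drop_tree n Y"] obtain gs where gs: "length gs = m" "set gs \<subseteq> set (suffs ws)" "canonical n gs (drop_tree n Y)"
    by (auto simp: set_tuples)
  obtain g where "g \<in> set (suffs ws)" "matches n (hd g) Y \<and> \<not> (\<exists>w\<in>set (tl g). matches n w Y)"
    using suffs_exists[of ws "\<lambda>w. matches n w Y"] assms by (auto simp: covers_iff)
  then show ?case using gs by (intro bexI[of _ "g # gs"]) (auto simp: set_tuples)
qed (simp add: set_tuples)

lemma canonical_unique:
  assumes "gs \<in> set (tuples ws m)" "hs \<in> set (tuples ws m)" "canonical n gs Y" "canonical n hs Y"
  shows "gs = hs"
proof -
  have len: "length gs = length hs" and sub: "set gs \<subseteq> set (suffs ws)" "set hs \<subseteq> set (suffs ws)"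
    using assms(1,2) by (auto simp: set_tuples)
  from len sub assms(3,4) show ?thesis
  proof (induction gs hs arbitrary: Y rule: list_induct2)
    case (Cons g gs h hs)
    then have "g = h" using suffs_unique[of g ws h "\<lambda>w. matches n w Y"] by auto
    moreover have "gs = hs" using Cons by auto
    ultimately show ?case by simp
  qed simp
qed

lemma distinct_concat_map:
  assumes "distinct xs" "\<And>x. x \<in> set xs \<Longrightarrow> distinct (f x)"
    "\<And>x y. x \<in> set xs \<Longrightarrow> y \<in> set xs \<Longrightarrow> x \<noteq> y \<Longrightarrow> set (f x) \<inter> set (f y) = {}"
  shows "distinct (concat (map f xs))"
  using assms
proof (induction xs)
  case (Cons x xs)
  then have "distinct (concat (map f xs))" by simp
  moreover have "set (f x) \<inter> set (f y) = {}" if "y \<in> set xs" for y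
    using Cons.prems(1) that by (intro Cons.prems(3)) auto
  ultimately show ?case using Cons.prems(2)[of x] by auto
qed simp

lemma distinct_suffs: "distinct (suffs ws)"
proof (induction ws)
  case (Cons w ws)
  have "w # ws \<notin> set (suffs ws)" using set_suffs[of "w # ws" ws] by auto
  then show ?case using Cons by simp
qed simp

lemma distinct_tuples: "distinct (tuples ws m)"
proof (induction m)
  case (Suc m)
  have "distinct (concat (map (\<lambda>gs. map (\<lambda>g. g # gs) (suffs ws)) (tuples ws m)))"
    by (rule distinct_concat_map[OF Suc]) (auto simp: distinct_map distinct_suffs inj_on_def)
  then show ?case unfolding tuples_Suc distinct_rev .
qed simp

text \<open>Counting is additive over the blocks. The local conditions therefore add up to what a
  query needs in order to find \<open>Y\<close>: it contains the chosen set and exceeds it by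
  exactly \<open>rest_size gs\<close> elements.\<close>

lemma canonical_chosen:
  assumes "canonical c gs Y"
  shows "(\<forall>i<length gs * c. bit_at i (tree_of_list (chosen c gs)) \<longrightarrow> bit_at i Y) \<and>
     count (\<lambda>i. bit_at i Y \<and> \<not> bit_at i (tree_of_list (chosen c gs))) (length gs * c) = rest_size gs"
  using assms
proof (induction gs arbitrary: Y)
  case (Cons g gs)
  let ?Z = "tree_of_list (chosen c gs)" and ?Z' = "tree_of_list (chosen c (g # gs))"
  have Z1: "bit_at i ?Z' \<longleftrightarrow> bit_at i (left (hd g))" if "i < c" for i
    using that by (simp add: chosen_def bit_at_tree_of_list nth_append)
      (simp add: prefix_list_def bit_at_def)
  have Z2: "bit_at (c + i) ?Z' \<longleftrightarrow> bit_at i ?Z" for i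
    by (simp add: chosen_def bit_at_tree_of_list nth_append)
  have g: "\<forall>i<c. bit_at i (left (hd g)) \<longrightarrow> bit_at i Y" "count (\<lambda>i. bit_at i Y \<and> \<not> bit_at i (left (hd g))) c = length (list_of_tree (right (hd g)))"
    using Cons.prems by (auto simp: matches_def match_bits_iff)
  have IH: "\<forall>i<length gs * c. bit_at i ?Z \<longrightarrow> bit_at (c + i) Y"
     "count (\<lambda>i. bit_at (c + i) Y \<and> \<not> bit_at i ?Z) (length gs * c) = rest_size gs"
    using Cons.IH[of "drop_tree c Y"] Cons.prems by (auto simp: bit_at_drop_tree)
  have "bit_at i Y" if "i < length (g # gs) * c" "bit_at i ?Z'" for i
  proof (cases "i < c")
    case False
    then have i: "i = c + (i - c)" "i - c < length gs * c" using that(1) by auto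
    then have "bit_at (i - c) ?Z" using Z2[of "i - c"] that(2) by simp
    then have "bit_at (c + (i - c)) Y" using IH(1) i(2) by blast
    then show ?thesis using i(1) by simp
  qed (use Z1 g that in auto)
  moreover have "count (\<lambda>i. bit_at i Y \<and> \<not> bit_at i ?Z') (c + length gs * c) =
      count (\<lambda>i. bit_at i Y \<and> \<not> bit_at i (left (hd g))) c + count (\<lambda>i. bit_at (c + i) Y \<and> \<not> bit_at i ?Z) (length gs * c)"
    unfolding count_add Z2 unfolding count_sum using Z1 by (auto intro!: sum.cong)
  ultimately show ?case using g(2) IH(2) by (auto simp: rest_size_def)
qed (simp add: rest_size_def)

text \<open>The counterpart of \<open>extensions\<close> for characteristic vectors; the translation
  is \<open>bits_extensions\<close>.\<close>

definition bit_extensions :: "nat \<Rightarrow> bool list set \<Rightarrow> bool list \<Rightarrow> nat \<Rightarrow> bool list set" where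
  "bit_extensions n F X k = {S. length S = n \<and> (\<forall>i<n. S ! i \<longrightarrow> \<not> X ! i) \<and> count (\<lambda>i. S ! i) n = k \<and>
     map (\<lambda>i. S ! i \<or> X ! i) [0..<n] \<in> F}"

lemma bits_of_bits: "length S = n \<Longrightarrow> length X = n \<Longrightarrow>
   bits_of n (tree_of_bits S) (tree_of_bits X) = map (\<lambda>i. S ! i \<or> X ! i) [0..<n]"
  by (auto simp: bits_of_def bit_at_tree_of_bits)

text \<open>Answers for different tuples are disjoint because canonical tuples are unique; within
  one tuple, adding the chosen set is injective on sets disjoint from it. Conversely, a member
  \<open>Y\<close> is found by the query of its canonical tuple, with the answer \<open>Y\<close>
  minus the chosen set.\<close>

lemma listing_correct:
  assumes F: "\<And>Y. Y \<in> F \<Longrightarrow> length Y = length us"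
    and L: "\<And>X k. length X = length us \<Longrightarrow> distinct (L X k) \<and> set (L X k) = bit_extensions (length us) F X k"
    and c: "covers c ws" "length us \<le> m * c"
  shows "distinct (listing us L c ws m) \<and> set (listing us L c ws m) = F"
proof -
  let ?n = "length us"
  have len [simp]: "length (chosen_bits ?n c gs) = ?n" for gs by (simp add: chosen_bits_def bits_of_def)
  have LL: "distinct (found us L c gs) \<and>
     set (found us L c gs) = bit_extensions ?n F (chosen_bits ?n c gs) (rest_size gs)" for gs
    unfolding found_def by (rule L) simp
  have Ls: "set (found us L c gs) = bit_extensions ?n F (chosen_bits ?n c gs) (rest_size gs)"
    and Ld: "distinct (found us L c gs)" for gs
    using LL[of gs] by auto
  let ?f = "\<lambda>gs S. map (\<lambda>i. S ! i \<or> chosen_bits ?n c gs ! i) [0..<?n]"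
  have ans: "answers ?n c gs (found us L c gs) = filter (\<lambda>Y. canonical c gs (tree_of_bits Y)) (map (?f gs) (found us L c gs))" for gs
    unfolding answers_def
    by (intro arg_cong[of _ _ "filter _"] map_cong refl) (auto simp: Ls bit_extensions_def intro!: bits_of_bits)
  have dist: "distinct (concat (map (\<lambda>gs. answers ?n c gs (found us L c gs)) (tuples ws m)))"
  proof (rule distinct_concat_map[OF distinct_tuples])
    fix gs
    have "inj_on (?f gs) (set (found us L c gs))"
    proof (rule inj_onI)
      fix S S' assume S: "S \<in> set (found us L c gs)" "S' \<in> set (found us L c gs)" "?f gs S = ?f gs S'"
      have l: "length S = ?n" "length S' = ?n" and disj: "\<forall>i<?n. S ! i \<longrightarrow> \<not> chosen_bits ?n c gs ! i"
         "\<forall>i<?n. S' ! i \<longrightarrow> \<not> chosen_bits ?n c gs ! i"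
        using S(1,2) by (auto simp: Ls bit_extensions_def)
      have "S ! i = S' ! i" if "i < ?n" for i
      proof -
        have "?f gs S ! i = ?f gs S' ! i" by (simp only: S(3))
        then show ?thesis using that disj by auto
      qed
      then show "S = S'" using l by (auto intro: nth_equalityI)
    qed
    then show "distinct (answers ?n c gs (found us L c gs))"
      unfolding ans using Ld by (auto simp: distinct_map)
  next
    fix gs hs assume "gs \<in> set (tuples ws m)" "hs \<in> set (tuples ws m)" "gs \<noteq> hs"
    then show "set (answers ?n c gs (found us L c gs)) \<inter> set (answers ?n c hs (found us L c hs)) = {}"
      using canonical_unique by (fastforce simp: ans)
  qed
  have "\<exists>gs\<in>set (tuples ws m). Y \<in> set (answers ?n c gs (found us L c gs))" if Y: "Y \<in> F" for Y
  proof -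
    obtain gs where gs: "gs \<in> set (tuples ws m)" "canonical c gs (tree_of_bits Y)"
      using canonical_exists[OF c(1)] by blast
    have lY: "length Y = ?n" using F Y by simp
    let ?X = "chosen_bits ?n c gs" and ?Z = "tree_of_list (chosen c gs)"
    have X: "?X ! i \<longleftrightarrow> bit_at i ?Z" if "i < ?n" for i
      using that by (simp add: chosen_bits_def bits_of_def bit_at_def)
    have lgs: "length gs = m" using gs(1) by (simp add: set_tuples)
    have can: "\<forall>i<m * c. bit_at i ?Z \<longrightarrow> bit_at i (tree_of_bits Y)"
      "count (\<lambda>i. bit_at i (tree_of_bits Y) \<and> \<not> bit_at i ?Z) (m * c) = rest_size gs"
      using canonical_chosen[OF gs(2)] lgs by auto
    let ?S = "map (\<lambda>i. Y ! i \<and> \<not> ?X ! i) [0..<?n]"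
    \<comment> \<open>The padded positions from \<open>?n\<close> up to \<open>m * c\<close> are
      zero in \<open>Y\<close>, so the count over whole blocks equals the count over the
      universe.\<close>
    have "{i. i < m * c \<and> bit_at i (tree_of_bits Y) \<and> \<not> bit_at i ?Z} = {i. i < ?n \<and> Y ! i \<and> \<not> ?X ! i}"
      using c(2) lY X by (auto simp: bit_at_tree_of_bits)
    then have "card {i. i < ?n \<and> Y ! i \<and> \<not> ?X ! i} = rest_size gs" using can(2) by (simp add: count_def)
    moreover have "{i. i < ?n \<and> ?S ! i} = {i. i < ?n \<and> Y ! i \<and> \<not> ?X ! i}" by auto
    ultimately have cnt: "count (\<lambda>i. ?S ! i) ?n = rest_size gs" by (simp add: count_def)
    have un: "?f gs ?S = Y"
    proof (rule nth_equalityI)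
      fix i assume "i < length (?f gs ?S)"
      then have i: "i < ?n" by simp
      have "?X ! i \<longrightarrow> Y ! i"
        using can(1) i c(2) X[OF i] lY by (auto simp: bit_at_tree_of_bits)
      then show "?f gs ?S ! i = Y ! i" using i by auto
    qed (use lY in simp)
    have S: "?S \<in> set (found us L c gs)"
      unfolding Ls bit_extensions_def using cnt un Y by auto
    have "Y \<in> ?f gs ` set (found us L c gs)" by (rule image_eqI[where f = "?f gs", OF un[symmetric] S])
    then have "Y \<in> set (answers ?n c gs (found us L c gs))" using gs(2) unfolding ans by auto
    then show ?thesis using gs(1) by blast
  qed
  moreover have "Y \<in> F" if "Y \<in> set (answers ?n c gs (found us L c gs))" for Y gs
    using that Ls[of gs] unfolding ans by (auto simp: bit_extensions_def)
  ultimately have "set (concat (map (\<lambda>gs. answers ?n c gs (found us L c gs)) (tuples ws m))) = F" by fastforce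
  then show ?thesis using dist unfolding listing_def distinct_rev set_rev by blast
qed

text \<open>The hypothesis on \<open>l\<close> is what \<open>length_computes_in\<close> yields for
  a query. One factor \<open>N + 1\<close> comes from the number of answers, the other from the
  treatment of a single answer; all else depends on the candidate and on \<open>p\<close>.\<close>

lemma query_cost_le:
  assumes "m \<le> N" "n \<le> N" "l \<le> N + n + m * Q + 4 + t"
  shows "query_cost b n m c M Q l t + 8 \<le>
     (28 * c + 12 * Q + 2 * b + 300 + (Q + 6) * (M * (30 * c + 50) + 30 * c + 300)) * (N + 1)\<^sup>2 * (t + 1)"
proof -
  let ?N = "N + 1" and ?t = "t + 1" and ?D = "M * (30 * c + 50) + 30 * c + 100"
  have l: "l \<le> (Q + 6) * (?N * ?t)"
  proof -
    have "m * Q \<le> N * Q" using assms(1) by (rule mult_le_mono1)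
    moreover have "(Q + 5) * ?N = N * Q + Q + 5 * N + 5" by (simp add: algebra_simps)
    ultimately have "l \<le> (Q + 5) * ?N + t" using assms by linarith
    also have "\<dots> \<le> (Q + 6) * (?N * ?t)" by (simp add: algebra_simps)
    finally show ?thesis .
  qed
  have D: "50 * n + m * ?D + 100 \<le> (M * (30 * c + 50) + 30 * c + 300) * ?N"
  proof -
    have "m * ?D \<le> ?N * ?D" using assms by (intro mult_le_mono1) simp
    moreover have "50 * n + 100 \<le> 200 * ?N" using assms by simp
    moreover have "(M * (30 * c + 50) + 30 * c + 300) * ?N = ?N * ?D + 200 * ?N" by (simp add: algebra_simps)
    ultimately show ?thesis by linarith
  qed
  have big: "?N \<le> ?N\<^sup>2 * ?t" "t \<le> ?N\<^sup>2 * ?t" "1 \<le> ?N\<^sup>2 * ?t"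
    by (auto simp: power2_eq_square algebra_simps)
  have 1: "l * (50 * n + m * ?D + 100) \<le> ((Q + 6) * (M * (30 * c + 50) + 30 * c + 300)) * (?N\<^sup>2 * ?t)"
    using mult_le_mono[OF l D] by (simp add: power2_eq_square algebra_simps)
  have 2: "m * (28 * c + 12 * Q + 50) \<le> (28 * c + 12 * Q + 50) * (?N\<^sup>2 * ?t)"
    using mult_le_mono[of m "?N\<^sup>2 * ?t" "28 * c + 12 * Q + 50" "28 * c + 12 * Q + 50"] big(1) assms(1)
    by (simp only: mult.commute)
  have 3: "50 * n + t + 2 * b + 150 + 8 \<le> (2 * b + 230) * (?N\<^sup>2 * ?t)"
  proof -
    have "50 * n \<le> 50 * (?N\<^sup>2 * ?t)" using big(1) assms(2) by linarith
    moreover have "2 * b + 158 \<le> (2 * b + 158) * (?N\<^sup>2 * ?t)" using mult_le_mono2[OF big(3), of "2 * b + 158"] by simp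
    moreover have "(2 * b + 230) * (?N\<^sup>2 * ?t) = 72 * (?N\<^sup>2 * ?t) + (2 * b + 158) * (?N\<^sup>2 * ?t)"
      by (simp only: distrib_right[symmetric]) simp
    ultimately show ?thesis using big(2) by linarith
  qed
  have "query_cost b n m c M Q l t + 8 =
     m * (28 * c + 12 * Q + 50) + (50 * n + t + 2 * b + 150 + 8) + l * (50 * n + m * ?D + 100)"
    by (simp add: query_cost_def)
  also have "\<dots> \<le> (28 * c + 12 * Q + 50) * (?N\<^sup>2 * ?t) + (2 * b + 230) * (?N\<^sup>2 * ?t) +
      ((Q + 6) * (M * (30 * c + 50) + 30 * c + 300)) * (?N\<^sup>2 * ?t)"
    by (intro add_mono 1 2 3)
  also have "\<dots> = (28 * c + 12 * Q + 50 + (2 * b + 230) + (Q + 6) * (M * (30 * c + 50) + 30 * c + 300)) * (?N\<^sup>2 * ?t)"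
    by (simp only: distrib_right)
  also have "\<dots> \<le> (28 * c + 12 * Q + 2 * b + 300 + (Q + 6) * (M * (30 * c + 50) + 30 * c + 300)) * (?N\<^sup>2 * ?t)"
    by (intro mult_le_mono1) simp
  finally show ?thesis by (simp only: mult.assoc)
qed

text \<open>\<open>K\<close> is fixed before the instance. It depends on the candidate
  \<open>a\<close>, which is harmless because for every \<epsilon> a single candidate is followed
  through the analysis.\<close>

lemma solve_correct:
  "\<exists>K. \<forall>bs (us :: tree list) F L t. length us \<le> length bs \<longrightarrow> F \<subseteq> {Y. length Y = length us} \<longrightarrow>
     (\<forall>X k. length X = length us \<longrightarrow>
        computes_in p (Node (tree_of_bits bs) (Node (tree_of_bits X) (tree_of_nat k)))
           (tree_of_list (map tree_of_bits (L X k))) (t X k) \<and>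
        distinct (L X k) \<and> set (L X k) = bit_extensions (length us) F X k) \<longrightarrow>
     (\<exists>f y T m. computes_in (solve p) (Node (Node (tree_of_bits bs) (tree_of_list us)) a) (Node f y) T \<and>
        (f \<noteq> Leaf \<longrightarrow> (\<exists>out. y = tree_of_list (map tree_of_bits out) \<and> distinct out \<and> set out = F)) \<and>
        (covers (length (blocks a)) (patterns a) \<longrightarrow> f \<noteq> Leaf) \<and>
        length us \<le> m * length (blocks a) \<and> m * length (blocks a) < length us + length (blocks a) \<and>
        T \<le> K * (length bs + 1)\<^sup>2 * (\<Sum>gs\<leftarrow>tuples (patterns a) m.
               t (chosen_bits (length us) (length (blocks a)) gs) (rest_size gs) + 1))"
proof -
  define c where "c = length (blocks a)"
  define ws where "ws = patterns a"
  define M where "M = length ws"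
  define Q where "Q = (\<Sum>w\<leftarrow>ws. length (list_of_tree (right w)))"
  have Q: "\<forall>w\<in>set (patterns a). length (list_of_tree (right w)) \<le> Q"
    unfolding Q_def ws_def by (auto intro!: member_le_sum_list)
  define K1 where "K1 = 28 * c + 12 * Q + 2 * var_bound p + 300 + (Q + 6) * (M * (30 * c + 50) + 30 * c + 300)"
  define K where "K = cover_cost c M + 11 * c + 12 + 16 * M + 12 + 20 + 100 + K1"
  show ?thesis
  proof (rule exI[of _ K], intro allI impI)
    fix bs and us :: "tree list" and F L t
    assume nN: "length us \<le> length bs" and F: "F \<subseteq> {Y. length Y = length us}"
      and p: "\<forall>X k. length X = length us \<longrightarrow>
        computes_in p (Node (tree_of_bits bs) (Node (tree_of_bits X) (tree_of_nat k)))
           (tree_of_list (map tree_of_bits (L X k))) (t X k) \<and>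
        distinct (L X k) \<and> set (L X k) = bit_extensions (length us) F X k"
    let ?n = "length us" and ?N = "length bs"
    let ?t = "time us t c"
    from runs_solve[of us p "tree_of_bits bs" L t a Q, OF _ Q] p obtain m T where
      m: "?n \<le> m * c" "m * c < ?n + c" and
      comp: "computes_in (solve p) (Node (Node (tree_of_bits bs) (tree_of_list us)) a)
        (Node (tree_of_bool (covers c ws)) (tree_of_list (map tree_of_bits (listing us L c ws m)))) T" and
      T: "T \<le> cover_cost c M + (?n + 1) * (11 * c + 12) + m * (M ^ m * (16 * M + 12) + 20) + 100 +
        (\<Sum>gs\<leftarrow>tuples ws m. query_cost (var_bound p) ?n m c M Q (length (found us L c gs)) (?t gs) + 8)"
      unfolding c_def ws_def M_def by blast
    have c0: "c > 0" by (simp add: c_def blocks_def)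
    have M0: "M > 0" by (simp add: M_def ws_def patterns_def)
    have mn: "m \<le> ?n"
    proof (rule ccontr)
      assume "\<not> m \<le> ?n"
      then have "Suc ?n * c \<le> m * c" by (intro mult_le_mono1) simp
      moreover have "?n \<le> ?n * c" using c0 by simp
      ultimately show False using m(2) by simp
    qed
    let ?S = "\<Sum>gs\<leftarrow>tuples ws m. ?t gs + 1"
    let ?E = "(?N + 1)\<^sup>2 * ?S"
    \<comment> \<open>The \<open>+ 1\<close> under the sum counts the tuples; it pays for generating
      them even if the queries are cheap.\<close>
    have Mm: "M ^ m \<le> ?S"
    proof -
      have "(\<Sum>gs\<leftarrow>tuples ws m. 1) \<le> ?S" by (intro sum_list_mono) simp
      then show ?thesis by (simp add: sum_list_triv length_tuples M_def)
    qed
    then have S1: "1 \<le> ?S" using M0 by (metis One_nat_def Suc_leI le_trans zero_less_power)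
    have N1: "?N + 1 \<le> (?N + 1)\<^sup>2" "1 \<le> (?N + 1)\<^sup>2" by (auto simp: power2_eq_square)
    have E: "1 \<le> ?E" "?N + 1 \<le> ?E" "(?N + 1) * M ^ m \<le> ?E"
      using mult_le_mono[OF N1(2) S1] mult_le_mono[OF N1(1) S1] mult_le_mono[OF N1(1) Mm] by simp_all
    have qs: "query_cost (var_bound p) ?n m c M Q (length (found us L c gs)) (?t gs) + 8 \<le> K1 * (?N + 1)\<^sup>2 * (?t gs + 1)"
      if "gs \<in> set (tuples ws m)" for gs
      unfolding K1_def
    proof (rule query_cost_le)
      let ?X = "chosen_bits ?n c gs"
      have gs: "length gs = m" "set gs \<subseteq> set (suffs ws)" using that by (auto simp: set_tuples)
      have "rest_size gs \<le> m * Q"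
        unfolding rest_size_def
        by (rule sum_list_le) (use gs Q set_suffs[of _ ws] ws_def in auto)
      moreover have lX: "length ?X = ?n" by (simp add: chosen_bits_def bits_of_def)
      then have "length (map tree_of_bits (found us L c gs)) \<le>
         height (Node (tree_of_bits bs) (Node (tree_of_bits ?X) (tree_of_nat (rest_size gs)))) + ?t gs"
        using p unfolding found_def time_def by (intro length_computes_in[of p]) auto
      ultimately show "length (found us L c gs) \<le> ?N + ?n + m * Q + 4 + ?t gs"
        using height_tree_of_bits[of bs] height_tree_of_bits[of ?X] lX by (simp add: height_tree_of_nat)
    qed (use mn nN in auto)
    have "(\<Sum>gs\<leftarrow>tuples ws m. query_cost (var_bound p) ?n m c M Q (length (found us L c gs)) (?t gs) + 8)
       \<le> (\<Sum>gs\<leftarrow>tuples ws m. K1 * (?N + 1)\<^sup>2 * (?t gs + 1))"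
      by (rule sum_list_mono) (rule qs)
    also have "\<dots> = K1 * ?E" by (simp only: sum_list_const_mult mult.assoc)
    finally have q: "(\<Sum>gs\<leftarrow>tuples ws m. query_cost (var_bound p) ?n m c M Q (length (found us L c gs)) (?t gs) + 8) \<le> K1 * ?E" .
    have 1: "cover_cost c M + 100 \<le> (cover_cost c M + 100) * ?E" using mult_le_mono2[OF E(1)] by (metis mult_1_right)
    have 2: "(?n + 1) * (11 * c + 12) \<le> (11 * c + 12) * ?E"
      using mult_le_mono[of "?n + 1" ?E "11 * c + 12", OF _ order.refl] E(2) nN by (simp only: mult.commute)
    have 3: "m * (M ^ m * (16 * M + 12) + 20) \<le> (16 * M + 12 + 20) * ?E"
    proof -
      have "m * M ^ m \<le> (?N + 1) * M ^ m" using mn nN by (intro mult_le_mono1) simp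
      then have "m * M ^ m \<le> ?E" using E(3) by linarith
      then have "(16 * M + 12) * (m * M ^ m) \<le> (16 * M + 12) * ?E" by (rule mult_le_mono2)
      moreover have "20 * m \<le> 20 * ?E" using E(2) mn nN by linarith
      moreover have "m * (M ^ m * (16 * M + 12) + 20) = (16 * M + 12) * (m * M ^ m) + 20 * m"
        by (simp add: algebra_simps)
      ultimately show ?thesis unfolding distrib_right[of "16 * M + 12"] by linarith
    qed
    have "T \<le> (cover_cost c M + 100) * ?E + (11 * c + 12) * ?E + (16 * M + 12 + 20) * ?E + K1 * ?E"
      using T q 1 2 3 by linarith
    also have "\<dots> = K * ?E" by (simp only: distrib_right[symmetric] K_def) (simp add: algebra_simps)
    finally have "T \<le> K * (?N + 1)\<^sup>2 * ?S" by (simp only: mult.assoc)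
    moreover have "distinct (listing us L c ws m) \<and> set (listing us L c ws m) = F" if "covers c ws"
      by (rule listing_correct) (use F p m that in auto)
    ultimately show "\<exists>f y T m. computes_in (solve p) (Node (Node (tree_of_bits bs) (tree_of_list us)) a) (Node f y) T \<and>
        (f \<noteq> Leaf \<longrightarrow> (\<exists>out. y = tree_of_list (map tree_of_bits out) \<and> distinct out \<and> set out = F)) \<and>
        (covers (length (blocks a)) (patterns a) \<longrightarrow> f \<noteq> Leaf) \<and>
        length us \<le> m * length (blocks a) \<and> m * length (blocks a) < length us + length (blocks a) \<and>
        T \<le> K * (length bs + 1)\<^sup>2 * (\<Sum>gs\<leftarrow>tuples (patterns a) m.
               t (chosen_bits (length us) (length (blocks a)) gs) (rest_size gs) + 1)"
      using comp m unfolding c_def[symmetric] ws_def[symmetric] time_def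
      by (intro exI[of _ "tree_of_bool (covers c ws)"] exI[of _ "tree_of_list (map tree_of_bits (listing us L c ws m))"] exI[of _ T] exI[of _ m])
         auto
  qed
qed

section \<open>Covering families\<close>

text \<open>The \<open>n + 1\<close> binomial probabilities add up to 1, so one of them is at least
  the average.\<close>

lemma binomial_pmf_large:
  fixes p :: real assumes "0 \<le> p" "p \<le> 1"
  shows "\<exists>i\<le>n. 1 / (real n + 1) \<le> real (n choose i) * p ^ i * (1 - p) ^ (n - i)"
proof (rule ccontr)
  assume "\<not> ?thesis"
  then have "(\<Sum>i\<le>n. real (n choose i) * p ^ i * (1 - p) ^ (n - i)) < (\<Sum>i\<le>n. 1 / (real n + 1))"
    by (intro sum_strict_mono) (simp_all, meson not_less)
  moreover have "(\<Sum>i\<le>n. real (n choose i) * p ^ i * (1 - p) ^ (n - i)) = (p + (1 - p)) ^ n"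
    by (rule binomial_ring[symmetric])
  ultimately show False by simp
qed

text \<open>By Pascal's rule the binomial weight on the left is a convex combination of two weights of
  the previous row, which yields the induction step.\<close>

lemma binomial_pmf_le_column:
  fixes p :: real assumes p: "0 \<le> p" "p \<le> 1" and "i \<le> k"
  shows "\<exists>j\<le>k. real ((q + k) choose i) * p ^ i * (1 - p) ^ (q + k - i) \<le> real ((q + j) choose j) * p ^ j * (1 - p) ^ q"
  using \<open>i \<le> k\<close>
proof (induction k arbitrary: i)
  case (Suc k)
  let ?f = "\<lambda>j. real ((q + j) choose j) * p ^ j * (1 - p) ^ q"
  let ?w = "\<lambda>n i. real (n choose i) * p ^ i * (1 - p) ^ (n - i)"
  consider "i = Suc k" | "i \<le> k" "i = 0" | i' where "i \<le> k" "i = Suc i'"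
    using Suc.prems by (cases i) (auto simp: le_Suc_eq)
  then show ?case
  proof cases
    case 1
    then show ?thesis by (intro exI[of _ "Suc k"]) auto
  next
    case 2
    obtain j where j: "j \<le> k" "?w (q + k) 0 \<le> ?f j" using Suc.IH[of 0] by auto
    have "?w (q + Suc k) 0 = (1 - p) * ?w (q + k) 0" by simp
    also have "\<dots> \<le> ?w (q + k) 0" using p by (intro mult_left_le_one_le) auto
    also note j(2)
    finally show ?thesis using j(1) 2 by (intro exI[of _ j]) auto
  next
    case 3
    obtain j1 where j1: "j1 \<le> k" "?w (q + k) i \<le> ?f j1" using Suc.IH[of i] 3 by auto
    obtain j2 where j2: "j2 \<le> k" "?w (q + k) i' \<le> ?f j2" using Suc.IH[of i'] 3 by auto
    obtain j where j: "j \<le> k" "?f j1 \<le> ?f j" "?f j2 \<le> ?f j"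
      using j1(1) j2(1) by (meson linear)
    have e: "q + Suc k - i = Suc (q + k - i)" "q + k - i' = Suc (q + k - i)" using 3 by auto
    have "?w (q + Suc k) i = p * ?w (q + k) i' + (1 - p) * ?w (q + k) i"
      unfolding e using 3 by (simp add: algebra_simps)
    also have "\<dots> \<le> p * ?f j + (1 - p) * ?f j"
      using j1 j2 j p by (intro add_mono mult_left_mono) auto
    also have "\<dots> = ?f j" by (simp add: algebra_simps)
    finally show ?thesis using j(1) by (intro exI[of _ j]) auto
  qed
qed auto

text \<open>If \<open>i\<close> is a position where the binomial weight for \<open>p = 1 / (b * c)\<close> is at least \<open>1 / (s + 1)\<close>, then
  for \<open>k \<ge> i\<close> some \<open>j\<close> inherits this bound from the column lemma, and for \<open>k < i\<close> the choice \<open>j = k\<close>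
  is no more expensive than \<open>j = i\<close> in the case \<open>k = i\<close>.\<close>

lemma exchange:
  fixes b c :: real assumes b: "b \<ge> 1" and c: "c \<ge> 1" and k: "k \<le> s"
  shows "\<exists>j\<le>k. real (s choose k) * (b ^ (s - k + j) * c ^ j) \<le>
     (real s + 1) * (1 + b - 1 / c) ^ s * real ((s - k + j) choose j)"
proof -
  define p where "p = 1 / (b * c)"
  have "1 * 1 \<le> b * c" using b c by (intro mult_mono) auto
  then have p: "0 \<le> p" "p \<le> 1" and bc: "b * c * p = 1" "b * c > 0" by (auto simp: p_def divide_simps)
  have bp: "b * (1 - p) = b - 1 / c" using b c by (simp add: p_def field_simps)
  have "1 / c \<le> 1" using c by simp
  then have r: "0 \<le> b - 1 / c" using b by linarith
  have binom_term: "real (s choose i) * (b - 1 / c) ^ (s - i) \<le> (1 + b - 1 / c) ^ s" if "i \<le> s" for i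
  proof -
    have "real (s choose i) * 1 ^ i * (b - 1 / c) ^ (s - i) \<le> (\<Sum>i\<le>s. real (s choose i) * 1 ^ i * (b - 1 / c) ^ (s - i))"
      by (rule member_le_sum) (use r that in auto)
    also have "\<dots> = (1 + (b - 1 / c)) ^ s" by (rule binomial_ring[symmetric])
    finally show ?thesis by (simp add: add_diff_eq)
  qed
  \<comment> \<open>Multiplying by \<open>(b * c) ^ j * b ^ q\<close> cancels the powers of
    \<open>p\<close>, because \<open>b * c * p = 1\<close>, and turns \<open>(1 - p) ^ q\<close>
    into \<open>(b - 1 / c) ^ q\<close>; this is the reason for the choice of
    \<open>p\<close>.\<close>
  have scale: "b ^ (q + j) * c ^ j \<le> (real s + 1) * (real N * (b - 1 / c) ^ q)"
    if "1 / (real s + 1) \<le> real N * p ^ j * (1 - p) ^ q" for N q j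
  proof -
    have "1 \<le> (real s + 1) * (real N * p ^ j * (1 - p) ^ q)" using that by (simp add: divide_simps mult.commute)
    then have "(b * c) ^ j * b ^ q * 1 \<le> (b * c) ^ j * b ^ q * ((real s + 1) * (real N * p ^ j * (1 - p) ^ q))"
      using b c by (intro mult_left_mono) auto
    also have "\<dots> = (real s + 1) * (real N * ((b * c * p) ^ j * (b * (1 - p)) ^ q))"
      by (simp add: power_mult_distrib mult_ac)
    also have "\<dots> = (real s + 1) * (real N * (b - 1 / c) ^ q)"
      by (simp only: bc bp power_one mult_1_left)
    finally show ?thesis by (simp add: power_add power_mult_distrib mult_ac)
  qed
  obtain i where i: "i \<le> s" "1 / (real s + 1) \<le> real (s choose i) * p ^ i * (1 - p) ^ (s - i)"
    using binomial_pmf_large[OF p] by blast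
  show ?thesis
  proof (cases "i \<le> k")
    case True
    from binomial_pmf_le_column[OF p True, of "s - k"] k obtain j where j: "j \<le> k"
      "real (s choose i) * p ^ i * (1 - p) ^ (s - i) \<le> real ((s - k + j) choose j) * p ^ j * (1 - p) ^ (s - k)"
      by auto
    have "real (s choose k) * (b ^ (s - k + j) * c ^ j) \<le>
       real (s choose k) * ((real s + 1) * (real ((s - k + j) choose j) * (b - 1 / c) ^ (s - k)))"
      using i(2) j(2) by (intro mult_left_mono scale) auto
    also have "\<dots> = (real s + 1) * (real (s choose k) * (b - 1 / c) ^ (s - k)) * real ((s - k + j) choose j)"
      by (simp add: mult_ac)
    also have "\<dots> \<le> (real s + 1) * (1 + b - 1 / c) ^ s * real ((s - k + j) choose j)"
      using binom_term[OF k] by (intro mult_right_mono mult_left_mono) auto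
    finally show ?thesis using j(1) by blast
  next
    case False
    \<comment> \<open>With \<open>j = k\<close> the empty set covers everything: the whole block is
      left free, the exponent of \<open>b\<close> is \<open>s\<close>, and both binomial
      coefficients in the claim equal \<open>s choose k\<close>.\<close>
    have "b ^ s * c ^ k \<le> b ^ (s - i + i) * c ^ i"
      using False b c i(1) by (intro mult_mono power_increasing) auto
    also have "\<dots> \<le> (real s + 1) * (real (s choose i) * (b - 1 / c) ^ (s - i))"
      by (rule scale) (rule i(2))
    also have "\<dots> \<le> (real s + 1) * (1 + b - 1 / c) ^ s"
      using binom_term[OF i(1)] by (intro mult_left_mono) auto
    finally have "real (s choose k) * (b ^ s * c ^ k) \<le> real (s choose k) * ((real s + 1) * (1 + b - 1 / c) ^ s)"
      by (intro mult_left_mono) auto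
    then show ?thesis using k by (intro exI[of _ k]) (auto simp: mult_ac)
  qed
qed

section \<open>Small covering families by the greedy method\<close>

definition k_subsets :: "'a set \<Rightarrow> nat \<Rightarrow> 'a set set" where
  "k_subsets S k = {T. T \<subseteq> S \<and> card T = k}"

lemma finite_k_subsets: "finite S \<Longrightarrow> finite (k_subsets S k)"
  by (rule finite_subset[of _ "Pow S"]) (auto simp: k_subsets_def)

lemma card_k_subsets: "finite S \<Longrightarrow> card (k_subsets S k) = card S choose k"
  by (simp add: k_subsets_def n_subsets)

text \<open>Double counting of the pairs \<open>X \<subseteq> T\<close>: every \<open>T\<close> in
  \<open>U\<close> contains \<open>k choose t\<close> sets of size \<open>t\<close>, so on average
  over all such sets, and hence for some \<open>X\<close>, the stated fraction of \<open>U\<close>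
  is covered.\<close>

lemma greedy_step:
  assumes S: "finite S" and t: "t \<le> k" "k \<le> card S" and U: "U \<subseteq> k_subsets S k"
  shows "\<exists>X\<in>k_subsets S t. real (card {T\<in>U. \<not> X \<subseteq> T}) \<le>
     real (card U) * (1 - real (k choose t) / real (card S choose t))"
proof (rule ccontr)
  assume neg: "\<not> ?thesis"
  let ?\<rho> = "real (k choose t) / real (card S choose t)"
  have fU: "finite U" using U finite_k_subsets[OF S] finite_subset by blast
  have ft: "finite (k_subsets S t)" by (rule finite_k_subsets[OF S])
  have pos: "card S choose t > 0" using t by simp
  have ne: "k_subsets S t \<noteq> {}"
  proof
    assume "k_subsets S t = {}"
    then show False using card_k_subsets[OF S, of t] pos by simp
  qed
  have "real (card {T\<in>U. X \<subseteq> T}) < real (card U) * ?\<rho>" if "X \<in> k_subsets S t" for X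
  proof -
    have "U = {T\<in>U. X \<subseteq> T} \<union> {T\<in>U. \<not> X \<subseteq> T}" by auto
    then have "card U = card {T\<in>U. X \<subseteq> T} + card {T\<in>U. \<not> X \<subseteq> T}"
      using fU by (subst card_Un_disjoint[symmetric]) auto
    moreover have "real (card {T\<in>U. \<not> X \<subseteq> T}) > real (card U) * (1 - ?\<rho>)" using neg that by (auto simp: not_le)
    ultimately show ?thesis by (simp add: algebra_simps)
  qed
  then have "(\<Sum>X\<in>k_subsets S t. real (card {T\<in>U. X \<subseteq> T})) < (\<Sum>X\<in>k_subsets S t. real (card U) * ?\<rho>)"
    by (intro sum_strict_mono ft ne)
  also have "\<dots> = real (card U) * real (k choose t)"
    using pos by (simp add: card_k_subsets[OF S])
  also have "\<dots> = (\<Sum>T\<in>U. real (card {X\<in>k_subsets S t. X \<subseteq> T}))"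
  proof -
    have "card {X\<in>k_subsets S t. X \<subseteq> T} = k choose t" if "T \<in> U" for T
    proof -
      have "T \<subseteq> S" "card T = k" using that U by (auto simp: k_subsets_def)
      moreover have "{X\<in>k_subsets S t. X \<subseteq> T} = k_subsets T t" using \<open>T \<subseteq> S\<close> by (auto simp: k_subsets_def)
      ultimately show ?thesis using card_k_subsets[of T t] S finite_subset by metis
    qed
    then show ?thesis by simp
  qed
  also have "\<dots> = (\<Sum>X\<in>k_subsets S t. real (card {T\<in>U. X \<subseteq> T}))"
  proof -
    have "(\<Sum>T\<in>U. real (card {X\<in>k_subsets S t. X \<subseteq> T})) = (\<Sum>T\<in>U. \<Sum>X\<in>k_subsets S t. of_bool (X \<subseteq> T))"
      using ft by (intro sum.cong refl) (simp add: Int_def)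
    also have "\<dots> = (\<Sum>X\<in>k_subsets S t. \<Sum>T\<in>U. of_bool (X \<subseteq> T))" by (rule sum.swap)
    also have "\<dots> = (\<Sum>X\<in>k_subsets S t. real (card {T\<in>U. X \<subseteq> T}))"
      using fU by (intro sum.cong refl) (simp add: Int_def)
    finally show ?thesis .
  qed
  finally show False by simp
qed

lemma greedy:
  assumes S: "finite S" and t: "t \<le> k" "k \<le> card S"
  shows "\<exists>\<X>. finite \<X> \<and> \<X> \<subseteq> k_subsets S t \<and> card \<X> \<le> i \<and> real (card {T\<in>k_subsets S k. \<forall>X\<in>\<X>. \<not> X \<subseteq> T}) \<le>
     real (card S choose k) * (1 - real (k choose t) / real (card S choose t)) ^ i"
proof (induction i)
  case 0
  show ?case by (rule exI[of _ "{}"]) (simp add: card_k_subsets[OF S])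
next
  case (Suc i)
  let ?\<rho> = "real (k choose t) / real (card S choose t)"
  obtain \<X> where X: "finite \<X>" "\<X> \<subseteq> k_subsets S t" "card \<X> \<le> i"
    "real (card {T\<in>k_subsets S k. \<forall>X\<in>\<X>. \<not> X \<subseteq> T}) \<le> real (card S choose k) * (1 - ?\<rho>) ^ i"
    using Suc by blast
  let ?U = "{T\<in>k_subsets S k. \<forall>X\<in>\<X>. \<not> X \<subseteq> T}"
  obtain X where Y: "X \<in> k_subsets S t" "real (card {T\<in>?U. \<not> X \<subseteq> T}) \<le> real (card ?U) * (1 - ?\<rho>)"
    using greedy_step[OF S t, of ?U] by auto
  have "?\<rho> \<le> 1"
    using t binomial_right_mono[of k "card S" t] by (simp add: divide_simps)
  then have "real (card ?U) * (1 - ?\<rho>) \<le> real (card S choose k) * (1 - ?\<rho>) ^ i * (1 - ?\<rho>)"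
    using X(4) by (intro mult_right_mono) auto
  then have "real (card {T\<in>?U. \<not> X \<subseteq> T}) \<le> real (card S choose k) * (1 - ?\<rho>) ^ Suc i"
    using Y(2) by (simp add: mult_ac)
  moreover have "{T\<in>?U. \<not> X \<subseteq> T} = {T\<in>k_subsets S k. \<forall>Z\<in>insert X \<X>. \<not> Z \<subseteq> T}" by auto
  moreover have "card (insert X \<X>) \<le> Suc i" using X(1,3) by (simp add: card_insert_if)
  ultimately show ?case using X Y by (intro exI[of _ "insert X \<X>"]) auto
qed

text \<open>Each greedy choice leaves at most the fraction \<open>1 - \<rho>\<close> uncovered. With
  \<open>s = card S\<close>, after about \<open>s / \<rho>\<close> choices at most
  \<open>2 ^ s * exp (- s)\<close> sets remain, which is below 1, hence none. The identity
  \<open>choose_mult\<close> rewrites \<open>1 / \<rho>\<close> as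
  \<open>(s choose k) / ((s - t) choose (k - t))\<close>.\<close>

lemma cover_exists:
  assumes S: "finite S" "card S \<ge> 1" and t: "t \<le> k" "k \<le> card S"
  shows "\<exists>\<X>. finite \<X> \<and> \<X> \<subseteq> k_subsets S t \<and> (\<forall>T\<in>k_subsets S k. \<exists>X\<in>\<X>. X \<subseteq> T) \<and>
     real (card \<X>) * real ((card S - t) choose (k - t)) \<le> (real (card S) + 1) * real (card S choose k)"
proof -
  let ?s = "card S"
  define \<rho> where "\<rho> = real (k choose t) / real (?s choose t)"
  have pos: "?s choose t > 0" "k choose t > 0" "?s choose k > 0" "(?s - t) choose (k - t) > 0" using t by auto
  have le: "k choose t \<le> ?s choose t" using t by (intro binomial_right_mono)
  have \<rho>: "0 < \<rho>" "\<rho> \<le> 1" using pos le by (auto simp: \<rho>_def)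
  define i where "i = nat \<lceil>real ?s / \<rho>\<rceil>"
  have i: "real ?s / \<rho> \<le> real i" "real i \<le> real ?s / \<rho> + 1"
    using \<rho> by (auto simp: i_def)
  obtain \<X> where X: "finite \<X>" "\<X> \<subseteq> k_subsets S t" "card \<X> \<le> i"
    "real (card {T\<in>k_subsets S k. \<forall>X\<in>\<X>. \<not> X \<subseteq> T}) \<le> real (?s choose k) * (1 - \<rho>) ^ i"
    using greedy[OF S(1) t, of i] unfolding \<rho>_def by blast
  have "(1 - \<rho>) ^ i \<le> exp (- \<rho>) ^ i"
    using \<rho> exp_ge_add_one_self[of "- \<rho>"] by (intro power_mono) auto
  also have "\<dots> = exp (- (\<rho> * real i))" by (simp add: exp_of_nat_mult[symmetric] mult_ac)
  also have "\<dots> \<le> exp (- real ?s)" using i(1) \<rho> by (simp add: field_simps)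
  finally have "real (?s choose k) * (1 - \<rho>) ^ i \<le> 2 ^ ?s * exp (- real ?s)"
    using binomial_le_pow2[of ?s k] of_nat_mono[of "?s choose k" "2 ^ ?s", where 'a = real] \<rho> by (intro mult_mono) auto
  also have "\<dots> = (2 * exp (-1)) ^ ?s"
    by (simp add: power_mult_distrib exp_of_nat_mult[symmetric])
  also have "\<dots> < 1"
  proof -
    have "2 < exp (1::real)" using exp_lower_Taylor_quadratic[of "1::real"] by simp
    then have "2 * exp (-1 :: real) < 1" by (simp add: exp_minus field_simps)
    then show ?thesis using S(2) by (intro power_Suc_less_one[of _ "?s - 1", simplified] power_less_one_iff[THEN iffD2]) auto
  qed
  finally have "card {T\<in>k_subsets S k. \<forall>X\<in>\<X>. \<not> X \<subseteq> T} = 0" using X(4) by linarith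
  moreover have "finite {T\<in>k_subsets S k. \<forall>X\<in>\<X>. \<not> X \<subseteq> T}" using finite_k_subsets[OF S(1)] by simp
  ultimately have cov: "\<forall>T\<in>k_subsets S k. \<exists>X\<in>\<X>. X \<subseteq> T" by auto
  have id: "real (?s choose k) * real (k choose t) = real (?s choose t) * real ((?s - t) choose (k - t))"
    using choose_mult[OF t] by (metis of_nat_mult)
  have "real (card \<X>) \<le> real ?s / \<rho> + 1 / \<rho>"
    using X(3) i(2) \<rho> le_divide_eq_1_pos[of \<rho> 1] by (simp add: order.trans[of "real (card \<X>)" "real i"])
      (smt (verit) divide_le_eq_1_pos le_divide_eq_1_pos of_nat_mono)
  then have "real (card \<X>) * \<rho> \<le> real ?s + 1" using \<rho> by (simp add: field_simps)
  then have "real (card \<X>) * real (k choose t) \<le> (real ?s + 1) * real (?s choose t)"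
    using pos by (simp add: \<rho>_def field_simps)
  then have "real (card \<X>) * real (k choose t) * real (?s choose k) \<le> (real ?s + 1) * real (?s choose t) * real (?s choose k)"
    by (intro mult_right_mono) auto
  then have "real (card \<X>) * real ((?s - t) choose (k - t)) * real (?s choose t) \<le> (real ?s + 1) * real (?s choose k) * real (?s choose t)"
    using id by (simp add: mult_ac)
  then have "real (card \<X>) * real ((?s - t) choose (k - t)) \<le> (real ?s + 1) * real (?s choose k)"
    using pos by (simp add: mult_le_cancel_right)
  then show ?thesis using X cov by blast
qed

section \<open>Weights of patterns and of tuples\<close>

lemma sum_list_concat: "sum_list (concat xss) = (\<Sum>xs\<leftarrow>xss. sum_list xs)"
  by (induction xss) auto

text \<open>The share of one block in the time bound of a query: the zeros of the left component are
  the elements left free, and the length of the right component is the contribution to the requested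
  cardinality.\<close>

definition weight :: "real \<Rightarrow> real \<Rightarrow> nat \<Rightarrow> tree \<Rightarrow> real" where
  "weight b c n w = b ^ count (\<lambda>i. \<not> bit_at i (left w)) n * c ^ length (list_of_tree (right w))"

text \<open>For each \<open>k\<close> the size of the cover is multiplied by the price bounded in
  \<open>exchange\<close>; both binomial coefficients cancel, and
  \<open>(s + 1) ^ 2 * \<alpha> ^ s\<close> is left. Adding over the \<open>s + 1\<close> values of
  \<open>k\<close> gives the cube.\<close>

lemma scheme_exists:
  fixes b c :: real assumes b: "b \<ge> 1" and c: "c \<ge> 1" and s: "s \<ge> 1"
  shows "\<exists>ws. covers s ws \<and> (\<Sum>w\<leftarrow>ws. weight b c s w) \<le> (real s + 1) ^ 3 * (1 + b - 1 / c) ^ s"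
proof -
  let ?\<alpha> = "1 + b - 1 / c"
  have "\<forall>k\<in>{..s}. \<exists>j\<le>k. real (s choose k) * (b ^ (s - k + j) * c ^ j) \<le>
     (real s + 1) * ?\<alpha> ^ s * real ((s - k + j) choose j)"
    using exchange[OF b c] by auto
  then obtain j where j: "\<And>k. k \<le> s \<Longrightarrow> j k \<le> k" and
    j': "\<And>k. k \<le> s \<Longrightarrow> real (s choose k) * (b ^ (s - k + j k) * c ^ j k) \<le>
     (real s + 1) * ?\<alpha> ^ s * real ((s - k + j k) choose j k)"
    by (metis atMost_iff)
  have "\<forall>k\<in>{..s}. \<exists>\<X>. finite \<X> \<and> \<X> \<subseteq> k_subsets {..<s} (k - j k) \<and> (\<forall>T\<in>k_subsets {..<s} k. \<exists>X\<in>\<X>. X \<subseteq> T) \<and>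
     real (card \<X>) * real ((s - (k - j k)) choose (k - (k - j k))) \<le> (real s + 1) * real (s choose k)"
  proof
    fix k assume "k \<in> {..s}"
    then show "\<exists>\<X>. finite \<X> \<and> \<X> \<subseteq> k_subsets {..<s} (k - j k) \<and> (\<forall>T\<in>k_subsets {..<s} k. \<exists>X\<in>\<X>. X \<subseteq> T) \<and>
     real (card \<X>) * real ((s - (k - j k)) choose (k - (k - j k))) \<le> (real s + 1) * real (s choose k)"
      using cover_exists[of "{..<s}" "k - j k" k] s by simp
  qed
  then obtain \<X> where X: "\<And>k. k \<le> s \<Longrightarrow> finite (\<X> k) \<and> \<X> k \<subseteq> k_subsets {..<s} (k - j k) \<and>
     (\<forall>T\<in>k_subsets {..<s} k. \<exists>X\<in>\<X> k. X \<subseteq> T) \<and>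
     real (card (\<X> k)) * real ((s - (k - j k)) choose (k - (k - j k))) \<le> (real s + 1) * real (s choose k)"
    by (metis atMost_iff)
  have "\<forall>k\<in>{..s}. \<exists>xs. set xs = \<X> k \<and> distinct xs" by (meson X atMost_iff finite_distinct_list)
  then obtain xs where xs: "\<And>k. k \<le> s \<Longrightarrow> set (xs k) = \<X> k \<and> distinct (xs k)" by (metis atMost_iff)
  define pat where "pat X i = Node (tree_of_bits (map (\<lambda>i. i \<in> X) [0..<s])) (tree_of_nat i)" for X i
  define ws where "ws = concat (map (\<lambda>k. map (\<lambda>X. pat X (j k)) (xs k)) [0..<Suc s])"
  have nbp: "bit_at i (left (pat X l)) \<longleftrightarrow> i < s \<and> i \<in> X" for i X l
    by (auto simp: pat_def bit_at_tree_of_bits)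
  have "covers s ws"
    unfolding covers_def
  proof
    fix t assume "t \<in> set (all_bits s)"
    then obtain bs where bs: "t = tree_of_bits bs" "length bs = s" by (auto simp: set_all_bits)
    define T where "T = {i. i < s \<and> bs ! i}"
    define k where "k = card T"
    have Ts: "T \<subseteq> {..<s}" by (auto simp: T_def)
    then have fT: "finite T" using finite_subset by blast
    have k: "k \<le> s" unfolding k_def using card_mono[OF _ Ts] by simp
    have "T \<in> k_subsets {..<s} k" using Ts by (simp add: k_subsets_def k_def)
    then obtain X where X': "X \<in> \<X> k" "X \<subseteq> T" using X[OF k] by blast
    then have cX: "card X = k - j k" using X[OF k] by (auto simp: k_subsets_def)
    have "{i. i < s \<and> bit_at i t \<and> \<not> bit_at i (left (pat X (j k)))} = T - X"
      by (auto simp: T_def nbp bs bit_at_tree_of_bits)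
    moreover have "card (T - X) = j k"
      using X'(2) fT cX j[OF k] by (simp add: card_Diff_subset finite_subset k_def)
    ultimately have "count (\<lambda>i. bit_at i t \<and> \<not> bit_at i (left (pat X (j k)))) s = j k" by (simp add: count_def)
    then have "matches s (pat X (j k)) t"
      using X'(2) unfolding matches_def match_bits_iff by (auto simp: nbp T_def bs bit_at_tree_of_bits) (simp_all add: pat_def tree_of_nat_conv)
    moreover have "pat X (j k) \<in> set ws" using k X'(1) xs[OF k] by (auto simp: ws_def less_Suc_eq_le simp del: upt_Suc intro!: bexI[of _ k])
    ultimately show "\<exists>w\<in>set ws. matches s w t" by blast
  qed
  moreover have "(\<Sum>w\<leftarrow>ws. weight b c s w) \<le> (real s + 1) ^ 3 * ?\<alpha> ^ s"
  proof -
    have al: "0 \<le> ?\<alpha>"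
    proof -
      have "1 / c \<le> 1" using c by simp
      then show ?thesis using b by linarith
    qed
    have one: "(\<Sum>X\<leftarrow>xs k. weight b c s (pat X (j k))) \<le> (real s + 1)\<^sup>2 * ?\<alpha> ^ s" if k: "k \<le> s" for k
    proof -
      let ?C = "real ((s - k + j k) choose j k)"
      have e: "s - (k - j k) = s - k + j k" "k - (k - j k) = j k" using j[OF k] k by auto
      have w: "weight b c s (pat X (j k)) = b ^ (s - k + j k) * c ^ j k" if "X \<in> \<X> k" for X
      proof -
        have "X \<subseteq> {..<s}" "card X = k - j k" using X[OF k] that by (auto simp: k_subsets_def)
        moreover have "{i. i < s \<and> \<not> bit_at i (left (pat X (j k)))} = {..<s} - X" by (auto simp: nbp)
        ultimately have "count (\<lambda>i. \<not> bit_at i (left (pat X (j k)))) s = s - k + j k"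
          using e by (simp add: count_def card_Diff_subset finite_subset)
        then show ?thesis by (simp add: weight_def pat_def tree_of_nat_conv)
      qed
      have "(\<Sum>X\<leftarrow>xs k. weight b c s (pat X (j k))) = (\<Sum>X\<in>\<X> k. weight b c s (pat X (j k)))"
        using xs[OF k] by (metis sum_list_distinct_conv_sum_set)
      also have "\<dots> = real (card (\<X> k)) * (b ^ (s - k + j k) * c ^ j k)" using w by simp
      finally have sum: "(\<Sum>X\<leftarrow>xs k. weight b c s (pat X (j k))) = real (card (\<X> k)) * (b ^ (s - k + j k) * c ^ j k)" .
      have C: "?C > 0" "real (s choose k) > 0" using k by auto
      have "(real (card (\<X> k)) * (b ^ (s - k + j k) * c ^ j k)) * (?C * real (s choose k)) =
         (real (card (\<X> k)) * ?C) * (real (s choose k) * (b ^ (s - k + j k) * c ^ j k))" by (simp add: mult_ac)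
      also have "\<dots> \<le> ((real s + 1) * real (s choose k)) * ((real s + 1) * ?\<alpha> ^ s * ?C)"
        using X[OF k] j'[OF k] b c al unfolding e by (intro mult_mono[of "_ * _" _ "_ * _"]) auto
      also have "\<dots> = ((real s + 1)\<^sup>2 * ?\<alpha> ^ s) * (?C * real (s choose k))" by (simp add: power2_eq_square mult_ac)
      finally show ?thesis unfolding sum using C by (simp add: mult_le_cancel_right)
    qed
    have "(\<Sum>w\<leftarrow>ws. weight b c s w) = (\<Sum>k\<leftarrow>[0..<Suc s]. \<Sum>X\<leftarrow>xs k. weight b c s (pat X (j k)))"
      by (simp add: ws_def map_concat sum_list_concat o_def del: upt_Suc)
    also have "\<dots> \<le> (\<Sum>k\<leftarrow>[0..<Suc s]. (real s + 1)\<^sup>2 * ?\<alpha> ^ s)"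
      by (intro sum_list_mono one) auto
    also have "\<dots> = (real s + 1) ^ 3 * ?\<alpha> ^ s"
      by (simp add: sum_list_triv power2_eq_square power3_eq_cube mult_ac del: upt_Suc)
    finally show ?thesis .
  qed
  ultimately show ?thesis by blast
qed

text \<open>A tuple is a free choice of one suffix per block, and suffixes correspond to patterns
  through their heads, so this is the expansion of a power of a sum.\<close>

lemma sum_tuples:
  fixes v :: "'a \<Rightarrow> real"
  shows "(\<Sum>gs\<leftarrow>tuples ws m. \<Prod>g\<leftarrow>gs. v (hd g)) = (\<Sum>w\<leftarrow>ws. v w) ^ m"
proof (induction m)
  case (Suc m)
  have s: "(\<Sum>g\<leftarrow>suffs ws. v (hd g)) = (\<Sum>w\<leftarrow>ws. v w)" by (induction ws) auto
  have "(\<Sum>gs\<leftarrow>tuples ws (Suc m). \<Prod>g\<leftarrow>gs. v (hd g)) =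
     (\<Sum>gs\<leftarrow>tuples ws m. \<Sum>g\<leftarrow>suffs ws. v (hd g) * (\<Prod>g\<leftarrow>gs. v (hd g)))"
    by (simp add: tuples_Suc rev_map[symmetric] map_concat sum_list_concat o_def)
  also have "\<dots> = (\<Sum>gs\<leftarrow>tuples ws m. (\<Sum>w\<leftarrow>ws. v w) * (\<Prod>g\<leftarrow>gs. v (hd g)))"
    by (simp only: sum_list_mult_const s)
  also have "\<dots> = (\<Sum>w\<leftarrow>ws. v w) ^ Suc m"
    by (simp only: sum_list_const_mult Suc power_Suc)
  finally show ?case .
qed simp

text \<open>The zeros of the chosen vector are counted block by block. The padding of the last block
  can only raise the exponent of \<open>b\<close>, which is harmless because
  \<open>b \<ge> 1\<close>.\<close>

lemma weight_tuple:
  fixes b c :: real assumes b: "b \<ge> 1" and c: "c \<ge> 1" and n: "n \<le> length gs * s"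
  shows "b ^ (n - count (\<lambda>i. chosen_bits n s gs ! i) n) * c ^ rest_size gs \<le> (\<Prod>g\<leftarrow>gs. weight b c s (hd g))"
proof -
  let ?Z = "\<lambda>gs. tree_of_list (chosen s gs)"
  have zeros: "count (\<lambda>i. \<not> bit_at i (?Z gs)) (length gs * s) = (\<Sum>g\<leftarrow>gs. count (\<lambda>i. \<not> bit_at i (left (hd g))) s)" for gs
  proof (induction gs)
    case (Cons g gs)
    have Z1: "bit_at i (?Z (g # gs)) \<longleftrightarrow> bit_at i (left (hd g))" if "i < s" for i
      using that by (simp add: chosen_def bit_at_tree_of_list nth_append)
        (simp add: prefix_list_def bit_at_def)
    have Z2: "bit_at (s + i) (?Z (g # gs)) \<longleftrightarrow> bit_at i (?Z gs)" for i
      by (simp add: chosen_def bit_at_tree_of_list nth_append)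
    have "count (\<lambda>i. \<not> bit_at i (?Z (g # gs))) (s + length gs * s) =
       count (\<lambda>i. \<not> bit_at i (left (hd g))) s + count (\<lambda>i. \<not> bit_at i (?Z gs)) (length gs * s)"
      unfolding count_add Z2 unfolding count_sum using Z1 by (auto intro!: sum.cong)
    then show ?case using Cons by simp
  qed simp
  have "n - count (\<lambda>i. chosen_bits n s gs ! i) n = card ({..<n} - {i. i < n \<and> chosen_bits n s gs ! i})"
    by (subst card_Diff_subset) (auto simp: count_def)
  also have "{..<n} - {i. i < n \<and> chosen_bits n s gs ! i} = {i. i < n \<and> \<not> bit_at i (?Z gs)}"
    by (auto simp: chosen_bits_def bits_of_def bit_at_def)
  also have "card \<dots> \<le> count (\<lambda>i. \<not> bit_at i (?Z gs)) (length gs * s)"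
    unfolding count_def using n by (intro card_mono) auto
  finally have "b ^ (n - count (\<lambda>i. chosen_bits n s gs ! i) n) * c ^ rest_size gs \<le>
     b ^ count (\<lambda>i. \<not> bit_at i (?Z gs)) (length gs * s) * c ^ rest_size gs"
    using b c by (intro mult_right_mono power_increasing) auto
  also have "\<dots> = (\<Prod>g\<leftarrow>gs. weight b c s (hd g))"
    unfolding zeros rest_size_def by (induction gs) (auto simp: weight_def power_add)
  finally show ?thesis .
qed

section \<open>The exponent and the encoding of sets\<close>

text \<open>The bound for \<open>\<epsilon> = 1 / (j + 1)\<close> has the excess exponent
  \<open>h m j\<close>, its constant being moved into the exponent by a logarithm. For every
  \<open>m\<close> the best of the first \<open>m + 1\<close> bounds is taken: the minimum obeys all
  of them eventually, and at each \<open>m\<close> it is attained by one that is valid.\<close>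

lemma little_o_exponent:
  fixes \<alpha> :: real and n :: "'i \<Rightarrow> nat" and T P :: "'i \<Rightarrow> real"
  assumes \<alpha>: "\<alpha> > 1" and P: "\<And>x. P x \<ge> 0"
    and T: "\<And>\<epsilon>. \<epsilon> > 0 \<Longrightarrow> \<exists>C. \<forall>x. T x \<le> C * \<alpha> powr ((1 + \<epsilon>) * real (n x)) * P x"
  shows "\<exists>g. g \<in> o(\<lambda>n. real n) \<and> (\<forall>x. T x \<le> \<alpha> powr (real (n x) + g (n x)) * P x)"
proof -
  have "\<forall>j. \<exists>C. \<forall>x. T x \<le> C * \<alpha> powr ((1 + 1 / (real j + 1)) * real (n x)) * P x"
    using T by simp
  then obtain C where C: "\<And>j x. T x \<le> C j * \<alpha> powr ((1 + 1 / (real j + 1)) * real (n x)) * P x"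
    by metis
  \<comment> \<open>The maximum keeps the logarithm defined and nonnegative; nothing is known about
    the sign of \<open>C j\<close>.\<close>
  define l where "l j = log \<alpha> (max 1 (C j))" for j
  have l0: "l j \<ge> 0" and Cl: "C j \<le> \<alpha> powr l j" for j
    using \<alpha> by (auto simp: l_def)
  define h where "h m j = real m / (real j + 1) + l j" for m j
  define g where "g m = Min (h m ` {..m})" for m
  have h0: "h m j \<ge> 0" for m j using l0 by (simp add: h_def)
  have g0: "g m \<ge> 0" for m unfolding g_def using h0 by (subst Min_ge_iff) auto
  have gh: "g m \<le> h m j" if "j \<le> m" for m j
    unfolding g_def using that by (intro Min_le) auto
  have "g \<in> o(\<lambda>n. real n)"
  proof (rule landau_o.smallI)
    fix e :: real assume e: "e > 0"
    \<comment> \<open>One half of \<open>e\<close> pays for the linear term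
      \<open>m / (j + 1)\<close>, the other half for the constant \<open>l j\<close> once
      \<open>m\<close> is large.\<close>
    define j where "j = nat \<lceil>2 / e\<rceil>"
    have j: "1 / (real j + 1) \<le> e / 2"
    proof -
      have "2 / e \<le> real j" unfolding j_def by (rule real_nat_ceiling_ge)
      then have "2 / e \<le> real j + 1" by simp
      then show ?thesis using e by (simp add: field_simps)
    qed
    have "eventually (\<lambda>m. m \<ge> max j (nat \<lceil>2 * l j / e\<rceil>)) at_top" by (rule eventually_ge_at_top)
    then show "eventually (\<lambda>m. norm (g m) \<le> e * norm (real m)) at_top"
    proof eventually_elim
      case (elim m)
      have "2 * l j / e \<le> real m" using elim by linarith
      then have "l j \<le> e / 2 * real m" using e by (simp add: field_simps)
      moreover have "real m / (real j + 1) \<le> e / 2 * real m"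
        using mult_right_mono[OF j, of "real m"] by simp
      moreover have "g m \<le> real m / (real j + 1) + l j" using gh[of j m] elim by (simp add: h_def)
      ultimately have "g m \<le> e / 2 * real m + e / 2 * real m" by linarith
      then show ?case using g0[of m] by simp
    qed
  qed
  moreover have "T x \<le> \<alpha> powr (real (n x) + g (n x)) * P x" for x
  proof -
    have "g (n x) \<in> h (n x) ` {..n x}" unfolding g_def by (intro Min_in) auto
    then obtain j where j: "g (n x) = h (n x) j" by auto
    have "T x \<le> C j * \<alpha> powr ((1 + 1 / (real j + 1)) * real (n x)) * P x" by (rule C)
    also have "\<dots> \<le> \<alpha> powr l j * \<alpha> powr ((1 + 1 / (real j + 1)) * real (n x)) * P x"
      using Cl P by (intro mult_right_mono) auto
    also have "\<dots> = \<alpha> powr (real (n x) + g (n x)) * P x"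
      unfolding j h_def by (simp add: powr_add[symmetric] algebra_simps)
    finally show ?thesis .
  qed
  ultimately show ?thesis by blast
qed

section \<open>Characteristic vectors of sets\<close>

definition bits :: "'a::linorder set \<Rightarrow> 'a set \<Rightarrow> bool list" where
  "bits U S = map (\<lambda>u. u \<in> S) (sorted_list_of_set U)"

definition set_of :: "'a::linorder set \<Rightarrow> bool list \<Rightarrow> 'a set" where
  "set_of U X = {sorted_list_of_set U ! i |i. i < card U \<and> X ! i}"

lemma tree_of_subset_bits: "tree_of_subset U S = tree_of_bits (bits U S)"
  by (simp add: tree_of_subset_def bits_def)

lemma length_bits [simp]: "length (bits U S) = card U"
  by (simp add: bits_def)

lemma bits_nth: "i < card U \<Longrightarrow> bits U S ! i \<longleftrightarrow> sorted_list_of_set U ! i \<in> S"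
  by (simp add: bits_def)

lemma set_of_bits: "finite U \<Longrightarrow> S \<subseteq> U \<Longrightarrow> set_of U (bits U S) = S"
proof -
  assume U: "finite U" "S \<subseteq> U"
  have "x \<in> set_of U (bits U S)" if "x \<in> S" for x
  proof -
    have "x \<in> set (sorted_list_of_set U)" using that U by auto
    then obtain i where "i < card U" "sorted_list_of_set U ! i = x" by (auto simp: in_set_conv_nth)
    then show ?thesis using that by (auto simp: set_of_def bits_nth)
  qed
  then show ?thesis by (auto simp: set_of_def bits_nth)
qed

lemma nth_in_set_of:
  assumes "finite U" "i < card U" shows "sorted_list_of_set U ! i \<in> set_of U X \<longleftrightarrow> X ! i"
proof -
  have "distinct (sorted_list_of_set U)" by simp
  then show ?thesis using assms
    by (auto simp: set_of_def nth_eq_iff_index_eq)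
qed

lemma bits_set_of: "finite U \<Longrightarrow> length X = card U \<Longrightarrow> bits U (set_of U X) = X"
  by (rule nth_equalityI) (auto simp: bits_nth nth_in_set_of)

lemma set_of_subset: "finite U \<Longrightarrow> set_of U X \<subseteq> U"
proof
  fix x assume "finite U" "x \<in> set_of U X"
  then obtain i where "i < length (sorted_list_of_set U)" "x = sorted_list_of_set U ! i" by (auto simp: set_of_def)
  then have "x \<in> set (sorted_list_of_set U)" by simp
  then show "x \<in> U" using \<open>finite U\<close> by simp
qed

lemma card_set_of:
  assumes "finite U" shows "card (set_of U X) = count (\<lambda>i. X ! i) (card U)"
proof -
  have "set_of U X = (\<lambda>i. sorted_list_of_set U ! i) ` {i. i < card U \<and> X ! i}" by (auto simp: set_of_def)
  moreover have "inj_on (\<lambda>i. sorted_list_of_set U ! i) {i. i < card U \<and> X ! i}"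
    by (auto simp: inj_on_def nth_eq_iff_index_eq)
  ultimately show ?thesis by (simp add: card_image count_def)
qed

lemma inj_on_bits: "finite U \<Longrightarrow> inj_on (bits U) (Pow U)"
  by (rule inj_on_inverseI[where g = "set_of U"]) (auto simp: set_of_bits)

lemma bits_extensions:
  assumes U: "finite U" and F: "F \<subseteq> Pow U" and X: "length X = card U"
  shows "bits U ` extensions (U, F) (set_of U X) k = bit_extensions (card U) (bits U ` F) X k"
proof (intro equalityI subsetI)
  fix Y assume "Y \<in> bits U ` extensions (U, F) (set_of U X) k"
  then obtain S where S: "Y = bits U S" "S \<subseteq> U - set_of U X" "card S = k" "S \<union> set_of U X \<in> F"
    by (auto simp: extensions_def)
  have "card (set_of U (bits U S)) = k" using S U by (subst set_of_bits) auto
  moreover have "map (\<lambda>i. Y ! i \<or> X ! i) [0..<card U] = bits U (S \<union> set_of U X)"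
    by (rule nth_equalityI) (auto simp: S(1) bits_nth nth_in_set_of[OF U])
  moreover have "\<not> X ! i" if "i < card U" "Y ! i" for i
    using that S(2) nth_in_set_of[OF U that(1), of X] by (auto simp: S(1) bits_nth)
  ultimately show "Y \<in> bit_extensions (card U) (bits U ` F) X k"
    unfolding bit_extensions_def using S by (auto simp: card_set_of[OF U])
next
  fix Y assume "Y \<in> bit_extensions (card U) (bits U ` F) X k"
  then have Y: "length Y = card U" "\<And>i. i < card U \<Longrightarrow> Y ! i \<Longrightarrow> \<not> X ! i" "count (\<lambda>i. Y ! i) (card U) = k"
    "map (\<lambda>i. Y ! i \<or> X ! i) [0..<card U] \<in> bits U ` F" by (auto simp: bit_extensions_def)
  let ?S = "set_of U Y"
  have "map (\<lambda>i. Y ! i \<or> X ! i) [0..<card U] = bits U (?S \<union> set_of U X)"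
    by (rule nth_equalityI) (auto simp: bits_nth nth_in_set_of[OF U])
  then obtain S' where "S' \<in> F" "bits U (?S \<union> set_of U X) = bits U S'" using Y(4) by auto
  then have "?S \<union> set_of U X \<in> F"
    using inj_onD[OF inj_on_bits[OF U], of "?S \<union> set_of U X" S'] set_of_subset[OF U] F by auto
  moreover have "?S \<inter> set_of U X = {}"
  proof -
    have False if "x \<in> ?S" "x \<in> set_of U X" for x
    proof -
      obtain i where "i < card U" "x = sorted_list_of_set U ! i" "Y ! i" using \<open>x \<in> ?S\<close> by (auto simp: set_of_def)
      then show False using Y(2) that(2) nth_in_set_of[OF U] by auto
    qed
    then show ?thesis by auto
  qed
  ultimately have "?S \<in> extensions (U, F) (set_of U X) k"
    using set_of_subset[OF U, of Y] card_set_of[OF U, of Y] Y(3) by (auto simp: extensions_def)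
  then show "Y \<in> bits U ` extensions (U, F) (set_of U X) k"
    using bits_set_of[OF U Y(1)] by (metis imageI)
qed

text \<open>For \<open>b = c = 1\<close> the bound is polynomial and leaves no room for the search.\<close>

definition all_sizes :: "com \<Rightarrow> com" where
  "all_sizes p = Seq (Assign 1 (Hd (Var 0))) (Seq (Assign 2 (Tl (Var 0))) (Seq (Assign 3 Empty)
     (Seq (For 5 6 (Var 2) (Assign 3 (expr.Cons Empty (Var 3)))) (Seq (Assign 4 Empty) (Seq (Assign 9 Empty)
     (Seq (For 5 6 (expr.Cons Empty (Var 2)) (Seq (call 100 p (expr.Cons (Var 1) (expr.Cons (Var 3) (Var 4))) 7)
       (Seq (For 10 11 (Var 7) (Assign 9 (expr.Cons (Var 10) (Var 9)))) (Assign 4 (expr.Cons Empty (Var 4))))))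
     (Assign 0 (Var 9))))))))"

lemma runs_all_sizes:
  assumes p: "\<And>k. computes_in p (Node It (Node (tree_of_nat (length us)) (tree_of_nat k))) (tree_of_list (L k)) (t k)"
    and T: "\<And>k. k \<le> length us \<Longrightarrow> t k \<le> B \<and> length (L k) \<le> B"
  shows "\<exists>T. computes_in (all_sizes p) (Node It (tree_of_list us))
      (tree_of_list (rev (concat (map L [0..<Suc (length us)])))) T \<and> T \<le> (length us + 1) * (14 * B + 2 * var_bound p + 100)"
proof -
  let ?n = "length us"
  let ?s = "(\<lambda>_. Leaf)(0 := Node It (tree_of_list us), 1 := It, 2 := tree_of_list us, 3 := Leaf)"
  let ?R = "rev (concat (map L [0..<Suc ?n]))"
  let ?I = "\<lambda>(ys :: tree list) (s' :: store). s' 1 = It \<and> s' 2 = tree_of_list us \<and> (\<exists>k. k + length ys = ?n \<and> s' 3 = tree_of_nat k)"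
  have 1: "runs (For 5 6 (Var 2) (Assign 3 (expr.Cons Empty (Var 3)))) ?s (12 * ?n + 4) (?I [])"
  proof (rule runs_For[where xs = us and B = "\<lambda>_. 4" and Inv = ?I])
    fix x :: tree and ys :: "tree list" and s1 :: store assume "?I (x # ys) s1"
    then obtain k where "Suc k + length ys = ?n" "s1 3 = tree_of_nat k" "s1 1 = It" "s1 2 = tree_of_list us" by auto
    then show "runs (Assign 3 (expr.Cons Empty (Var 3))) (s1(5 := x, 6 := tree_of_list ys)) 4
       (\<lambda>s'. s' 6 = tree_of_list ys \<and> ?I ys s')"
      by (auto simp: runs_simps intro!: exI[of _ "Suc k"])
  qed (auto simp: sum_list_triv intro!: exI[of _ 0])
  let ?B = "13 * B + 2 * var_bound p + 40"
  let ?P = "Seq (call 100 p (expr.Cons (Var 1) (expr.Cons (Var 3) (Var 4))) 7)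
       (Seq (For 10 11 (Var 7) (Assign 9 (expr.Cons (Var 10) (Var 9)))) (Assign 4 (expr.Cons Empty (Var 4))))"
  let ?F = "\<lambda>(s' :: store). s' 1 = It \<and> s' 2 = tree_of_list us \<and> s' 3 = tree_of_nat ?n"
  let ?J = "\<lambda>(ys :: tree list) s'. ?F s' \<and> (\<exists>k. k + length ys = Suc ?n \<and> s' 4 = tree_of_nat k \<and>
     s' 9 = tree_of_list (rev (concat (map L [0..<k]))))"
  \<comment> \<open>The traversed list has one element more than the universe, since the
    cardinalities run from 0 to \<open>?n\<close>.\<close>
  have 2: "runs (For 5 6 (expr.Cons Empty (Var 2)) ?P) s1 ((?n + 1) * (?B + 8) + 6) (?J [])"
    if s1: "?F s1" "s1 4 = Leaf" "s1 9 = Leaf" for s1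
  proof (rule runs_For[where xs = "Leaf # us" and B = "\<lambda>_. ?B" and Inv = ?J])
    fix x :: tree and ys :: "tree list" and s2 assume "?J (x # ys) s2"
    then obtain k where k: "Suc k + length ys = Suc ?n" "s2 4 = tree_of_nat k" "?F s2"
      "s2 9 = tree_of_list (rev (concat (map L [0..<k])))" by auto
    let ?s2 = "s2(5 := x, 6 := tree_of_list ys)"
    have tk: "t k \<le> B" "length (L k) \<le> B" using T[of k] k(1) by auto
    show "runs ?P ?s2 ?B (\<lambda>s'. s' 6 = tree_of_list ys \<and> ?J ys s')"
    proof (rule runs_Seq[OF runs_weaken[OF runs_call[where y = "tree_of_list (L k)" and t = "t k", OF _ _ _ order.refl] order.refl],
          where ?T2.0 = "12 * B + 15"])
      show "computes_in p (eval_expr (expr.Cons (Var 1) (expr.Cons (Var 3) (Var 4))) ?s2) (tree_of_list (L k)) (t k)"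
        using p[of k] k by simp
      fix s3 assume s3: "s3 7 = tree_of_list (L k) \<and> (\<forall>v<100. v \<noteq> 7 \<longrightarrow> s3 v = ?s2 v)"
      let ?K = "\<lambda>zs s'. (\<exists>acc. s' 9 = tree_of_list acc \<and> rev zs @ acc = rev (concat (map L [0..<Suc k]))) \<and>
        ?F s' \<and> s' 4 = tree_of_nat k \<and> s' 6 = tree_of_list ys"
      show "runs (Seq (For 10 11 (Var 7) (Assign 9 (expr.Cons (Var 10) (Var 9)))) (Assign 4 (expr.Cons Empty (Var 4)))) s3
         (12 * B + 15) (\<lambda>s'. s' 6 = tree_of_list ys \<and> ?J ys s')"
      proof (rule runs_Seq)
        show "runs (For 10 11 (Var 7) (Assign 9 (expr.Cons (Var 10) (Var 9)))) s3 (12 * B + 5)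
           (\<lambda>s'. runs (Assign 4 (expr.Cons Empty (Var 4))) s' 4 (\<lambda>s'. s' 6 = tree_of_list ys \<and> ?J ys s'))"
        proof (rule runs_For[where xs = "L k" and B = "\<lambda>_. 4" and Inv = ?K])
          fix z zs s4 assume "?K (z # zs) s4"
          then obtain acc where "s4 9 = tree_of_list acc" "rev zs @ z # acc = rev (concat (map L [0..<Suc k]))"
            "?F s4" "s4 4 = tree_of_nat k" "s4 6 = tree_of_list ys" by auto
          then show "runs (Assign 9 (expr.Cons (Var 10) (Var 9))) (s4(10 := z, 11 := tree_of_list zs)) 4
             (\<lambda>s'. s' 11 = tree_of_list zs \<and> ?K zs s')"
            by (auto simp: runs_simps intro!: exI[of _ "z # acc"])
        next
          fix s4 assume K: "?K [] s4"
          then have "(s4(4 := tree_of_nat (Suc k))) 9 = tree_of_list (rev (concat (map L [0..<Suc k])))" by auto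
          then have "?J ys (s4(4 := tree_of_nat (Suc k)))"
            using K k(1) by (intro conjI exI[of _ "Suc k"]) auto
          then show "runs (Assign 4 (expr.Cons Empty (Var 4))) s4 4 (\<lambda>s'. s' 6 = tree_of_list ys \<and> ?J ys s')"
            using K by (simp add: runs_simps del: upt_Suc)
        qed (use s3 k tk in \<open>auto simp: sum_list_triv\<close>)
      qed simp
    qed (use tk in auto)
  qed (use s1 in \<open>auto simp: sum_list_triv intro!: exI[of _ 0]\<close>)
  have "runs (Seq (For 5 6 (Var 2) (Assign 3 (expr.Cons Empty (Var 3)))) (Seq (Assign 4 Empty) (Seq (Assign 9 Empty)
     (Seq (For 5 6 (expr.Cons Empty (Var 2)) ?P) (Assign 0 (Var 9)))))) ?s (12 * ?n + 4 + ((?n + 1) * (?B + 8) + 12))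
     (\<lambda>s'. s' 0 = tree_of_list ?R)"
  proof (rule runs_Seq[OF runs_weaken[OF 1 order.refl]])
    fix s1 assume s1: "?I [] s1"
    have "runs (Seq (For 5 6 (expr.Cons Empty (Var 2)) ?P) (Assign 0 (Var 9))) (s1(4 := Leaf, 9 := Leaf))
       ((?n + 1) * (?B + 8) + 8) (\<lambda>s'. s' 0 = tree_of_list ?R)"
      by (rule runs_Seq[OF runs_weaken[OF 2 order.refl], where ?T2.0 = 2]) (use s1 in \<open>auto simp: runs_simps\<close>)
    then show "runs (Seq (Assign 4 Empty) (Seq (Assign 9 Empty)
     (Seq (For 5 6 (expr.Cons Empty (Var 2)) ?P) (Assign 0 (Var 9))))) s1 ((?n + 1) * (?B + 8) + 12)
     (\<lambda>s'. s' 0 = tree_of_list ?R)"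
      by (auto simp: runs_simps elim!: runs_weaken)
  qed simp
  then have "runs (all_sizes p) ((\<lambda>_. Leaf)(0 := Node It (tree_of_list us))) ((?n + 1) * (14 * B + 2 * var_bound p + 100)) (\<lambda>s'. s' 0 = tree_of_list ?R)"
    by (auto simp: all_sizes_def runs_simps algebra_simps elim!: runs_weaken)
  then show ?thesis unfolding runs_def computes_in_def by blast
qed

section \<open>The main theorem\<close>

lemma computes_in_unique: "computes_in p x y t \<Longrightarrow> computes_in p x y' t' \<Longrightarrow> y' = y \<and> t' = t"
  unfolding computes_in_def using exec_deterministic by blast

lemma scheme_for_exponent:
  fixes b c \<epsilon> :: real
  defines "\<alpha> \<equiv> 1 + b - 1 / c"
  assumes b: "b \<ge> 1" and c: "c \<ge> 1" and \<alpha>: "\<alpha> > 1" and \<epsilon>: "\<epsilon> > 0"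
  shows "\<exists>a. covers (length (blocks a)) (patterns a) \<and>
     (\<Sum>w\<leftarrow>patterns a. weight b c (length (blocks a)) w) \<le> \<alpha> powr ((1 + \<epsilon>) * real (length (blocks a)))"
proof -
  define l where "l = \<epsilon> * ln \<alpha>"
  have l: "l > 0" using \<alpha> \<epsilon> by (simp add: l_def)
  \<comment> \<open>The cube \<open>(s + 1) ^ 3 \<le> 8 * s ^ 3\<close> has to stay below
    \<open>exp (s * l)\<close>. The estimate \<open>(1 + x / 4) ^ 4 \<le> exp x\<close> supplies a
    fourth power, which wins as soon as \<open>s \<ge> 8 * (4 / l) ^ 4\<close>; adding 1 makes the
    block nonempty.\<close>
  define s where "s = nat \<lceil>8 * (4 / l) ^ 4\<rceil> + 1"
  have s: "s \<ge> 1" "8 * (4 / l) ^ 4 \<le> real s"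
    using order.trans[OF real_nat_ceiling_ge[of "8 * (4 / l) ^ 4"], of "real s"] unfolding s_def by simp_all
  have "(real s + 1) ^ 3 \<le> (2 * real s) ^ 3" using s(1) by (intro power_mono) auto
  also have "\<dots> = 8 * real s ^ 3" by (simp add: power_mult_distrib)
  also have "\<dots> \<le> real s * (l / 4) ^ 4 * real s ^ 3"
    using s(2) l by (intro mult_right_mono) (auto simp: field_simps)
  also have "\<dots> = (1 * (real s * l / 4)) ^ 4" by (simp add: power4_eq_xxxx power3_eq_cube)
  also have "\<dots> \<le> (1 + real s * l / real 4) ^ 4" using l by (intro power_mono) auto
  also have "\<dots> \<le> exp (real s * l)"
  proof (rule exp_ge_one_plus_x_over_n_power_n)
    have "0 \<le> real s * l" using l by simp
    then show "- real 4 \<le> real s * l" by linarith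
  qed simp
  also have "\<dots> = \<alpha> powr (\<epsilon> * real s)" using \<alpha> by (simp add: powr_def l_def mult_ac)
  finally have poly: "(real s + 1) ^ 3 \<le> \<alpha> powr (\<epsilon> * real s)" .
  obtain ws where ws: "covers s ws" "(\<Sum>w\<leftarrow>ws. weight b c s w) \<le> (real s + 1) ^ 3 * \<alpha> ^ s"
    using scheme_exists[OF b c s(1)] unfolding \<alpha>_def by blast
  \<comment> \<open>\<open>patterns\<close> and \<open>blocks\<close> always read off a nonempty
    list, so a list survives the encoding exactly if it is nonempty; a covering list is, since there
    is a vector to be matched.\<close>
  have "ws \<noteq> []" using ws(1) length_all_bits[of s] by (cases "all_bits s") (auto simp: covers_def)
  then have pats: "patterns (Node (tree_of_nat s) (tree_of_list ws)) = ws" by (cases ws) (auto simp: patterns_def)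
  have blks: "length (blocks (Node (tree_of_nat s) (tree_of_list ws))) = s"
    using s(1) by (cases s) (auto simp: blocks_def tree_of_nat_conv simp del: tree_of_nat_simps)
  have "(real s + 1) ^ 3 * \<alpha> ^ s \<le> \<alpha> powr (\<epsilon> * real s) * \<alpha> powr real s"
    using poly \<alpha> by (intro mult_mono) (auto simp: powr_realpow)
  also have "\<dots> = \<alpha> powr ((1 + \<epsilon>) * real s)" by (simp add: powr_add[symmetric] algebra_simps)
  finally show ?thesis using ws
    by (intro exI[of _ "Node (tree_of_nat s) (tree_of_list ws)"]) (auto simp: pats blks)
qed

lemma power_of_two_above: "\<exists>r. t < 2 ^ r \<and> 2 ^ r \<le> 2 * (t + 1 :: nat)"
proof (induction t)
  case 0
  show ?case by (rule exI[of _ 0]) simp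
next
  case (Suc t)
  then obtain r where r: "t < 2 ^ r" "2 ^ r \<le> 2 * (t + 1)" by blast
  show ?case
  proof (cases "Suc t < 2 ^ r")
    case True
    then show ?thesis using r by (intro exI[of _ r]) auto
  next
    case False
    then have "2 ^ r = Suc t" using r by simp
    then show ?thesis by (intro exI[of _ "Suc r"]) auto
  qed
qed

lemma real_le_two_power: "real n + 1 \<le> 2 ^ (n + 1)"
proof -
  have "n + 1 < 2 ^ (n + 1)" by (rule less_exp)
  then have "real (n + 1) < real (2 ^ (n + 1))" by (simp only: of_nat_less_iff)
  then show ?thesis by simp
qed

lemma real_sum_list: "real (\<Sum>x\<leftarrow>xs. f x) = (\<Sum>x\<leftarrow>xs. real (f x))"
  by (induction xs) auto

text \<open>The uniform algorithm after choice: the list and the exact time of each query become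
  functions of the query, and sets are replaced by their characteristic vectors.\<close>

locale uniform_enumerator =
  fixes b c :: real and \<Phi> :: "bool list \<Rightarrow> 'a::linorder set_system" and p :: com
    and L :: "bool list \<Rightarrow> bool list \<Rightarrow> nat \<Rightarrow> bool list list" and t :: "bool list \<Rightarrow> bool list \<Rightarrow> nat \<Rightarrow> nat"
    and C :: real and d :: nat
  assumes b: "b \<ge> 1" and c: "c \<ge> 1" and C: "C \<ge> 0" and \<Phi>: "implicit_set_system \<Phi>"
    and p: "\<And>I X k. length X = card (fst (\<Phi> I)) \<Longrightarrow>
        computes_in p (Node (tree_of_bits I) (Node (tree_of_bits X) (tree_of_nat k)))
          (tree_of_list (map tree_of_bits (L I X k))) (t I X k) \<and>
        distinct (L I X k) \<and>
        set (L I X k) = bit_extensions (card (fst (\<Phi> I))) (bits (fst (\<Phi> I)) ` snd (\<Phi> I)) X k \<and>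
        real (t I X k) \<le> b ^ (card (fst (\<Phi> I)) - count (\<lambda>i. X ! i) (card (fst (\<Phi> I)))) * c ^ k *
           (C * (real (length I) + 1) ^ d)"
begin

definition good :: "bool list \<Rightarrow> tree \<Rightarrow> bool" where
  "good I y \<longleftrightarrow> (\<exists>out. y = tree_of_list (map tree_of_bits out) \<and> distinct out \<and>
     set out = bits (fst (\<Phi> I)) ` snd (\<Phi> I))"

definition us :: "bool list \<Rightarrow> tree list" where
  "us I = replicate (card (fst (\<Phi> I))) (tree_of_bool True)"

lemma length_us [simp]: "length (us I) = card (fst (\<Phi> I))"
  by (simp add: us_def)

lemma instance_tree: "tree_of_instance \<Phi> I = Node (tree_of_bits I) (tree_of_list (us I))"
proof -
  have U: "finite (fst (\<Phi> I))" using \<Phi> by (simp add: implicit_set_system_def)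
  have "sorted_list_of_set (fst (\<Phi> I)) ! i \<in> fst (\<Phi> I)" if "i < card (fst (\<Phi> I))" for i
    using U that nth_mem[of i "sorted_list_of_set (fst (\<Phi> I))"] by simp
  then have "map tree_of_bool (bits (fst (\<Phi> I)) (fst (\<Phi> I))) = us I"
    by (intro nth_equalityI) (simp_all add: us_def bits_nth)
  then show ?thesis by (simp add: tree_of_instance_def tree_of_subset_bits tree_of_bits_conv)
qed

text \<open>The bound on a query is a product over blocks, so by \<open>sum_tuples\<close> the sum
  over all tuples collapses to a power of the total weight. The lemma holds for every candidate,
  covering or not, because the search has to know how \<open>solve\<close> behaves on all of
  them.\<close>

lemma solve_bound:
  "\<exists>K. \<forall>I. \<exists>f y T m. computes_in (solve p) (Node (tree_of_instance \<Phi> I) a) (Node f y) T \<and>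
     (f \<noteq> Leaf \<longrightarrow> good I y) \<and> (covers (length (blocks a)) (patterns a) \<longrightarrow> f \<noteq> Leaf) \<and>
     m * length (blocks a) < card (fst (\<Phi> I)) + length (blocks a) \<and>
     real T \<le> K * (real (length I) + 1) ^ (d + 2) * (\<Sum>w\<leftarrow>patterns a. weight b c (length (blocks a)) w) ^ m \<and> K \<ge> 0"
proof -
  let ?s = "length (blocks a)"
  let ?ws = "patterns a"
  from solve_correct[of p a] obtain K where K: "\<And>I us F L t. length (us :: tree list) \<le> length I \<Longrightarrow> F \<subseteq> {Y. length Y = length us} \<Longrightarrow>
     (\<forall>X k. length X = length us \<longrightarrow>
        computes_in p (Node (tree_of_bits I) (Node (tree_of_bits X) (tree_of_nat k)))
           (tree_of_list (map tree_of_bits (L X k))) (t X k) \<and>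
        distinct (L X k) \<and> set (L X k) = bit_extensions (length us) F X k) \<Longrightarrow>
     (\<exists>f y T m. computes_in (solve p) (Node (Node (tree_of_bits I) (tree_of_list us)) a) (Node f y) T \<and>
        (f \<noteq> Leaf \<longrightarrow> (\<exists>out. y = tree_of_list (map tree_of_bits out) \<and> distinct out \<and> set out = F)) \<and>
        (covers ?s ?ws \<longrightarrow> f \<noteq> Leaf) \<and>
        length us \<le> m * ?s \<and> m * ?s < length us + ?s \<and>
        T \<le> K * (length I + 1)\<^sup>2 * (\<Sum>gs\<leftarrow>tuples ?ws m. t (chosen_bits (length us) ?s gs) (rest_size gs) + 1))"
    by (elim exE) blast
  show ?thesis
  proof (rule exI[of _ "real K * (C + 1)"], intro allI)
    fix I
    let ?U = "fst (\<Phi> I)" and ?F = "snd (\<Phi> I)"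
    let ?n = "card ?U" and ?N = "real (length I) + 1"
    have nN: "?n \<le> length I" using \<Phi> by (simp add: implicit_set_system_def)
    have F: "bits ?U ` ?F \<subseteq> {Y. length Y = ?n}" by auto
    have P: "\<forall>X k. length X = ?n \<longrightarrow>
        computes_in p (Node (tree_of_bits I) (Node (tree_of_bits X) (tree_of_nat k)))
           (tree_of_list (map tree_of_bits (L I X k))) (t I X k) \<and>
        distinct (L I X k) \<and> set (L I X k) = bit_extensions ?n (bits ?U ` ?F) X k"
      using p[of _ I] by blast
    obtain f y T m where r: "computes_in (solve p) (Node (tree_of_instance \<Phi> I) a) (Node f y) T"
      "f \<noteq> Leaf \<longrightarrow> good I y" "covers ?s ?ws \<longrightarrow> f \<noteq> Leaf" "?n \<le> m * ?s" "m * ?s < ?n + ?s"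
      "T \<le> K * (length I + 1)\<^sup>2 * (\<Sum>gs\<leftarrow>tuples ?ws m. t I (chosen_bits ?n ?s gs) (rest_size gs) + 1)"
      using K[of "us I" I "bits ?U ` ?F" "L I" "t I", unfolded length_us, folded instance_tree good_def, OF nN F P]
      by blast
    let ?v = "\<lambda>gs. \<Prod>g\<leftarrow>gs. weight b c ?s (hd g)"
    have "real (t I (chosen_bits ?n ?s gs) (rest_size gs) + 1) \<le> (C + 1) * ?N ^ d * ?v gs" if "gs \<in> set (tuples ?ws m)" for gs
    proof -
      have gs: "?n \<le> length gs * ?s" using r(4) that by (simp add: set_tuples)
      let ?V = "b ^ (?n - count (\<lambda>i. chosen_bits ?n ?s gs ! i) ?n) * c ^ rest_size gs"
      have V: "?V \<le> ?v gs" using weight_tuple[OF b c gs] .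
      have "1 * 1 \<le> ?V" using b c by (intro mult_mono) auto
      then have V1: "1 \<le> ?v gs" using V by simp
      have N1: "1 \<le> ?N ^ d" by simp
      have "length (chosen_bits ?n ?s gs) = ?n" by (simp add: chosen_bits_def bits_of_def)
      from p[of _ I, OF this] have "real (t I (chosen_bits ?n ?s gs) (rest_size gs)) \<le> ?V * (C * ?N ^ d)" by blast
      also have "\<dots> \<le> ?v gs * (C * ?N ^ d)" using V C by (intro mult_right_mono) auto
      finally have 1: "real (t I (chosen_bits ?n ?s gs) (rest_size gs)) \<le> ?v gs * (C * ?N ^ d)" .
      have "1 * 1 \<le> ?v gs * ?N ^ d" using V1 N1 by (intro mult_mono) auto
      with 1 show ?thesis by (simp add: algebra_simps)
    qed
    then have "(\<Sum>gs\<leftarrow>tuples ?ws m. real (t I (chosen_bits ?n ?s gs) (rest_size gs) + 1)) \<le>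
        (\<Sum>gs\<leftarrow>tuples ?ws m. (C + 1) * ?N ^ d * ?v gs)"
      by (rule sum_list_mono)
    also have "\<dots> = (C + 1) * ?N ^ d * (\<Sum>w\<leftarrow>?ws. weight b c ?s w) ^ m"
      by (simp only: sum_list_const_mult sum_tuples)
    finally have S: "real (\<Sum>gs\<leftarrow>tuples ?ws m. t I (chosen_bits ?n ?s gs) (rest_size gs) + 1) \<le>
       (C + 1) * ?N ^ d * (\<Sum>w\<leftarrow>?ws. weight b c ?s w) ^ m"
      by (simp only: real_sum_list)
    have "real T \<le> real (K * (length I + 1)\<^sup>2 * (\<Sum>gs\<leftarrow>tuples ?ws m. t I (chosen_bits ?n ?s gs) (rest_size gs) + 1))"
      using r(6) by (simp only: of_nat_le_iff)
    also have "\<dots> = real K * ?N\<^sup>2 * real (\<Sum>gs\<leftarrow>tuples ?ws m. t I (chosen_bits ?n ?s gs) (rest_size gs) + 1)"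
      by (simp only: of_nat_mult of_nat_power of_nat_add of_nat_1)
    also have "\<dots> \<le> real K * ?N\<^sup>2 * ((C + 1) * ?N ^ d * (\<Sum>w\<leftarrow>?ws. weight b c ?s w) ^ m)"
      by (rule mult_left_mono[OF S]) auto
    also have "\<dots> = real K * (C + 1) * ?N ^ (d + 2) * (\<Sum>w\<leftarrow>?ws. weight b c ?s w) ^ m"
      by (simp add: power_add power2_eq_square mult_ac)
    finally show "\<exists>f y T m. computes_in (solve p) (Node (tree_of_instance \<Phi> I) a) (Node f y) T \<and>
     (f \<noteq> Leaf \<longrightarrow> good I y) \<and> (covers ?s ?ws \<longrightarrow> f \<noteq> Leaf) \<and> m * ?s < ?n + ?s \<and>
     real T \<le> real K * (C + 1) * ?N ^ (d + 2) * (\<Sum>w\<leftarrow>?ws. weight b c ?s w) ^ m \<and> real K * (C + 1) \<ge> 0"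
      using r C by (intro exI[of _ f] exI[of _ y] exI[of _ T] exI[of _ m]) auto
  qed
qed

text \<open>The candidate to be hit is the covering list that suits \<epsilon>; its rank is a
  constant. The exponent \<open>d + 5\<close> consists of \<open>d + 2\<close> from
  \<open>solve_bound\<close> and 3 from the cubic factor of the search, in which \<open>r\<close> is
  at most linear in the instance length.\<close>

lemma search_bound:
  assumes \<epsilon>: "\<epsilon> > 0" and \<alpha>: "1 + b - 1 / c > 1"
  shows "\<exists>K. \<forall>I. \<exists>out T. computes_in (search (solve p)) (tree_of_instance \<Phi> I) out T \<and> good I out \<and>
     real T \<le> K * (1 + b - 1 / c) powr ((1 + \<epsilon>) * real (card (fst (\<Phi> I)))) * (real (length I) + 1) ^ (d + 5)"
proof -
  define \<alpha> where "\<alpha> = 1 + b - 1 / c"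
  have \<alpha>1: "\<alpha> > 1" using \<alpha> by (simp add: \<alpha>_def)
  obtain a where a: "covers (length (blocks a)) (patterns a)"
    "(\<Sum>w\<leftarrow>patterns a. weight b c (length (blocks a)) w) \<le> \<alpha> powr ((1 + \<epsilon>) * real (length (blocks a)))"
    using scheme_for_exponent[OF b c \<alpha> \<epsilon>] unfolding \<alpha>_def by blast
  let ?s = "length (blocks a)"
  let ?W = "\<Sum>w\<leftarrow>patterns a. weight b c ?s w"
  have W0: "?W \<ge> 0" using b c by (intro sum_list_nonneg) (auto simp: weight_def)
  obtain K1 where K1: "\<And>I. \<exists>f y T m. computes_in (solve p) (Node (tree_of_instance \<Phi> I) a) (Node f y) T \<and>
     (f \<noteq> Leaf \<longrightarrow> good I y) \<and> f \<noteq> Leaf \<and> m * ?s < card (fst (\<Phi> I)) + ?s \<and>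
     real T \<le> K1 * (real (length I) + 1) ^ (d + 2) * ?W ^ m \<and> K1 \<ge> 0"
    using solve_bound[of a] a(1) by auto
  obtain K2 where K2: "\<And>x f y t Good a r. (\<forall>a. computes_in (solve p) (Node x a) (Node (f a) (y a)) (t a) \<and>
     (f a \<noteq> Leaf \<longrightarrow> Good (y a))) \<Longrightarrow> f a \<noteq> Leaf \<Longrightarrow> t a < 2 ^ r \<Longrightarrow>
     (\<exists>out T. computes_in (search (solve p)) x out T \<and> Good out \<and>
        T \<le> K2 * (rank a + r + 1) ^ 3 * 2 ^ (rank a + r))"
    using search[of "solve p"] by blast
  have K10: "K1 \<ge> 0" using K1 by blast
  \<comment> \<open>Rounding up to whole blocks costs less than one additional block, which is
    absorbed into this constant.\<close>
  define D where "D = K1 * \<alpha> powr ((1 + \<epsilon>) * real ?s)"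
  have D: "D \<ge> 0" using K10 by (simp add: D_def)
  \<comment> \<open>This makes \<open>r\<close> linear: \<open>2 ^ r\<close> is bounded by a product
    in which every factor is at most a power of a constant with exponent
    \<open>length I + 1\<close>, and \<open>2 ^ \<beta>\<close> exceeds the product of these
    constants.\<close>
  obtain \<beta> where \<beta>: "2 * (D + 1) * 2 ^ (d + 2) * \<alpha> powr (1 + \<epsilon>) < 2 ^ \<beta>"
    using real_arch_pow[of 2 "2 * (D + 1) * 2 ^ (d + 2) * \<alpha> powr (1 + \<epsilon>)"] by auto
  define K where "K = real K2 * (real (rank a) + real \<beta> + 1) ^ 3 * (2 ^ rank a * (2 * (D + 1)))"
  show ?thesis
  proof (rule exI[of _ K], intro allI)
    fix I
    let ?n = "card (fst (\<Phi> I))" and ?N = "real (length I) + 1"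
    let ?A = "\<alpha> powr ((1 + \<epsilon>) * real ?n)"
    have nN: "?n \<le> length I" using \<Phi> by (simp add: implicit_set_system_def)
    have "\<forall>a'. \<exists>f y T. computes_in (solve p) (Node (tree_of_instance \<Phi> I) a') (Node f y) T \<and> (f \<noteq> Leaf \<longrightarrow> good I y)"
      using solve_bound by blast
    then obtain f y \<tau> where all: "\<forall>a'. computes_in (solve p) (Node (tree_of_instance \<Phi> I) a') (Node (f a') (y a')) (\<tau> a') \<and>
       (f a' \<noteq> Leaf \<longrightarrow> good I (y a'))" by metis
    obtain m where fa: "f a \<noteq> Leaf" and m: "m * ?s < ?n + ?s" "real (\<tau> a) \<le> K1 * ?N ^ (d + 2) * ?W ^ m"
      using K1[of I] all computes_in_unique by (metis tree.inject)
    have "?W ^ m \<le> (\<alpha> powr ((1 + \<epsilon>) * real ?s)) ^ m" using a(2) W0 by (rule power_mono)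
    also have "\<dots> = \<alpha> powr ((1 + \<epsilon>) * real (m * ?s))"
      using \<alpha>1 by (simp add: powr_realpow[symmetric] powr_powr mult_ac)
    also have "\<dots> \<le> \<alpha> powr ((1 + \<epsilon>) * real (?n + ?s))"
      using m(1) \<epsilon> \<alpha>1 by (intro powr_mono mult_left_mono of_nat_mono) auto
    also have "\<dots> = ?A * \<alpha> powr ((1 + \<epsilon>) * real ?s)" by (simp add: powr_add[symmetric] algebra_simps)
    finally have Wm: "?W ^ m \<le> ?A * \<alpha> powr ((1 + \<epsilon>) * real ?s)" .
    have "real (\<tau> a) \<le> K1 * ?N ^ (d + 2) * (?A * \<alpha> powr ((1 + \<epsilon>) * real ?s))"
      using m(2) mult_left_mono[OF Wm, of "K1 * ?N ^ (d + 2)"] K10 by simp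
    also have "\<dots> = D * (?N ^ (d + 2) * ?A)" by (simp add: D_def mult_ac)
    finally have \<tau>: "real (\<tau> a) \<le> D * (?N ^ (d + 2) * ?A)" .
    have A1: "1 \<le> ?A" using \<alpha>1 \<epsilon> by (intro ge_one_powr_ge_zero) auto
    have "1 * 1 \<le> ?N ^ (d + 2) * ?A" by (intro mult_mono one_le_power A1) auto
    then have \<tau>1: "real (\<tau> a) + 1 \<le> (D + 1) * (?N ^ (d + 2) * ?A)" using \<tau> by (simp add: algebra_simps)
    \<comment> \<open>The least sufficient power of two overshoots the needed budget by a factor of
      at most 2, so the final budget is still proportional to the time of the good
      candidate.\<close>
    obtain r where r: "\<tau> a < 2 ^ r" "2 ^ r \<le> 2 * (\<tau> a + 1)" using power_of_two_above by blast
    have "real (2 ^ r) \<le> real (2 * (\<tau> a + 1))" using r(2) by (simp only: of_nat_le_iff)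
    then have "(2::real) ^ r \<le> 2 * (real (\<tau> a) + 1)" by simp
    also have "\<dots> \<le> 2 * ((D + 1) * (?N ^ (d + 2) * ?A))" using \<tau>1 by (rule mult_left_mono) simp
    finally have r2: "(2::real) ^ r \<le> 2 * (D + 1) * (?N ^ (d + 2) * ?A)" by (simp only: mult.assoc)
    have "r \<le> \<beta> * (length I + 1)"
    proof -
      let ?M = "length I + 1"
      have 1: "2 * (D + 1) \<le> (2 * (D + 1)) ^ ?M" using D by (intro self_le_power) auto
      have "?N ^ (d + 2) \<le> (2 ^ ?M) ^ (d + 2)" using real_le_two_power by (intro power_mono) auto
      also have "\<dots> = (2 ^ (d + 2)) ^ ?M" by (simp only: power_mult[symmetric] mult.commute)
      finally have 2: "?N ^ (d + 2) \<le> (2 ^ (d + 2)) ^ ?M" .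
      have "?A \<le> \<alpha> powr ((1 + \<epsilon>) * real ?M)" using \<alpha>1 \<epsilon> nN by (intro powr_mono mult_left_mono) auto
      also have "\<dots> = (\<alpha> powr (1 + \<epsilon>)) ^ ?M" using \<alpha>1 by (simp add: powr_realpow[symmetric] powr_powr del: power_Suc of_nat_Suc)
      finally have 3: "?A \<le> (\<alpha> powr (1 + \<epsilon>)) ^ ?M" .
      note r2
      also have "2 * (D + 1) * (?N ^ (d + 2) * ?A) \<le> (2 * (D + 1)) ^ ?M * ((2 ^ (d + 2)) ^ ?M * (\<alpha> powr (1 + \<epsilon>)) ^ ?M)"
        by (rule mult_mono[OF 1 mult_mono[OF 2 3]]) (use D in auto)
      also have "\<dots> = (2 * (D + 1) * 2 ^ (d + 2) * \<alpha> powr (1 + \<epsilon>)) ^ ?M" by (simp only: power_mult_distrib mult_ac)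
      also have "\<dots> \<le> (2 ^ \<beta>) ^ ?M" using \<beta> D by (intro power_mono) auto
      also have "\<dots> = 2 ^ (\<beta> * ?M)" by (simp only: power_mult)
      finally show ?thesis by (rule power_le_imp_le_exp[rotated]) simp
    qed
    then have "real r \<le> real \<beta> * ?N" by (metis of_nat_1 of_nat_add of_nat_le_iff of_nat_mult)
    moreover have "real (rank a) + 1 \<le> (real (rank a) + 1) * ?N" by (simp add: algebra_simps)
    moreover have "(real (rank a) + real \<beta> + 1) * ?N = (real (rank a) + 1) * ?N + real \<beta> * ?N" by (simp add: algebra_simps)
    ultimately have rr: "real (rank a) + real r + 1 \<le> (real (rank a) + real \<beta> + 1) * ?N" by linarith
    obtain out T where T: "computes_in (search (solve p)) (tree_of_instance \<Phi> I) out T" "good I out"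
      "T \<le> K2 * (rank a + r + 1) ^ 3 * 2 ^ (rank a + r)"
      using K2[OF all fa r(1)] by blast
    have "real T \<le> real (K2 * (rank a + r + 1) ^ 3 * 2 ^ (rank a + r))" using T(3) by (simp only: of_nat_le_iff)
    also have "\<dots> = real K2 * (real (rank a) + real r + 1) ^ 3 * (2 ^ rank a * 2 ^ r)" by (simp add: power_add add_ac)
    also have "\<dots> \<le> real K2 * ((real (rank a) + real \<beta> + 1) * ?N) ^ 3 * (2 ^ rank a * (2 * (D + 1) * (?N ^ (d + 2) * ?A)))"
      using rr r2 by (intro mult_mono power_mono) auto
    also have "\<dots> = K * (?A * (?N ^ 3 * ?N ^ (d + 2)))"
      unfolding K_def power_mult_distrib by (simp only: mult_ac)
    also have "?N ^ 3 * ?N ^ (d + 2) = ?N ^ (d + 5)"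
      unfolding power_add[symmetric] by (rule arg_cong[of _ _ "power _"]) simp
    finally have "real T \<le> K * ?A * ?N ^ (d + 5)" by (simp add: mult.assoc)
    then show "\<exists>out T. computes_in (search (solve p)) (tree_of_instance \<Phi> I) out T \<and> good I out \<and>
     real T \<le> K * (1 + b - 1 / c) powr ((1 + \<epsilon>) * real ?n) * ?N ^ (d + 5)"
      using T unfolding \<alpha>_def by blast
  qed
qed

lemma good_enumerates:
  assumes "computes_in q x out T" "good I out"
  shows "enumerates_in q x (fst (\<Phi> I)) (snd (\<Phi> I)) T"
proof -
  let ?U = "fst (\<Phi> I)"
  have U: "finite ?U" "snd (\<Phi> I) \<subseteq> Pow ?U" using \<Phi> by (auto simp: implicit_set_system_def)
  obtain ys where ys: "out = tree_of_list (map tree_of_bits ys)" "distinct ys" "set ys = bits ?U ` snd (\<Phi> I)"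
    using assms(2) by (auto simp: good_def)
  let ?L = "map (set_of ?U) ys"
  have inv: "bits ?U (set_of ?U y) = y" if "y \<in> set ys" for y
    using that ys(3) U(1) by (auto intro!: bits_set_of)
  then have "inj_on (set_of ?U) (set ys)" by (rule inj_on_inverseI)
  then have "distinct ?L" using ys(2) by (simp add: distinct_map)
  moreover have "set ?L = snd (\<Phi> I)"
  proof -
    have "set ?L = (\<lambda>S. set_of ?U (bits ?U S)) ` snd (\<Phi> I)" by (simp add: ys(3) image_image)
    also have "\<dots> = (\<lambda>S. S) ` snd (\<Phi> I)" using U by (intro image_cong refl set_of_bits) auto
    finally show ?thesis by simp
  qed
  moreover have "map (tree_of_subset ?U) ?L = map tree_of_bits ys"
    using inv by (simp add: tree_of_subset_bits)
  ultimately show ?thesis using assms(1) ys(1) unfolding enumerates_in_def by metis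
qed

lemma search_enumerates:
  assumes \<alpha>: "1 + b - 1 / c > 1"
  shows "\<exists>g. g \<in> o(\<lambda>n. real n) \<and> (\<forall>I. \<exists>T. enumerates_in (search (solve p)) (tree_of_instance \<Phi> I) (fst (\<Phi> I)) (snd (\<Phi> I)) T \<and>
    real T \<le> (1 + b - 1 / c) powr (real (card (fst (\<Phi> I))) + g (card (fst (\<Phi> I)))) * (real (length I) + 1) ^ (d + 5))"
proof -
  have "\<forall>I. \<exists>out T. computes_in (search (solve p)) (tree_of_instance \<Phi> I) out T \<and> good I out"
    using search_bound[OF zero_less_one \<alpha>] by blast
  then obtain out T where T: "\<And>I. computes_in (search (solve p)) (tree_of_instance \<Phi> I) (out I) (T I)" "\<And>I. good I (out I)"
    by metis
  have "\<exists>g. g \<in> o(\<lambda>n. real n) \<and> (\<forall>I. real (T I) \<le> (1 + b - 1 / c) powr (real (card (fst (\<Phi> I))) + g (card (fst (\<Phi> I)))) * (real (length I) + 1) ^ (d + 5))"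
  proof (rule little_o_exponent[OF \<alpha>])
    fix \<epsilon> :: real assume "\<epsilon> > 0"
    from search_bound[OF this \<alpha>] obtain K where "\<forall>I. \<exists>out T. computes_in (search (solve p)) (tree_of_instance \<Phi> I) out T \<and> good I out \<and>
     real T \<le> K * (1 + b - 1 / c) powr ((1 + \<epsilon>) * real (card (fst (\<Phi> I)))) * (real (length I) + 1) ^ (d + 5)" by blast
    \<comment> \<open>Each \<epsilon> comes with its own witness for the running time; by
      determinism they are all the same \<open>T I\<close>, so that the bounds for different
      \<epsilon> concern one function.\<close>
    then have "real (T I) \<le> K * (1 + b - 1 / c) powr ((1 + \<epsilon>) * real (card (fst (\<Phi> I)))) * (real (length I) + 1) ^ (d + 5)" for I
      using computes_in_unique[OF T(1)] by metis
    then show "\<exists>K. \<forall>I. real (T I) \<le> K * (1 + b - 1 / c) powr ((1 + \<epsilon>) * real (card (fst (\<Phi> I)))) * (real (length I) + 1) ^ (d + 5)"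
      by blast
  qed auto
  then show ?thesis using good_enumerates[OF T] by blast
qed

end

lemma uniform_enumerator_exists:
  assumes "b \<ge> 1" "c \<ge> 1" and \<Phi>: "implicit_set_system \<Phi>" and eff: "efficiently_uniform b c \<Phi>"
  shows "\<exists>p L t C d. uniform_enumerator b c \<Phi> p L t C d"
proof -
  obtain p :: com and C :: real and d :: nat where eff: "\<forall>I X k. X \<subseteq> fst (\<Phi> I) \<longrightarrow>
        (\<exists>t. enumerates_in p
               (Node (tree_of_bits I) (Node (tree_of_subset (fst (\<Phi> I)) X) (tree_of_nat k)))
               (fst (\<Phi> I)) (extensions (\<Phi> I) X k) t \<and>
             real t \<le> b ^ (card (fst (\<Phi> I)) - card X) * c ^ k * (C * (real (length I) + 1) ^ d))"
    using eff unfolding efficiently_uniform_def by blast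
  have "\<forall>I X k. \<exists>L t. length X = card (fst (\<Phi> I)) \<longrightarrow>
        computes_in p (Node (tree_of_bits I) (Node (tree_of_bits X) (tree_of_nat k)))
          (tree_of_list (map tree_of_bits L)) t \<and>
        distinct L \<and>
        set L = bit_extensions (card (fst (\<Phi> I))) (bits (fst (\<Phi> I)) ` snd (\<Phi> I)) X k \<and>
        real t \<le> b ^ (card (fst (\<Phi> I)) - count (\<lambda>i. X ! i) (card (fst (\<Phi> I)))) * c ^ k *
           (\<bar>C\<bar> * (real (length I) + 1) ^ d)"
  proof (intro allI)
    fix I X k
    let ?U = "fst (\<Phi> I)"
    have U: "finite ?U" "snd (\<Phi> I) \<subseteq> Pow ?U" using \<Phi> by (auto simp: implicit_set_system_def)
    show "\<exists>L t. length X = card ?U \<longrightarrow>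
        computes_in p (Node (tree_of_bits I) (Node (tree_of_bits X) (tree_of_nat k)))
          (tree_of_list (map tree_of_bits L)) t \<and>
        distinct L \<and> set L = bit_extensions (card ?U) (bits ?U ` snd (\<Phi> I)) X k \<and>
        real t \<le> b ^ (card ?U - count (\<lambda>i. X ! i) (card ?U)) * c ^ k * (\<bar>C\<bar> * (real (length I) + 1) ^ d)"
    proof (cases "length X = card ?U")
      case True
      obtain t where t: "enumerates_in p (Node (tree_of_bits I) (Node (tree_of_subset ?U (set_of ?U X)) (tree_of_nat k)))
               ?U (extensions (\<Phi> I) (set_of ?U X) k) t"
         "real t \<le> b ^ (card ?U - card (set_of ?U X)) * c ^ k * (C * (real (length I) + 1) ^ d)"
        using eff set_of_subset[OF U(1)] by blast
      then obtain L where L: "distinct L" "set L = extensions (\<Phi> I) (set_of ?U X) k"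
        "computes_in p (Node (tree_of_bits I) (Node (tree_of_bits X) (tree_of_nat k))) (tree_of_list (map (tree_of_subset ?U) L)) t"
        by (auto simp: enumerates_in_def tree_of_subset_bits bits_set_of[OF U(1) True])
      have "extensions (\<Phi> I) (set_of ?U X) k \<subseteq> Pow ?U" by (auto simp: extensions_def)
      then have "distinct (map (bits ?U) L)"
        using L inj_on_subset[OF inj_on_bits[OF U(1)]] by (simp add: distinct_map)
      moreover have "set (map (bits ?U) L) = bit_extensions (card ?U) (bits ?U ` snd (\<Phi> I)) X k"
        using bits_extensions[OF U True, of k] L(2) by simp
      moreover have "map (tree_of_subset ?U) L = map tree_of_bits (map (bits ?U) L)" by (simp add: tree_of_subset_bits)
      moreover have "real t \<le> b ^ (card ?U - count (\<lambda>i. X ! i) (card ?U)) * c ^ k * (\<bar>C\<bar> * (real (length I) + 1) ^ d)"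
      proof -
        have "C * (real (length I) + 1) ^ d \<le> \<bar>C\<bar> * (real (length I) + 1) ^ d" by (intro mult_right_mono) auto
        then have "b ^ (card ?U - card (set_of ?U X)) * c ^ k * (C * (real (length I) + 1) ^ d) \<le>
          b ^ (card ?U - card (set_of ?U X)) * c ^ k * (\<bar>C\<bar> * (real (length I) + 1) ^ d)"
          using assms(1,2) by (intro mult_left_mono) auto
        then show ?thesis using t(2) by (simp add: card_set_of[OF U(1)])
      qed
      ultimately show ?thesis using L(3) by metis
    qed simp
  qed
  then obtain L t where "\<And>I X k. length X = card (fst (\<Phi> I)) \<Longrightarrow>
        computes_in p (Node (tree_of_bits I) (Node (tree_of_bits X) (tree_of_nat k)))
          (tree_of_list (map tree_of_bits (L I X k))) (t I X k) \<and>
        distinct (L I X k) \<and>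
        set (L I X k) = bit_extensions (card (fst (\<Phi> I))) (bits (fst (\<Phi> I)) ` snd (\<Phi> I)) X k \<and>
        real (t I X k) \<le> b ^ (card (fst (\<Phi> I)) - count (\<lambda>i. X ! i) (card (fst (\<Phi> I)))) * c ^ k *
           (\<bar>C\<bar> * (real (length I) + 1) ^ d)"
    by metis
  then have "uniform_enumerator b c \<Phi> p L t \<bar>C\<bar> d" using assms by unfold_locales auto
  then show ?thesis by blast
qed

text \<open>For \<open>b = c = 1\<close> every query is answered in polynomial time. With the empty
  set as \<open>X\<close>, the query for \<open>k\<close> lists the members of cardinality
  \<open>k\<close>, so the \<open>n + 1\<close> queries split the family without overlap.\<close>

lemma all_sizes_enumerates:
  assumes "uniform_enumerator 1 1 \<Phi> p L t C d"
  shows "\<exists>K. \<forall>I. \<exists>T. enumerates_in (all_sizes p) (tree_of_instance \<Phi> I) (fst (\<Phi> I)) (snd (\<Phi> I)) T \<and>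
    real T \<le> K * (real (length I) + 1) ^ (d + 2)"
proof (rule exI[of _ "14 * (C + 5) + 2 * real (var_bound p) + 100"], intro allI)
  fix I
  interpret uniform_enumerator 1 1 \<Phi> p L t C d by fact
  let ?U = "fst (\<Phi> I)" and ?F = "bits (fst (\<Phi> I)) ` snd (\<Phi> I)"
  let ?n = "card ?U" and ?N = "real (length I) + 1"
  have nN: "?n \<le> length I" using \<Phi> by (simp add: implicit_set_system_def)
  let ?X = "replicate ?n False"
  \<comment> \<open>An all-zero vector of length \<open>n\<close> and the number \<open>n\<close> in
    unary are the same tree.\<close>
  have X: "tree_of_bits ?X = tree_of_nat (length (us I))" by (simp add: tree_of_bits_conv tree_of_nat_conv)
  note p0 = p[of ?X I, simplified]
  define B where "B = nat \<lceil>C * ?N ^ d\<rceil> + 4 * (length I + 1)"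
  have t: "real (t I ?X k) \<le> C * ?N ^ d" for k using p0 by blast
  have tB: "t I ?X k \<le> B \<and> length (map tree_of_bits (L I ?X k)) \<le> B" if "k \<le> length (us I)" for k
  proof -
    have "real (t I ?X k) \<le> real (nat \<lceil>C * ?N ^ d\<rceil>)" using t real_nat_ceiling_ge by (rule order.trans)
    then have tk: "t I ?X k \<le> nat \<lceil>C * ?N ^ d\<rceil>" by simp
    have "length (map tree_of_bits (L I ?X k)) \<le> height (Node (tree_of_bits I) (Node (tree_of_bits ?X) (tree_of_nat k))) + t I ?X k"
      using p0 by (intro length_computes_in[of p]) blast
    also have "\<dots> \<le> 4 * (length I + 1) + t I ?X k"
      using height_tree_of_bits[of I] height_tree_of_bits[of ?X] that nN by (simp add: height_tree_of_nat)
    finally show ?thesis using tk by (simp add: B_def)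
  qed
  from runs_all_sizes[where It = "tree_of_bits I" and us = "us I" and L = "\<lambda>k. map tree_of_bits (L I ?X k)" and t = "t I ?X" and p = p, OF _ tB]
  obtain T where T: "computes_in (all_sizes p) (tree_of_instance \<Phi> I)
      (tree_of_list (rev (concat (map (\<lambda>k. map tree_of_bits (L I ?X k)) [0..<Suc ?n])))) T"
    "T \<le> (?n + 1) * (14 * B + 2 * var_bound p + 100)"
    using p0 unfolding X[symmetric] instance_tree by auto
  let ?out = "rev (concat (map (L I ?X) [0..<Suc ?n]))"
  have ext: "set (L I ?X k) = {Y \<in> ?F. count (\<lambda>i. Y ! i) ?n = k}" for k
  proof -
    have "map (\<lambda>i. Y ! i \<or> ?X ! i) [0..<?n] = Y" if "length Y = ?n" for Y
      using that by (intro nth_equalityI) auto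
    then have "bit_extensions ?n ?F ?X k = {Y \<in> ?F. count (\<lambda>i. Y ! i) ?n = k}"
      unfolding bit_extensions_def by auto
    then show ?thesis using p0 by blast
  qed
  have "distinct (concat (map (L I ?X) [0..<Suc ?n]))"
  proof (rule distinct_concat_map)
    show "distinct (L I ?X k)" for k using p0 by blast
    show "set (L I ?X k) \<inter> set (L I ?X k') = {}" if "k \<noteq> k'" for k k'
      using that unfolding ext by auto
  qed simp
  moreover have "set (concat (map (L I ?X) [0..<Suc ?n])) = ?F"
  proof -
    have "{i. i < ?n \<and> P i} \<subseteq> {..<?n}" for P by auto
    from card_mono[OF finite_lessThan this] have "count P ?n < Suc ?n" for P
      by (simp add: count_def less_Suc_eq_le)
    then show ?thesis by (auto simp: ext simp del: upt_Suc)
  qed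
  ultimately have "good I (tree_of_list (map tree_of_bits ?out))"
    unfolding good_def by (intro exI[of _ ?out]) (auto simp del: upt_Suc)
  then have "good I (tree_of_list (rev (concat (map (\<lambda>k. map tree_of_bits (L I ?X k)) [0..<Suc ?n]))))"
    by (simp only: rev_map[symmetric] map_concat map_map o_def)
  from good_enumerates[OF T(1) this]
  have en: "enumerates_in (all_sizes p) (tree_of_instance \<Phi> I) ?U (snd (\<Phi> I)) T" .
  have N1: "1 \<le> ?N ^ d" by simp
  have CN: "0 \<le> C * ?N ^ d" using C by simp
  have "real B \<le> C * ?N ^ d + 1 + 4 * ?N" using CN by (simp add: B_def) linarith
  also have "\<dots> \<le> C * ?N ^ d * ?N + ?N ^ d * ?N + 4 * (?N ^ d * ?N)"
  proof -
    have "C * ?N ^ d * 1 \<le> C * ?N ^ d * ?N" using CN by (intro mult_left_mono) auto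
    then have 1: "C * ?N ^ d \<le> C * ?N ^ d * ?N" by simp
    have "1 * ?N \<le> ?N ^ d * ?N" using N1 by (intro mult_right_mono) auto
    then have 2: "?N \<le> ?N ^ d * ?N" by simp
    then have 3: "1 \<le> ?N ^ d * ?N" by (rule order.trans[rotated]) simp
    show ?thesis by (intro add_mono mult_left_mono 1 2 3) simp
  qed
  also have "\<dots> = (C + 5) * ?N ^ (d + 1)" by (simp add: algebra_simps)
  finally have B: "real B \<le> (C + 5) * ?N ^ (d + 1)" .
  have "real T \<le> real ((?n + 1) * (14 * B + 2 * var_bound p + 100))" using T(2) by (simp only: of_nat_le_iff)
  also have "\<dots> = (real ?n + 1) * (14 * real B + 2 * real (var_bound p) + 100)" by (simp add: algebra_simps)
  also have "\<dots> \<le> ?N * (14 * ((C + 5) * ?N ^ (d + 1)) + (2 * real (var_bound p) + 100) * ?N ^ (d + 1))"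
  proof (rule mult_mono)
    have "(2 * real (var_bound p) + 100) * 1 \<le> (2 * real (var_bound p) + 100) * ?N ^ (d + 1)"
      by (intro mult_left_mono one_le_power) auto
    from add_mono[OF mult_left_mono[OF B, of 14] this]
    show "14 * real B + 2 * real (var_bound p) + 100 \<le> 14 * ((C + 5) * ?N ^ (d + 1)) + (2 * real (var_bound p) + 100) * ?N ^ (d + 1)"
      by (simp only: mult_1_right add.assoc zero_le_numeral simp_thms)
  qed (use nN in auto)
  also have "\<dots> = (14 * (C + 5) + 2 * real (var_bound p) + 100) * ?N ^ (d + 2)" by (simp add: algebra_simps)
  finally show "\<exists>T. enumerates_in (all_sizes p) (tree_of_instance \<Phi> I) ?U (snd (\<Phi> I)) T \<and>
    real T \<le> (14 * (C + 5) + 2 * real (var_bound p) + 100) * ?N ^ (d + 2)" using en by blast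
qed

theorem theorem4:
  fixes b c :: real
    and \<Phi> :: "bool list \<Rightarrow> 'a::linorder set_system"
  assumes "b \<ge> 1" and "c \<ge> 1"
    and "implicit_set_system \<Phi>"
    and "efficiently_uniform b c \<Phi>"
  shows "\<exists>p (C::real) (d::nat) (g :: nat \<Rightarrow> real). g \<in> o(\<lambda>n. real n) \<and>
    (\<forall>I. \<exists>t. enumerates_in p (tree_of_instance \<Phi> I) (fst (\<Phi> I)) (snd (\<Phi> I)) t \<and>
       real t \<le> (1 + b - 1 / c) powr (real (card (fst (\<Phi> I))) + g (card (fst (\<Phi> I))))
                 * (C * (real (length I) + 1) ^ d))"
proof -
  obtain p L t C d where o: "uniform_enumerator b c \<Phi> p L t C d" using uniform_enumerator_exists[OF assms] by blast
  show ?thesis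
  proof (cases "1 + b - 1 / c > 1")
    case True
    from uniform_enumerator.search_enumerates[OF o this] obtain g where "g \<in> o(\<lambda>n. real n)"
      "\<forall>I. \<exists>T. enumerates_in (search (solve p)) (tree_of_instance \<Phi> I) (fst (\<Phi> I)) (snd (\<Phi> I)) T \<and>
       real T \<le> (1 + b - 1 / c) powr (real (card (fst (\<Phi> I))) + g (card (fst (\<Phi> I)))) * (real (length I) + 1) ^ (d + 5)"
      by blast
    then show ?thesis
      by (intro exI[of _ "search (solve p)"] exI[of _ 1] exI[of _ "d + 5"] exI[of _ g]) simp
  next
    case False
    \<comment> \<open>Since \<open>b \<ge> 1\<close> and \<open>1 / c \<le> 1\<close>, the base is
      at least 1 and equals 1 only for \<open>b = c = 1\<close>.\<close>
    have "1 / c \<le> 1" using assms(2) by simp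
    then have "b = 1" "1 / c = 1" using False assms(1) by linarith+
    then have bc: "b = 1" "c = 1" by simp_all
    obtain K where "\<forall>I. \<exists>T. enumerates_in (all_sizes p) (tree_of_instance \<Phi> I) (fst (\<Phi> I)) (snd (\<Phi> I)) T \<and>
      real T \<le> K * (real (length I) + 1) ^ (d + 2)"
      using all_sizes_enumerates[OF o[unfolded bc]] by blast
    then show ?thesis unfolding bc
      by (intro exI[of _ "all_sizes p"] exI[of _ K] exI[of _ "d + 2"] exI[of _ "\<lambda>_. 0"]) simp
  qed
qed

end
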